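(* Let $K$ be a field with $\operatorname{char}K=p>0$, and let $G=G(n,p^r)$ where $p\nmid n$, $s=[\mathbb{F}_p(\zeta_n^2):\mathbb{F}_p]$ divides $r$, and $r\ge 1$. Then $\operatorname{ed}_K(G)=1$ if and only if $n$ is odd, $\zeta_n\in K$, and $[K:\mathbb{F}_p]\ge r$.
   Context: Essential dimension: for a finite group $G$ and a field $K$, choose a faithful finite-dimensional representation $G\to GL(V)$ over $K$ and let $K(V)$ be the field of rational functions on $V$ with the induced $G$-action. A faithful $G$-subfield is a subfield $E$ with $K\subseteq E\subseteq K(V)$, stable under $G$, on which $G$ acts faithfully. Then $\operatorname{ed}_K(G)$ is the minimum of $\operatorname{trdeg}_K E$ over all faithful $G$-subfields $E$; it is independent of $V$. $[K:\mathbb{F}_p]$ may be infinite. The group $G(n,p^r)$: $\zeta_n$ is a primitive $n$-th root of unity in an algebraic closure of $\mathbb{F}_p$ (resp. of $K$). Let $W$ be an $\mathbb{F}_p(\zeta_n^2)$-vector space of dimension $r/s$. Then $G(n,p^r)=W\rtimes\langle\tau\rangle$, where $\tau$ has order $n$ and acts on $W$ by $w\mapsto\zeta_n^2w$. Equivalently, for an algebraically closed field $L$ of characteristic $p$, it is isomorphic to the subgroup of $SL_2(L)$ generated by $\begin{pmatrix}1&v\\0&1\end{pmatrix}$, $v\in V$, and $\begin{pmatrix}\zeta_n&0\\0&\zeta_n^{-1}\end{pmatrix}$, where $V\subset L$ is any $\mathbb{F}_p(\zeta_n^2)$-subspace with $\dim_{\mathbb{F}_p}V=r$; the isomorphism type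 does not depend on these choices. *)

theory Defs
  imports "HOL-Library.Poly_Mapping" "HOL-Computational_Algebra.Polynomial"
begin

definition is_subfield :: "'a::field set \<Rightarrow> bool" where
  "is_subfield F \<longleftrightarrow> 0 \<in> F \<and> 1 \<in> F \<and>
     (\<forall>a\<in>F. \<forall>b\<in>F. a + b \<in> F \<and> a * b \<in> F) \<and>
     (\<forall>a\<in>F. - a \<in> F \<and> inverse a \<in> F)"

definition gen_subfield :: "'a::field set \<Rightarrow> 'a set" where
  "gen_subfield X = \<Inter>{F. is_subfield F \<and> X \<subseteq> F}"

text \<open>Linear independence over the prime field (whose elements are the of_nat k).\<close>
definition fp_indep :: "'a::field set \<Rightarrow> bool" where
  "fp_indep B \<longleftrightarrow> (\<forall>c::'a \<Rightarrow> nat.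
      (\<Sum>b\<in>B. of_nat (c b) * b) = 0 \<longrightarrow> (\<forall>b\<in>B. of_nat (c b) = (0::'a)))"

definition fp_dim :: "'a::field set \<Rightarrow> nat \<Rightarrow> bool" where
  "fp_dim S d \<longleftrightarrow> (\<exists>B. finite B \<and> B \<subseteq> S \<and> card B = d \<and> fp_indep B \<and>
      S = {\<Sum>b\<in>B. of_nat (c b) * b | c :: 'a \<Rightarrow> nat. True})"

definition fp_degree_ge :: "'a::field set \<Rightarrow> nat \<Rightarrow> bool" where
  "fp_degree_ge K r \<longleftrightarrow> (\<exists>B. finite B \<and> B \<subseteq> K \<and> card B = r \<and> fp_indep B)"

definition primitive_root :: "'a::field \<Rightarrow> nat \<Rightarrow> bool" where
  "primitive_root z n \<longleftrightarrow> z ^ n = 1 \<and> (\<forall>k. 0 < k \<and> k < n \<longrightarrow> z ^ k \<noteq> 1)"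

definition alg_closed :: "'a::field itself \<Rightarrow> bool" where
  "alg_closed _ \<longleftrightarrow> (\<forall>q :: 'a poly. 0 < degree q \<longrightarrow> (\<exists>z. poly q z = 0))"

text \<open>Polynomials with coefficients in the field, variables indexed by field elements;
  evaluation substitutes each variable by itself.\<close>
definition peval :: "(('a::field \<Rightarrow>\<^sub>0 nat) \<Rightarrow>\<^sub>0 'a) \<Rightarrow> 'a" where
  "peval q = (\<Sum>m\<in>Poly_Mapping.keys q. Poly_Mapping.lookup q m * (\<Prod>v\<in>Poly_Mapping.keys m. v ^ Poly_Mapping.lookup m v))"

definition alg_indep :: "'a::field set \<Rightarrow> 'a set \<Rightarrow> bool" where
  "alg_indep K S \<longleftrightarrow> (\<forall>q :: ('a \<Rightarrow>\<^sub>0 nat) \<Rightarrow>\<^sub>0 'a.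
      q \<noteq> 0 \<and> (\<forall>m. Poly_Mapping.lookup q m \<in> K) \<and> (\<forall>m\<in>Poly_Mapping.keys q. Poly_Mapping.keys m \<subseteq> S) \<longrightarrow> peval q \<noteq> 0)"

definition trdeg_is :: "'a::field set \<Rightarrow> 'a set \<Rightarrow> nat \<Rightarrow> bool" where
  "trdeg_is K E d \<longleftrightarrow> (\<exists>S. finite S \<and> S \<subseteq> E \<and> card S = d \<and> alg_indep K S \<and>
      (\<forall>e\<in>E - S. \<not> alg_indep K (insert e S)))"

text \<open>x h (h in G) are the coordinate functions of the regular representation K[G],
  so K(V) = K(x_h : h in G) (inside an ambient field); sigma g is the induced action
  of g on K(V): a K-algebra endomorphism with x_h \<mapsto> x_(g h).\<close>
definition regular_setup ::
  "'f::field set \<Rightarrow> 'g set \<Rightarrow> ('g \<Rightarrow> 'g \<Rightarrow> 'g) \<Rightarrow> ('g \<Rightarrow> 'f) \<Rightarrow> ('g \<Rightarrow> 'f \<Rightarrow> 'f) \<Rightarrow> bool" where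
  "regular_setup K G gmul x \<sigma> \<longleftrightarrow> is_subfield K \<and> inj_on x G \<and> alg_indep K (x ` G) \<and>
     (\<forall>g\<in>G.
        (\<forall>a\<in>gen_subfield (K \<union> x ` G). \<sigma> g a \<in> gen_subfield (K \<union> x ` G)) \<and>
        (\<forall>a\<in>gen_subfield (K \<union> x ` G). \<forall>b\<in>gen_subfield (K \<union> x ` G).
            \<sigma> g (a + b) = \<sigma> g a + \<sigma> g b \<and> \<sigma> g (a * b) = \<sigma> g a * \<sigma> g b) \<and>
        (\<forall>c\<in>K. \<sigma> g c = c) \<and>
        (\<forall>h\<in>G. \<sigma> g (x h) = x (gmul g h)))"

definition faithful_G_subfield ::
  "'f::field set \<Rightarrow> 'g set \<Rightarrow> 'g \<Rightarrow> ('g \<Rightarrow> 'f) \<Rightarrow> ('g \<Rightarrow> 'f \<Rightarrow> 'f) \<Rightarrow> 'f set \<Rightarrow> bool" where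
  "faithful_G_subfield K G one x \<sigma> E \<longleftrightarrow>
     is_subfield E \<and> K \<subseteq> E \<and> E \<subseteq> gen_subfield (K \<union> x ` G) \<and>
     (\<forall>g\<in>G. \<sigma> g ` E \<subseteq> E) \<and>
     (\<forall>g\<in>G. g \<noteq> one \<longrightarrow> (\<exists>e\<in>E. \<sigma> g e \<noteq> e))"

definition ess_dim ::
  "'f::field set \<Rightarrow> 'g set \<Rightarrow> 'g \<Rightarrow> ('g \<Rightarrow> 'f) \<Rightarrow> ('g \<Rightarrow> 'f \<Rightarrow> 'f) \<Rightarrow> nat" where
  "ess_dim K G one x \<sigma> = (LEAST d. \<exists>E. faithful_G_subfield K G one x \<sigma> E \<and> trdeg_is K E d)"

text \<open>A 2x2 matrix ((a,b),(c,d)) stands for [[a,b],[c,d]].\<close>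
type_synonym 'a mat2 = "('a \<times> 'a) \<times> ('a \<times> 'a)"

fun mmul :: "'a::comm_ring_1 mat2 \<Rightarrow> 'a mat2 \<Rightarrow> 'a mat2" where
  "mmul ((a, b), (c, d)) ((a', b'), (c', d')) =
     ((a * a' + b * c', a * b' + b * d'), (c * a' + d * c', c * b' + d * d'))"

definition mone :: "'a::comm_ring_1 mat2" where
  "mone = ((1, 0), (0, 1))"

text \<open>Inverse of a determinant-1 matrix.\<close>
fun minv :: "'a::comm_ring_1 mat2 \<Rightarrow> 'a mat2" where
  "minv ((a, b), (c, d)) = ((d, - b), (- c, a))"

inductive_set sl2_gen :: "'a::comm_ring_1 mat2 set \<Rightarrow> 'a mat2 set" for S where
  one: "mone \<in> sl2_gen S"
| gen: "s \<in> S \<Longrightarrow> s \<in> sl2_gen S"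
| mult: "u \<in> sl2_gen S \<Longrightarrow> v \<in> sl2_gen S \<Longrightarrow> mmul u v \<in> sl2_gen S"
| inv: "u \<in> sl2_gen S \<Longrightarrow> minv u \<in> sl2_gen S"

definition Gnp :: "'a::field \<Rightarrow> 'a set \<Rightarrow> 'a mat2 set" where
  "Gnp \<zeta> V = sl2_gen ({((1, v), (0, 1)) | v. v \<in> V} \<union> {((\<zeta>, 0), (0, inverse \<zeta>))})"

definition subspace_over :: "'a::field set \<Rightarrow> 'a set \<Rightarrow> bool" where
  "subspace_over F V \<longleftrightarrow> 0 \<in> V \<and> (\<forall>u\<in>V. \<forall>v\<in>V. u + v \<in> V) \<and> (\<forall>c\<in>F. \<forall>v\<in>V. c * v \<in> V)"

end

theory Submission
  imports Defs "HOL-Computational_Algebra.Polynomial_Factorial" "HOL-Library.FuncSet"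
begin

text \<open>
  A faithful \<open>G\<close>-subfield of transcendence degree 1 is \<open>K(u)\<close> by Lueroth's theorem, after its embedding
  into \<open>K(s)\<close> by specializing all but one of the variables, so \<open>G\<close> acts on \<open>u\<close> by fractional linear
  substitutions over \<open>K\<close>. An element \<open>v \<noteq> 0\<close> of \<open>V\<close> has order \<open>p\<close>, hence discriminant 0 and a single
  fixed point; moving it to infinity makes \<open>v\<close> a translation \<open>U \<mapsto> U + \<beta>\<close>. Whatever normalizes
  translations is affine, so \<open>V\<close> embeds additively into \<open>K\<close> and \<open>\<tau>\<close> acts by \<open>U \<mapsto> \<alpha> U + \<delta>\<close> with \<open>\<alpha>\<close> of
  order \<open>n\<close>; conjugation by \<open>\<tau>\<close> on \<open>V\<close> becomes multiplication by \<open>\<alpha>\<close>, and this forces \<open>n\<close> to be odd.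
  Conversely, an additive embedding of \<open>V\<close> into \<open>K\<close> compatible with some \<open>\<alpha>\<close> conjugate to \<open>\<zeta>\<^sup>2\<close> makes
  \<open>G\<close> a group of affine maps of the line, and the ratio of two linear forms of the regular
  representation is a coordinate on which \<open>G\<close> acts in this way.
\<close>

section \<open>Subfields and polynomials over subfields\<close>

text \<open>\<open>K\<close> may be finite, so specializing a variable to a value in
  \<open>K\<close> can fail for want of suitable values: the variables are eliminated one at a time,
  each value lying in the field generated by \<open>K\<close> and the remaining ones. The
  specialization is injective on \<open>E\<close> as soon as an element \<open>t\<close> over which
  \<open>E\<close> is algebraic keeps a transcendental value. The vanishing of the discriminant
  comes from a congruence modulo the characteristic polynomial, so no eigenvalues outside
  \<open>K\<close> appear. Parity enters because \<open>\<tau>\<close> acts on \<open>V\<close>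
  through \<open>\<zeta> ^ 2\<close>: for \<open>n = 2 * k\<close> the power
  \<open>\<tau> ^ k\<close> centralizes \<open>V\<close>, although \<alpha> has order
  \<open>n\<close>; conversely, for odd \<open>n\<close> no nontrivial power of
  \<open>\<tau>\<close> centralizes \<open>V\<close>. In the converse direction \<open>K\<close> and
  the matrices live in unrelated fields that share only the prime field. Polynomials with natural
  coefficients, evaluated in both, carry the relations of \<open>\<zeta> ^ 2\<close> over to
  \<alpha>. The embedding of \<open>V\<close> grows by one vector at a time: \<open>K\<close>
  contains \<open>p ^ r\<close> prime field combinations, more than a proper subspace of
  \<open>V\<close> has elements, so a fresh value is always available.\<close>

lemma is_subfield_gen_subfield: "is_subfield (gen_subfield X)"
  unfolding is_subfield_def gen_subfield_def by auto

lemma gen_subfield_superset: "X \<subseteq> gen_subfield X"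
  unfolding gen_subfield_def by auto

lemma gen_subfield_least: "is_subfield F \<Longrightarrow> X \<subseteq> F \<Longrightarrow> gen_subfield X \<subseteq> F"
  unfolding gen_subfield_def by auto

lemma gen_subfield_mono: "X \<subseteq> Y \<Longrightarrow> gen_subfield X \<subseteq> gen_subfield Y"
  unfolding gen_subfield_def by auto

lemma gen_subfield_eq: "is_subfield F \<Longrightarrow> gen_subfield F = F"
  by (meson equalityI gen_subfield_least gen_subfield_superset order_refl)

lemma gen_subfield_insert_gen: "gen_subfield (insert y (gen_subfield X)) = gen_subfield (insert y X)"
proof
  show "gen_subfield (insert y (gen_subfield X)) \<subseteq> gen_subfield (insert y X)"
    by (rule gen_subfield_least[OF is_subfield_gen_subfield])
      (use gen_subfield_mono[of X "insert y X"] gen_subfield_superset[of "insert y X"] in auto)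
  show "gen_subfield (insert y X) \<subseteq> gen_subfield (insert y (gen_subfield X))"
    using gen_subfield_superset[of X] by (intro gen_subfield_mono) auto
qed

context
  fixes F :: "'a::field set"
  assumes F: "is_subfield F"
begin

lemma subfield_0: "0 \<in> F" and subfield_1: "1 \<in> F"
  and subfield_add: "a \<in> F \<Longrightarrow> b \<in> F \<Longrightarrow> a + b \<in> F"
  and subfield_mult: "a \<in> F \<Longrightarrow> b \<in> F \<Longrightarrow> a * b \<in> F"
  and subfield_uminus: "a \<in> F \<Longrightarrow> - a \<in> F"
  and subfield_inverse: "a \<in> F \<Longrightarrow> inverse a \<in> F"
  using F unfolding is_subfield_def by simp_all

lemma subfield_diff: "a \<in> F \<Longrightarrow> b \<in> F \<Longrightarrow> a - b \<in> F"
  using subfield_add[of a "- b"] subfield_uminus by simp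

lemma subfield_divide: "a \<in> F \<Longrightarrow> b \<in> F \<Longrightarrow> a / b \<in> F"
  by (simp add: divide_inverse subfield_mult subfield_inverse)

lemma subfield_power: "a \<in> F \<Longrightarrow> a ^ k \<in> F"
  by (induction k) (auto simp: subfield_1 subfield_mult)

lemma subfield_sum: "(\<And>i. i \<in> A \<Longrightarrow> f i \<in> F) \<Longrightarrow> sum f A \<in> F"
  by (induction A rule: infinite_finite_induct) (auto simp: subfield_0 subfield_add)

lemma subfield_prod: "(\<And>i. i \<in> A \<Longrightarrow> f i \<in> F) \<Longrightarrow> prod f A \<in> F"
  by (induction A rule: infinite_finite_induct) (auto simp: subfield_1 subfield_mult)

lemma subfield_of_nat: "of_nat k \<in> F"
  by (induction k) (auto simp: subfield_0 subfield_1 subfield_add)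

lemma subfield_numeral: "numeral k \<in> F"
  using subfield_of_nat[of "numeral k"] by simp

lemmas subfield_closed = subfield_0 subfield_1 subfield_add subfield_mult subfield_uminus
  subfield_inverse subfield_diff subfield_divide subfield_power subfield_of_nat subfield_numeral

end

text \<open>The fractions of a subring are closed under the field operations, with
  \<open>inverse 0 = 0\<close> as the one special case. Applied to polynomial values in one element
  and in several elements.\<close>

lemma gen_subfield_subset_fractions:
  fixes R :: "'a::field set"
  assumes "0 \<in> R" "1 \<in> R" and add: "\<And>a b. a \<in> R \<Longrightarrow> b \<in> R \<Longrightarrow> a + b \<in> R"
    and mult: "\<And>a b. a \<in> R \<Longrightarrow> b \<in> R \<Longrightarrow> a * b \<in> R" and minus: "\<And>a. a \<in> R \<Longrightarrow> - a \<in> R"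
    and X: "X \<subseteq> R"
  shows "gen_subfield X \<subseteq> {a / b | a b. a \<in> R \<and> b \<in> R \<and> b \<noteq> 0}" (is "_ \<subseteq> ?Q")
proof (rule gen_subfield_least)
  have frac: "a / b \<in> ?Q" if "a \<in> R" "b \<in> R" "b \<noteq> 0" for a b using that by blast
  have R: "a \<in> ?Q" if "a \<in> R" for a using frac[OF that assms(2)] by simp
  show "X \<subseteq> ?Q" using X R by blast
  show "is_subfield ?Q"
    unfolding is_subfield_def
  proof (intro conjI ballI)
    show "0 \<in> ?Q" "1 \<in> ?Q" using R assms(1,2) by blast+
    fix u v assume "u \<in> ?Q" "v \<in> ?Q"
    then obtain a b c d where *: "a \<in> R" "b \<in> R" "c \<in> R" "d \<in> R" "b \<noteq> 0" "d \<noteq> 0" "u = a / b" "v = c / d" by blast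
    have "u + v = (a * d + c * b) / (b * d)" "u * v = (a * c) / (b * d)" using * by (simp_all add: add_frac_eq)
    then show "u + v \<in> ?Q" "u * v \<in> ?Q"
      using frac[of "a * d + c * b" "b * d"] frac[of "a * c" "b * d"] * by (simp_all only: add mult no_zero_divisors not_False_eq_True)
  next
    fix u assume "u \<in> ?Q"
    then obtain a b where *: "a \<in> R" "b \<in> R" "b \<noteq> 0" "u = a / b" by blast
    then show "- u \<in> ?Q" using frac[OF minus[OF *(1)] *(2,3)] by simp
    show "inverse u \<in> ?Q" using * frac[of b a] R[OF assms(1)] by (cases "a = 0") simp_all
  qed
qed

text \<open>Subfields are subsets of one ambient type, so F[X] is a subset of the ambient polynomial
  ring. Degree, divisibility and evaluation are the ambient notions; only membership of the
  coefficients in \<open>F\<close> has to be tracked.\<close>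

definition polys_over :: "'a::comm_ring_1 set \<Rightarrow> 'a poly set" where
  "polys_over F = {p. \<forall>i. coeff p i \<in> F}"

lemma polys_overI: "(\<And>i. coeff p i \<in> F) \<Longrightarrow> p \<in> polys_over F"
  and polys_overD: "p \<in> polys_over F \<Longrightarrow> coeff p i \<in> F"
  by (auto simp: polys_over_def)

lemma polys_over_mono: "F \<subseteq> F' \<Longrightarrow> polys_over F \<subseteq> polys_over F'"
  by (auto simp: polys_over_def)

context
  fixes F :: "'a::field set"
  assumes F: "is_subfield F"
begin

lemma polys_over_pCons: "pCons a p \<in> polys_over F \<longleftrightarrow> a \<in> F \<and> p \<in> polys_over F"
proof
  assume *: "pCons a p \<in> polys_over F"
  show "a \<in> F \<and> p \<in> polys_over F"
    using polys_overD[OF *, of 0] polys_overD[OF *, of "Suc _"] by (auto intro!: polys_overI)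
next
  assume "a \<in> F \<and> p \<in> polys_over F"
  then show "pCons a p \<in> polys_over F"
    by (auto simp: polys_over_def coeff_pCons split: nat.splits)
qed

lemma polys_over_0: "0 \<in> polys_over F" and polys_over_1: "1 \<in> polys_over F"
  using subfield_0[OF F] subfield_1[OF F] by (auto simp: polys_over_def)

lemma polys_over_add: "p \<in> polys_over F \<Longrightarrow> q \<in> polys_over F \<Longrightarrow> p + q \<in> polys_over F"
  and polys_over_diff: "p \<in> polys_over F \<Longrightarrow> q \<in> polys_over F \<Longrightarrow> p - q \<in> polys_over F"
  and polys_over_uminus: "p \<in> polys_over F \<Longrightarrow> - p \<in> polys_over F"
  and polys_over_smult: "c \<in> F \<Longrightarrow> p \<in> polys_over F \<Longrightarrow> smult c p \<in> polys_over F"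
  and polys_over_monom: "c \<in> F \<Longrightarrow> monom c k \<in> polys_over F"
  by (auto simp: polys_over_def subfield_closed[OF F])

lemma polys_over_mult: "p \<in> polys_over F \<Longrightarrow> q \<in> polys_over F \<Longrightarrow> p * q \<in> polys_over F"
  by (auto simp: polys_over_def coeff_mult intro!: subfield_sum[OF F] subfield_mult[OF F])

lemma polys_over_power: "p \<in> polys_over F \<Longrightarrow> p ^ k \<in> polys_over F"
  by (induction k) (auto simp: polys_over_1 polys_over_mult)

lemma polys_over_sum: "(\<And>i. i \<in> A \<Longrightarrow> f i \<in> polys_over F) \<Longrightarrow> sum f A \<in> polys_over F"
  by (induction A rule: infinite_finite_induct) (auto simp: polys_over_0 polys_over_add)

lemma polys_over_pcompose: "p \<in> polys_over F \<Longrightarrow> q \<in> polys_over F \<Longrightarrow> pcompose p q \<in> polys_over F"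
  by (induction p) (auto simp: pcompose_pCons polys_over_pCons polys_over_0 intro!: polys_over_add polys_over_mult)

lemma poly_in_subfield: "p \<in> polys_over F \<Longrightarrow> a \<in> F \<Longrightarrow> poly p a \<in> F"
  by (induction p) (auto simp: polys_over_pCons subfield_0[OF F] intro!: subfield_add[OF F] subfield_mult[OF F])

text \<open>The division recursion divides only by the leading coefficient of \<open>q\<close>, so
  no coefficient leaves \<open>F\<close>.\<close>

lemma polys_over_div_mod:
  assumes "p \<in> polys_over F" "q \<in> polys_over F"
  shows "p div q \<in> polys_over F \<and> p mod q \<in> polys_over F"
  using assms(1)
proof (induction p)
  case 0
  then show ?case by (simp add: polys_over_0)
next
  case (pCons a p)
  then have "a \<in> F" "p div q \<in> polys_over F" "p mod q \<in> polys_over F"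
    by (auto simp: polys_over_pCons)
  then show ?case using assms(2)
    by (auto simp: div_pCons_eq mod_pCons_eq Let_def polys_over_0 polys_over_pCons
        intro!: polys_over_diff polys_over_smult subfield_divide[OF F] polys_overD)
qed

lemmas polys_over_closed = polys_over_0 polys_over_1 polys_over_add polys_over_diff polys_over_uminus
  polys_over_smult polys_over_monom polys_over_mult polys_over_power

text \<open>\<open>h\<close> is a nonzero element of least degree in the ideal of F[X] generated by
  the \<open>C i\<close>; remainders modulo \<open>h\<close> stay in that ideal, so \<open>h\<close>
  divides every \<open>C i\<close>. The Bezout relation for the cofactors serves as coprimality for
  fractions and as primitivity in Gauss's lemma.\<close>

lemma polys_over_bezout:
  fixes C :: "'i \<Rightarrow> 'a poly"
  assumes "finite I" and C: "\<And>i. i \<in> I \<Longrightarrow> C i \<in> polys_over F" and nz: "\<exists>i\<in>I. C i \<noteq> 0"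
  obtains h a c where "h \<noteq> 0" "h \<in> polys_over F" "\<And>i. a i \<in> polys_over F"
    "\<And>i. c i \<in> polys_over F" "\<And>i. i \<in> I \<Longrightarrow> C i = h * c i" "(\<Sum>i\<in>I. a i * c i) = 1"
proof -
  define J where "J = {h. h \<noteq> 0 \<and> (\<exists>a. (\<forall>i. a i \<in> polys_over F) \<and> h = (\<Sum>i\<in>I. a i * C i))}"
  obtain i0 where i0: "i0 \<in> I" "C i0 \<noteq> 0" using nz by auto
  have "C i0 = (\<Sum>i\<in>I. (if i = i0 then 1 else 0) * C i)"
    using i0 \<open>finite I\<close> by (simp add: if_distrib[of "\<lambda>t. t * _"] cong: if_cong)
  then have "C i0 \<in> J" using i0 unfolding J_def
    by (auto intro!: exI[of _ "\<lambda>i. if i = i0 then 1 else 0"] simp: polys_over_0 polys_over_1)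
  then obtain h where h: "h \<in> J" and min: "\<And>h'. h' \<in> J \<Longrightarrow> degree h \<le> degree h'"
    using ex_has_least_nat[of "\<lambda>h. h \<in> J" _ degree] by metis
  then obtain a where a: "\<And>i. a i \<in> polys_over F" "h = (\<Sum>i\<in>I. a i * C i)" and h0: "h \<noteq> 0"
    unfolding J_def by auto
  have hF: "h \<in> polys_over F" unfolding a(2) using a(1) C by (intro polys_over_sum polys_over_mult)
  have dvd: "C i = h * (C i div h)" if i: "i \<in> I" for i
  proof -
    have "C i mod h = 0"
    proof (rule ccontr)
      assume nz: "C i mod h \<noteq> 0"
      have "C i mod h = C i - (C i div h) * h"
        by (simp add: minus_div_mult_eq_mod)
      also have "\<dots> = (\<Sum>j\<in>I. (if j = i then 1 else 0) * C j) - (C i div h) * (\<Sum>j\<in>I. a j * C j)"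
        using i \<open>finite I\<close> by (subst a(2)[symmetric]) (simp add: if_distrib[of "\<lambda>t. t * _"] cong: if_cong)
      also have "\<dots> = (\<Sum>j\<in>I. ((if j = i then 1 else 0) - (C i div h) * a j) * C j)"
        by (simp add: sum_distrib_left sum_subtractf algebra_simps)
      finally have "C i mod h \<in> J" using nz a(1) C[OF i] hF unfolding J_def
        by (auto intro!: exI[of _ "\<lambda>j. (if j = i then 1 else 0) - (C i div h) * a j"] polys_over_diff
            polys_over_mult polys_over_1 polys_over_0 simp: polys_over_div_mod polys_over_uminus)
      from min[OF this] nz h0 show False using degree_mod_less'[of h "C i"] by linarith
    qed
    then show ?thesis by (metis dvd_mult_div_cancel mod_0_imp_dvd)
  qed
  define c where "c i = (if i \<in> I then C i div h else 0)" for i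
  have "h * (\<Sum>i\<in>I. a i * c i) = h"
    by (subst (2) a(2)) (auto simp: sum_distrib_left c_def intro!: sum.cong,
        metis dvd mult.left_commute)
  then have "(\<Sum>i\<in>I. a i * c i) = 1" using h0 by simp
  then show ?thesis using that[of h a c] h0 hF a(1) dvd C
    by (auto simp: c_def polys_over_div_mod polys_over_0)
qed

lemma polys_over_bezout_pair:
  assumes "f \<in> polys_over F" "g \<in> polys_over F" "f \<noteq> 0 \<or> g \<noteq> 0"
  obtains h a b f' g' where "h \<noteq> 0" "h \<in> polys_over F" "a \<in> polys_over F" "b \<in> polys_over F"
    "f' \<in> polys_over F" "g' \<in> polys_over F" "f = h * f'" "g = h * g'" "a * f' + b * g' = 1"
proof -
  obtain h a c where *: "h \<noteq> 0" "h \<in> polys_over F" "\<And>i. a i \<in> polys_over F"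
    "\<And>i. c i \<in> polys_over F" "\<And>i. i \<in> UNIV \<Longrightarrow> (if i then f else g) = h * c i" "(\<Sum>i\<in>UNIV. a i * c i) = 1"
    by (rule polys_over_bezout[of UNIV "\<lambda>i. if i then f else g"]) (use assms in \<open>auto split: if_splits\<close>)
  have "f = h * c True" "g = h * c False" using *(5)[of True] *(5)[of False] by simp_all
  show ?thesis
    by (rule that[of h "a True" "a False" "c True" "c False"]) (use \<open>f = _\<close> \<open>g = _\<close> *(1-4,6) in \<open>auto simp: UNIV_bool add.commute\<close>)
qed

end

subsection \<open>Simple extensions\<close>

lemma simple_extension_iff:
  assumes F: "is_subfield F"
  shows "w \<in> gen_subfield (insert y F) \<longleftrightarrow>
    (\<exists>f\<in>polys_over F. \<exists>g\<in>polys_over F. poly g y \<noteq> 0 \<and> w = poly f y / poly g y)"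
proof
  let ?R = "{poly f y | f. f \<in> polys_over F}"
  have R: "poly f y \<in> ?R" if "f \<in> polys_over F" for f using that by blast
  have "gen_subfield (insert y F) \<subseteq> {a / b | a b. a \<in> ?R \<and> b \<in> ?R \<and> b \<noteq> 0}"
  proof (rule gen_subfield_subset_fractions)
    show "0 \<in> ?R" "1 \<in> ?R" using R[of 0] R[of 1] by (simp_all add: polys_over_closed[OF F])
    show "insert y F \<subseteq> ?R"
      using R[of "[:0, 1:]"] R[of "[:_:]"]
      by (auto simp: polys_over_pCons[OF F] polys_over_0[OF F] subfield_closed[OF F] simp del: mem_Collect_eq)
    fix a assume "a \<in> ?R"
    then obtain f where f: "a = poly f y" "f \<in> polys_over F" by blast
    then show "- a \<in> ?R" using R[OF polys_over_uminus[OF F f(2)]] by simp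
    fix b assume "b \<in> ?R"
    then obtain g where g: "b = poly g y" "g \<in> polys_over F" by blast
    show "a + b \<in> ?R" "a * b \<in> ?R"
      using R[OF polys_over_add[OF F f(2) g(2)]] R[OF polys_over_mult[OF F f(2) g(2)]] by (simp_all add: f g)
  qed
  then show "w \<in> gen_subfield (insert y F) \<Longrightarrow> \<exists>f\<in>polys_over F. \<exists>g\<in>polys_over F. poly g y \<noteq> 0 \<and> w = poly f y / poly g y"
    by blast
next
  assume "\<exists>f\<in>polys_over F. \<exists>g\<in>polys_over F. poly g y \<noteq> 0 \<and> w = poly f y / poly g y"
  moreover have "poly f y \<in> gen_subfield (insert y F)" if "f \<in> polys_over F" for f
    by (rule poly_in_subfield[OF is_subfield_gen_subfield])
      (use that polys_over_mono[of F "gen_subfield (insert y F)"] gen_subfield_superset[of "insert y F"] in auto)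
  ultimately show "w \<in> gen_subfield (insert y F)"
    by (auto intro: subfield_divide[OF is_subfield_gen_subfield])
qed

definition transcendental_over :: "'a::field set \<Rightarrow> 'a \<Rightarrow> bool" where
  "transcendental_over F y \<longleftrightarrow> (\<forall>p\<in>polys_over F. poly p y = 0 \<longrightarrow> p = 0)"

lemma transcendental_overD: "transcendental_over F y \<Longrightarrow> p \<in> polys_over F \<Longrightarrow> poly p y = 0 \<Longrightarrow> p = 0"
  by (auto simp: transcendental_over_def)

lemma transcendental_over_mono: "transcendental_over F y \<Longrightarrow> F' \<subseteq> F \<Longrightarrow> transcendental_over F' y"
  unfolding transcendental_over_def by (meson polys_over_mono subsetD)

lemma transcendental_over_notin:
  assumes "is_subfield F" "transcendental_over F y" shows "y \<notin> F"
proof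
  assume "y \<in> F"
  then have "[:- y, 1:] \<in> polys_over F" using assms(1) by (auto simp: polys_over_pCons subfield_closed polys_over_0)
  from transcendental_overD[OF assms(2) this] show False by simp
qed

lemma transcendental_over_eq:
  assumes F: "is_subfield F" and "transcendental_over F y" "p \<in> polys_over F" "q \<in> polys_over F" "poly p y = poly q y"
  shows "p = q"
  using transcendental_overD[OF assms(2) polys_over_diff[OF F assms(3,4)]] assms(5) by simp

lemma simple_extension_coprime:
  assumes F: "is_subfield F" and w: "w \<in> gen_subfield (insert y F)"
  obtains f g a b where "f \<in> polys_over F" "g \<in> polys_over F" "a \<in> polys_over F" "b \<in> polys_over F"
    "a * f + b * g = 1" "poly g y \<noteq> 0" "w = poly f y / poly g y"
proof -
  obtain f g where fg: "f \<in> polys_over F" "g \<in> polys_over F" "poly g y \<noteq> 0" "w = poly f y / poly g y"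
    using w simple_extension_iff[OF F] by blast
  have "g \<noteq> 0" using fg by auto
  then obtain h a b f' g' where *: "h \<noteq> 0" "h \<in> polys_over F" "a \<in> polys_over F" "b \<in> polys_over F"
    "f' \<in> polys_over F" "g' \<in> polys_over F" "f = h * f'" "g = h * g'" "a * f' + b * g' = 1"
    using polys_over_bezout_pair[OF F fg(1,2)] by blast
  show ?thesis by (rule that[of f' g' a b]) (use * fg in auto)
qed

text \<open>Write \<open>w\<close> as f(y)/g(y) in lowest terms and clear denominators in
  \<open>p\<close>: since \<open>y\<close> is transcendental, the relation becomes an identity of
  polynomials. There \<open>g\<close> divides the top term, a multiple of a power of
  \<open>f\<close>, so \<open>g\<close> is constant; then \<open>p\<close> composed with a multiple
  of \<open>f\<close> is zero, so \<open>f\<close> is constant too.\<close>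

lemma algebraic_in_simple_extension:
  assumes F: "is_subfield F" and y: "transcendental_over F y" and w: "w \<in> gen_subfield (insert y F)"
    and alg: "\<not> transcendental_over F w"
  shows "w \<in> F"
proof -
  obtain f g a b where fg: "f \<in> polys_over F" "g \<in> polys_over F" "a \<in> polys_over F" "b \<in> polys_over F"
    and bez: "a * f + b * g = 1" and g: "poly g y \<noteq> 0" and w: "w = poly f y / poly g y"
    using simple_extension_coprime[OF F w] by blast
  obtain p where p: "p \<in> polys_over F" "p \<noteq> 0" "poly p w = 0"
    using alg unfolding transcendental_over_def by blast
  define k where "k = degree p"
  define q where "q = (\<Sum>i\<le>k. smult (coeff p i) (f ^ i * g ^ (k - i)))"
  have "poly q y = (\<Sum>i\<le>k. coeff p i * (poly f y ^ i * poly g y ^ (k - i)))"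
    by (simp add: q_def poly_sum)
  also have "\<dots> = poly g y ^ k * poly p w"
    using g by (simp add: poly_altdef k_def[symmetric] w sum_distrib_left power_divide power_diff algebra_simps)
  finally have "poly q y = 0" using p by simp
  moreover have "q \<in> polys_over F" unfolding q_def using fg p
    by (intro polys_over_sum[OF F] polys_over_smult[OF F] polys_over_mult[OF F] polys_over_power[OF F] polys_overD) auto
  ultimately have q0: "q = 0" using transcendental_overD[OF y] by blast
  have "q = smult (coeff p k) (f ^ k) + (\<Sum>i<k. smult (coeff p i) (f ^ i * g ^ (k - i)))"
    by (simp add: q_def lessThan_Suc_atMost[symmetric] add.commute)
  moreover have "g dvd (\<Sum>i<k. smult (coeff p i) (f ^ i * g ^ (k - i)))"
    by (intro dvd_sum dvd_smult dvd_mult dvd_power) auto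
  ultimately have "g dvd smult (coeff p k) (f ^ k)"
    using q0 dvd_add_left_iff[of g "\<Sum>i<k. smult (coeff p i) (f ^ i * g ^ (k - i))"] by (metis dvd_0_right)
  moreover have "coeff p k \<noteq> 0" using p(2) by (simp add: k_def)
  ultimately have "g dvd f ^ k" by (simp add: dvd_smult_iff)
  \<comment> \<open>The Bezout relation strips off one factor \<open>f\<close> at a time.\<close>
  have "g dvd 1" if "g dvd f ^ j" for j
    using that
  proof (induction j)
    case (Suc j)
    have "f ^ j = (a * f + b * g) * f ^ j" by (simp add: bez)
    also have "\<dots> = a * f ^ Suc j + g * (b * f ^ j)" by (simp add: algebra_simps)
    finally have "g dvd f ^ j" using Suc.prems by (metis dvd_add dvd_mult dvd_triv_left)
    then show ?case by (rule Suc.IH)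
  qed simp
  then have "g dvd 1" using \<open>g dvd f ^ k\<close> by blast
  then obtain c where c: "g = [:c:]" by (metis is_unit_polyE)
  then have "c \<noteq> 0" "c \<in> F" using g fg(2) by (auto simp: polys_over_pCons[OF F])
  have "poly (pcompose p (smult (inverse c) f)) y = 0"
    using p(3) by (simp add: poly_pcompose w c field_simps)
  then have "pcompose p (smult (inverse c) f) = 0"
    by (rule transcendental_overD[OF y, rotated])
      (use p fg \<open>c \<in> F\<close> in \<open>auto intro!: polys_over_pcompose[OF F] polys_over_smult[OF F] subfield_inverse[OF F]\<close>)
  then have "degree f = 0" using pcompose_eq_0[of p "smult (inverse c) f"] p(2) \<open>c \<noteq> 0\<close> by fastforce
  then obtain d where "f = [:d:]" by (metis degree_0_id)
  then show ?thesis using w c fg(1) \<open>c \<in> F\<close> by (auto simp: polys_over_pCons[OF F] intro!: subfield_divide[OF F])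
qed

section \<open>Algebraic independence and iterated simple extensions\<close>

definition monom_val :: "('a::field \<Rightarrow>\<^sub>0 nat) \<Rightarrow> 'a" where
  "monom_val m = (\<Prod>v\<in>Poly_Mapping.keys m. v ^ Poly_Mapping.lookup m v)"

lemma monom_val_superset:
  assumes "finite A" "Poly_Mapping.keys m \<subseteq> A"
  shows "monom_val m = (\<Prod>v\<in>A. v ^ Poly_Mapping.lookup m v)"
  unfolding monom_val_def
  by (rule prod.mono_neutral_left) (use assms in \<open>auto simp: in_keys_iff\<close>)

lemma monom_val_add: "monom_val (m + n) = monom_val m * monom_val n"
proof -
  let ?A = "Poly_Mapping.keys m \<union> Poly_Mapping.keys n"
  have "Poly_Mapping.keys (m + n) \<subseteq> ?A" by (rule Poly_Mapping.keys_add)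
  then show ?thesis
    by (simp add: monom_val_superset[of ?A] lookup_add power_add prod.distrib)
qed

lemma monom_val_single: "monom_val (Poly_Mapping.single y i) = y ^ i"
  by (simp add: monom_val_superset[of "{y}"])

lemma peval_superset:
  assumes "finite A" "Poly_Mapping.keys q \<subseteq> A"
  shows "peval q = (\<Sum>m\<in>A. Poly_Mapping.lookup q m * monom_val m)"
  unfolding peval_def monom_val_def[symmetric]
  by (rule sum.mono_neutral_left) (use assms in \<open>auto simp: in_keys_iff\<close>)

lemma peval_0: "peval 0 = 0"
  by (simp add: peval_def)

lemma peval_add: "peval (p + q) = peval p + peval q"
proof -
  let ?A = "Poly_Mapping.keys p \<union> Poly_Mapping.keys q"
  have "Poly_Mapping.keys (p + q) \<subseteq> ?A" by (rule Poly_Mapping.keys_add)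
  then show ?thesis
    by (simp add: peval_superset[of ?A] lookup_add distrib_right sum.distrib)
qed

lemma peval_single: "peval (Poly_Mapping.single m c) = c * monom_val m"
  by (simp add: peval_superset[of "{m}"])

lemma peval_sum: "peval (sum f A) = (\<Sum>i\<in>A. peval (f i))"
  by (induction A rule: infinite_finite_induct) (auto simp: peval_0 peval_add)

lemma poly_mapping_eq_sum_single:
  "q = (\<Sum>m\<in>Poly_Mapping.keys q. Poly_Mapping.single m (Poly_Mapping.lookup q m))"
  by (rule poly_mapping_eqI)
    (auto simp: lookup_sum lookup_single when_def in_keys_iff)

lemma poly_mapping_mult_eq_sum_single:
  "p * q = (\<Sum>m\<in>Poly_Mapping.keys p. \<Sum>n\<in>Poly_Mapping.keys q.
      Poly_Mapping.single (m + n) (Poly_Mapping.lookup p m * Poly_Mapping.lookup q n))"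
  by (subst poly_mapping_eq_sum_single[of p], subst poly_mapping_eq_sum_single[of q])
    (simp add: sum_product mult_single)

lemma peval_mult: "peval (p * q) = peval p * peval q"
  by (subst poly_mapping_mult_eq_sum_single)
    (simp add: peval_sum peval_single peval_superset[of "Poly_Mapping.keys p" p]
      peval_superset[of "Poly_Mapping.keys q" q] sum_product monom_val_add mult_ac)

definition mpolys_over :: "'a::field set \<Rightarrow> 'a set \<Rightarrow> (('a \<Rightarrow>\<^sub>0 nat) \<Rightarrow>\<^sub>0 'a) set" where
  "mpolys_over K S = {q. (\<forall>m. Poly_Mapping.lookup q m \<in> K) \<and>
     (\<forall>m\<in>Poly_Mapping.keys q. Poly_Mapping.keys m \<subseteq> S)}"

lemma alg_indep_iff: "alg_indep K S \<longleftrightarrow> (\<forall>q\<in>mpolys_over K S. peval q = 0 \<longrightarrow> q = 0)"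
  unfolding alg_indep_def mpolys_over_def by blast

lemma alg_indepD: "alg_indep K S \<Longrightarrow> q \<in> mpolys_over K S \<Longrightarrow> peval q = 0 \<Longrightarrow> q = 0"
  by (auto simp: alg_indep_iff)

lemma mpolys_over_mono: "S \<subseteq> T \<Longrightarrow> mpolys_over K S \<subseteq> mpolys_over K T"
  unfolding mpolys_over_def by blast

lemma alg_indep_subset: "alg_indep K T \<Longrightarrow> S \<subseteq> T \<Longrightarrow> alg_indep K S"
  unfolding alg_indep_iff using mpolys_over_mono by blast

context
  fixes K :: "'a::field set"
  assumes K: "is_subfield K"
begin

lemma mpolys_over_0: "0 \<in> mpolys_over K S"
  by (simp add: mpolys_over_def subfield_0[OF K])

lemma mpolys_over_single:
  "c \<in> K \<Longrightarrow> Poly_Mapping.keys m \<subseteq> S \<Longrightarrow> Poly_Mapping.single m c \<in> mpolys_over K S"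
  by (auto simp: mpolys_over_def lookup_single when_def subfield_0[OF K] split: if_splits)

lemma mpolys_over_add: "p \<in> mpolys_over K S \<Longrightarrow> q \<in> mpolys_over K S \<Longrightarrow> p + q \<in> mpolys_over K S"
  unfolding mpolys_over_def using Poly_Mapping.keys_add[of p q] subfield_add[OF K] by (fastforce simp: lookup_add)

lemma mpolys_over_sum: "(\<And>i. i \<in> A \<Longrightarrow> f i \<in> mpolys_over K S) \<Longrightarrow> sum f A \<in> mpolys_over K S"
  by (induction A rule: infinite_finite_induct) (auto simp: mpolys_over_0 mpolys_over_add)

lemma mpolys_over_mult:
  assumes "p \<in> mpolys_over K S" "q \<in> mpolys_over K S" shows "p * q \<in> mpolys_over K S"
  unfolding poly_mapping_mult_eq_sum_single[of p q]
proof (intro mpolys_over_sum mpolys_over_single)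
  fix m n assume mn: "m \<in> Poly_Mapping.keys p" "n \<in> Poly_Mapping.keys q"
  show "Poly_Mapping.lookup p m * Poly_Mapping.lookup q n \<in> K"
    using assms by (auto simp: mpolys_over_def intro: subfield_mult[OF K])
  have "Poly_Mapping.keys (m + n) \<subseteq> Poly_Mapping.keys m \<union> Poly_Mapping.keys n" by (rule Poly_Mapping.keys_add)
  also have "\<dots> \<subseteq> S" using assms mn by (auto simp: mpolys_over_def)
  finally show "Poly_Mapping.keys (m + n) \<subseteq> S" .
qed

lemma mpolys_over_1: "1 \<in> mpolys_over K S"
  using mpolys_over_single[of 1 0 S] by (simp add: subfield_1[OF K] single_one)

lemma peval_1: "peval (1 :: ('a \<Rightarrow>\<^sub>0 nat) \<Rightarrow>\<^sub>0 'a) = 1"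
  using peval_single[of 0 "1::'a"] by (simp add: single_one monom_val_def)

lemma peval_in_subfield:
  assumes F: "is_subfield F" and sub: "K \<subseteq> F" "S \<subseteq> F" and q: "q \<in> mpolys_over K S"
  shows "peval q \<in> F"
  unfolding peval_def
  by (intro subfield_sum[OF F] subfield_mult[OF F] subfield_prod[OF F] subfield_power[OF F])
    (use q sub in \<open>unfold mpolys_over_def, blast+\<close>)

lemma gen_subfield_fractions:
  assumes w: "w \<in> gen_subfield (K \<union> S)"
  obtains a b where "a \<in> mpolys_over K S" "b \<in> mpolys_over K S" "peval b \<noteq> 0" "w = peval a / peval b"
proof -
  let ?R = "{peval a | a. a \<in> mpolys_over K S}"
  have R: "peval a \<in> ?R" if "a \<in> mpolys_over K S" for a using that by blast
  have "gen_subfield (K \<union> S) \<subseteq> {a / b | a b. a \<in> ?R \<and> b \<in> ?R \<and> b \<noteq> 0}"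
  proof (rule gen_subfield_subset_fractions)
    show "0 \<in> ?R" "1 \<in> ?R" using R[of 0] R[of 1] by (simp_all only: mpolys_over_0 mpolys_over_1 peval_0 peval_1)
    have "c \<in> ?R" if "c \<in> K" for c
      using R[of "Poly_Mapping.single 0 c"] that
      by (simp only: mpolys_over_single peval_single monom_val_def keys_zero prod.empty mult_1_right empty_subsetI)
    moreover have "s \<in> ?R" if "s \<in> S" for s
      using R[of "Poly_Mapping.single (Poly_Mapping.single s 1) 1"] that
      by (simp only: mpolys_over_single peval_single monom_val_single power_one_right mult_1_left
          subfield_1[OF K] keys_single one_neq_zero if_False insert_subset empty_subsetI simp_thms)
    ultimately show "K \<union> S \<subseteq> ?R" by blast
    fix u assume "u \<in> ?R"
    then obtain a where a: "u = peval a" "a \<in> mpolys_over K S" by blast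
    have "Poly_Mapping.single 0 (- 1) \<in> mpolys_over K S"
      by (intro mpolys_over_single subfield_uminus[OF K] subfield_1[OF K]) simp
    from R[OF mpolys_over_mult[OF this a(2)]] show "- u \<in> ?R"
      by (simp only: peval_mult peval_single monom_val_def keys_zero prod.empty mult_1_right mult_minus1 a(1))
    fix v assume "v \<in> ?R"
    then obtain b where b: "v = peval b" "b \<in> mpolys_over K S" by blast
    show "u + v \<in> ?R" "u * v \<in> ?R"
      using R[OF mpolys_over_add[OF a(2) b(2)]] R[OF mpolys_over_mult[OF a(2) b(2)]] by (simp_all only: a b peval_add peval_mult)
  qed
  with w that show ?thesis by blast
qed

text \<open>Brings the coefficients of a polynomial over K(S) into K[S] simultaneously, so that a
  relation over K(S) becomes a polynomial relation over \<open>K\<close>.\<close>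

lemma common_denominator:
  assumes "finite I" "\<And>i. i \<in> I \<Longrightarrow> c i \<in> gen_subfield (K \<union> S)"
  shows "\<exists>d\<in>mpolys_over K S. peval d \<noteq> 0 \<and> (\<exists>q. \<forall>i\<in>I. q i \<in> mpolys_over K S \<and> peval (q i) = peval d * c i)"
  using assms
proof (induction I)
  case empty
  show ?case by (rule bexI[of _ 1]) (auto simp: mpolys_over_1 peval_1)
next
  case (insert j I)
  then obtain d q where d: "d \<in> mpolys_over K S" "peval d \<noteq> 0"
    and q: "\<And>i. i \<in> I \<Longrightarrow> q i \<in> mpolys_over K S \<and> peval (q i) = peval d * c i" by auto
  obtain a b where ab: "a \<in> mpolys_over K S" "b \<in> mpolys_over K S" "peval b \<noteq> 0" "c j = peval a / peval b"
    using gen_subfield_fractions insert.prems by blast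
  show ?case
  proof (intro bexI[of _ "d * b"] conjI exI[of _ "\<lambda>i. if i = j then d * a else q i * b"] ballI)
    fix i assume "i \<in> insert j I"
    then show "(if i = j then d * a else q i * b) \<in> mpolys_over K S"
      "peval (if i = j then d * a else q i * b) = peval (d * b) * c i"
      using d ab q[of i] by (auto simp: peval_mult intro!: mpolys_over_mult)
  qed (use d ab in \<open>auto simp: peval_mult intro: mpolys_over_mult\<close>)
qed

text \<open>Sort the monomials of \<open>q\<close> by their exponent of \<open>y\<close>:
  \<open>q\<close> becomes a polynomial in \<open>y\<close> with coefficients \<open>Q i\<close>
  from K[S]. Transcendence of \<open>y\<close> kills the values of the coefficients, and
  independence of \<open>S\<close> then kills the coefficients.\<close>

lemma alg_indep_insertI:
  assumes S: "alg_indep K S" and y: "transcendental_over (gen_subfield (K \<union> S)) y"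
  shows "alg_indep K (insert y S)"
  unfolding alg_indep_iff
proof (intro ballI impI)
  fix q assume q: "q \<in> mpolys_over K (insert y S)" and q0: "peval q = 0"
  let ?F = "gen_subfield (K \<union> S)"
  have F: "is_subfield ?F" "K \<subseteq> ?F" "S \<subseteq> ?F" using is_subfield_gen_subfield gen_subfield_superset by blast+
  define M where "M i = {m\<in>Poly_Mapping.keys q. Poly_Mapping.lookup m y = i}" for i
  define Q where "Q i = (\<Sum>m\<in>M i. Poly_Mapping.single (m - Poly_Mapping.single y i) (Poly_Mapping.lookup q m))" for i
  have fin: "finite (M i)" for i by (simp add: M_def)
  have dec: "m = (m - Poly_Mapping.single y i) + Poly_Mapping.single y i" if "m \<in> M i" for m i
    using that by (intro poly_mapping_eqI) (auto simp: M_def lookup_add lookup_minus lookup_single when_def)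
  have QS: "Q i \<in> mpolys_over K S" for i
    unfolding Q_def
  proof (intro mpolys_over_sum mpolys_over_single subsetI)
    fix m assume m: "m \<in> M i"
    show "Poly_Mapping.lookup q m \<in> K" using q by (simp add: mpolys_over_def)
    fix v assume "v \<in> Poly_Mapping.keys (m - Poly_Mapping.single y i)"
    then have "Poly_Mapping.lookup m v - (i when y = v) \<noteq> 0" by (simp add: in_keys_iff lookup_minus lookup_single)
    then have "v \<noteq> y" "v \<in> Poly_Mapping.keys m" using m by (auto simp: M_def in_keys_iff when_def split: if_splits)
    then show "v \<in> S" using q m by (auto simp: mpolys_over_def M_def)
  qed
  define N where "N = Max (insert 0 ((\<lambda>m. Poly_Mapping.lookup m y) ` Poly_Mapping.keys q))"
  have N: "Poly_Mapping.lookup m y \<le> N" if "m \<in> Poly_Mapping.keys q" for m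
    unfolding N_def using that by (intro Max_ge) auto
  have part: "Poly_Mapping.keys q = (\<Union>i\<le>N. M i)" using N by (auto simp: M_def)
  define P where "P = (\<Sum>i\<le>N. monom (peval (Q i)) i)"
  have "poly P y = (\<Sum>i\<le>N. peval (Q i) * y ^ i)" by (simp add: P_def poly_sum poly_monom)
  also have "\<dots> = (\<Sum>i\<le>N. \<Sum>m\<in>M i. Poly_Mapping.lookup q m * monom_val m)"
  proof (rule sum.cong[OF refl])
    fix i
    have "peval (Q i) * y ^ i = (\<Sum>m\<in>M i. Poly_Mapping.lookup q m * (monom_val (m - Poly_Mapping.single y i) * y ^ i))"
      by (simp add: Q_def peval_sum peval_single sum_distrib_right mult.assoc)
    also have "\<dots> = (\<Sum>m\<in>M i. Poly_Mapping.lookup q m * monom_val m)"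
      by (intro sum.cong refl) (subst (3) dec, assumption, simp add: monom_val_add monom_val_single)
    finally show "peval (Q i) * y ^ i = \<dots>" .
  qed
  also have "\<dots> = (\<Sum>m\<in>Poly_Mapping.keys q. Poly_Mapping.lookup q m * monom_val m)"
    unfolding part by (subst sum.UNION_disjoint) (auto simp: fin M_def)
  also have "\<dots> = 0" using q0 by (simp add: peval_superset[of "Poly_Mapping.keys q"])
  finally have "poly P y = 0" .
  moreover have "P \<in> polys_over ?F"
    unfolding P_def by (intro polys_over_sum[OF F(1)] polys_over_monom[OF F(1)] peval_in_subfield[OF F QS])
  ultimately have "P = 0" by (rule transcendental_overD[OF y, rotated])
  have Q0: "Q i = 0" if "i \<le> N" for i
  proof (rule alg_indepD[OF S QS])
    have "peval (Q i) = coeff P i" using that by (simp add: P_def coeff_sum)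
    then show "peval (Q i) = 0" using \<open>P = 0\<close> by simp
  qed
  show "q = 0"
  proof (rule ccontr)
    assume "q \<noteq> 0"
    then obtain m where m: "m \<in> Poly_Mapping.keys q" using poly_mapping_eqI[of q 0] by (auto simp: in_keys_iff)
    define i where "i = Poly_Mapping.lookup m y"
    have mi: "m \<in> M i" using m by (simp add: M_def i_def)
    \<comment> \<open>Removing the power of \<open>y\<close> is injective on \<open>M i\<close>, so
      no two terms of \<open>Q i\<close> can cancel and each coefficient of \<open>q\<close>
      reappears in some \<open>Q i\<close>.\<close>
    have "m' - Poly_Mapping.single y i = m - Poly_Mapping.single y i \<longleftrightarrow> m' = m" if "m' \<in> M i" for m'
      using dec[OF that] dec[OF mi] by metis
    then have "Poly_Mapping.lookup (Q i) (m - Poly_Mapping.single y i) = (\<Sum>m'\<in>M i. if m' = m then Poly_Mapping.lookup q m' else 0)"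
      unfolding Q_def lookup_sum lookup_single when_def by (intro sum.cong) auto
    then have "Poly_Mapping.lookup (Q i) (m - Poly_Mapping.single y i) = Poly_Mapping.lookup q m"
      using fin mi by simp
    then show False using Q0[of i] N[OF m] m by (simp add: i_def in_keys_iff)
  qed
qed

text \<open>After clearing denominators a relation for \<open>y\<close> becomes a multivariate
  polynomial \<open>Q\<close>. The \<open>q i\<close> do not involve \<open>y\<close>, so the
  exponent of \<open>y\<close> in a monomial of \<open>Q\<close> tells which \<open>q i\<close> it
  comes from, and \<open>Q = 0\<close> forces all \<open>q i\<close> to vanish.\<close>

lemma alg_indep_insertD:
  assumes S: "alg_indep K (insert y S)" and yS: "y \<notin> S"
  shows "transcendental_over (gen_subfield (K \<union> S)) y"
  unfolding transcendental_over_def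
proof (intro ballI impI)
  fix P assume P: "P \<in> polys_over (gen_subfield (K \<union> S))" and P0: "poly P y = 0"
  obtain d q where d: "d \<in> mpolys_over K S" "peval d \<noteq> 0"
    and q: "\<And>i. i \<le> degree P \<Longrightarrow> q i \<in> mpolys_over K S \<and> peval (q i) = peval d * coeff P i"
    using common_denominator[of "{..degree P}" "coeff P" S] polys_overD[OF P] by auto
  define Q where "Q = (\<Sum>i\<le>degree P. q i * Poly_Mapping.single (Poly_Mapping.single y i) 1)"
  have "peval Q = peval d * poly P y"
    by (simp add: Q_def peval_sum peval_mult peval_single monom_val_single poly_altdef sum_distrib_left q mult.assoc)
  then have "peval Q = 0" by (simp add: P0)
  moreover have "Q \<in> mpolys_over K (insert y S)"
    unfolding Q_def using q mpolys_over_mono[of S "insert y S" K]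
    by (intro mpolys_over_sum mpolys_over_mult mpolys_over_single) (auto simp: subfield_1[OF K])
  ultimately have Q0: "Q = 0" using alg_indepD[OF S] by blast
  have keys: "Poly_Mapping.lookup m y = 0" if "i \<le> degree P" "m \<in> Poly_Mapping.keys (q i)" for i m
    using q[OF that(1)] that(2) yS by (force simp: mpolys_over_def in_keys_iff)
  have "Poly_Mapping.lookup (q i) m = 0" if i: "i \<le> degree P" for i m
  proof (rule ccontr)
    assume nz: "Poly_Mapping.lookup (q i) m \<noteq> 0"
    have my: "Poly_Mapping.lookup m y = 0" using keys[OF i, of m] nz by (simp add: in_keys_iff)
    have eq: "m' + Poly_Mapping.single y j = m + Poly_Mapping.single y i \<longleftrightarrow> j = i \<and> m' = m"
      if "j \<le> degree P" "m' \<in> Poly_Mapping.keys (q j)" for j m'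
    proof
      assume *: "m' + Poly_Mapping.single y j = m + Poly_Mapping.single y i"
      then have "Poly_Mapping.lookup (m' + Poly_Mapping.single y j) y = Poly_Mapping.lookup (m + Poly_Mapping.single y i) y" by simp
      then have "j = i" using keys[OF that] my by (simp add: lookup_add)
      with * show "j = i \<and> m' = m" by simp
    qed simp
    have "Q = (\<Sum>j\<le>degree P. \<Sum>m'\<in>Poly_Mapping.keys (q j). Poly_Mapping.single (m' + Poly_Mapping.single y j) (Poly_Mapping.lookup (q j) m'))"
      unfolding Q_def by (intro sum.cong refl) (subst poly_mapping_mult_eq_sum_single, simp)
    then have "Poly_Mapping.lookup Q (m + Poly_Mapping.single y i) =
      (\<Sum>j\<le>degree P. \<Sum>m'\<in>Poly_Mapping.keys (q j). if j = i \<and> m' = m then Poly_Mapping.lookup (q j) m' else 0)"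
      unfolding lookup_sum lookup_single when_def by (simp add: lookup_sum lookup_single when_def, intro sum.cong refl) (auto simp: eq)
    also have "\<dots> = (\<Sum>j\<le>degree P. if j = i then Poly_Mapping.lookup (q j) m else 0)"
      by (intro sum.cong refl) (auto simp: in_keys_iff)
    also have "\<dots> = Poly_Mapping.lookup (q i) m" using i by simp
    finally show False using nz Q0 by simp
  qed
  then have "peval (q i) = 0" if "i \<le> degree P" for i using that by (simp add: peval_def)
  then have "coeff P i = 0" if "i \<le> degree P" for i using q[OF that] d(2) that by (metis mult_eq_0_iff)
  then show "P = 0" by (metis leading_coeff_0_iff order_refl)
qed

lemma alg_indep_empty: "alg_indep K {}"
  unfolding alg_indep_iff
proof (intro ballI impI)
  fix q :: "('a \<Rightarrow>\<^sub>0 nat) \<Rightarrow>\<^sub>0 'a" assume q: "q \<in> mpolys_over K {}" and q0: "peval q = 0"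
  then have sub: "Poly_Mapping.keys q \<subseteq> {0}" by (auto simp: mpolys_over_def)
  have "peval q = Poly_Mapping.lookup q 0"
    using peval_superset[OF _ sub] by (simp add: monom_val_def)
  with q0 sub show "q = 0" by (intro poly_mapping_eqI) (auto simp: in_keys_iff)
qed

lemma alg_indep_insert_iff:
  "y \<notin> S \<Longrightarrow> alg_indep K (insert y S) \<longleftrightarrow> alg_indep K S \<and> transcendental_over (gen_subfield (K \<union> S)) y"
  using alg_indep_insertI alg_indep_insertD alg_indep_subset[of K "insert y S" S] by blast

lemma alg_indep_singleton_iff: "alg_indep K {y} \<longleftrightarrow> transcendental_over K y"
  using alg_indep_insert_iff[of y "{}"] by (simp add: alg_indep_empty gen_subfield_eq[OF K])

text \<open>\<open>K\<close> is algebraically closed in a purely transcendental extension: the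
  variables are peeled off one at a time with the result for one variable.\<close>

lemma algebraic_in_gen_subfield:
  assumes "finite S" "alg_indep K S" "w \<in> gen_subfield (K \<union> S)" "\<not> transcendental_over K w"
  shows "w \<in> K"
  using assms
proof (induction S)
  case empty
  then show ?case by (simp add: gen_subfield_eq[OF K])
next
  case (insert y S)
  let ?F = "gen_subfield (K \<union> S)"
  have "K \<subseteq> ?F" using gen_subfield_superset by blast
  then have "\<not> transcendental_over ?F w" using insert.prems transcendental_over_mono by blast
  moreover have "w \<in> gen_subfield (insert y ?F)" using insert.prems by (simp add: gen_subfield_insert_gen)
  ultimately have "w \<in> ?F"
    using algebraic_in_simple_extension[OF is_subfield_gen_subfield] alg_indep_insertD insert by blast
  then show ?case using insert alg_indep_subset[of K "insert y S" S] by blast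
qed

end

section \<open>Lueroth's theorem in one variable\<close>

lemma prime_elem_dvd_exists:
  fixes a :: "'a::field poly"
  assumes "a \<noteq> 0" "degree a > 0"
  obtains q where "prime_elem q" "q dvd a"
proof -
  obtain q where q: "q dvd a" "degree q > 0" and min: "\<And>b. b dvd a \<Longrightarrow> degree b > 0 \<Longrightarrow> degree q \<le> degree b"
    using ex_has_least_nat[of "\<lambda>q. q dvd a \<and> degree q > 0" a degree] assms by auto
  have "q \<noteq> 0" using q by auto
  have "irreducible q"
  proof (rule irreducibleI)
    fix b c assume bc: "q = b * c"
    then have nz: "b \<noteq> 0" "c \<noteq> 0" using \<open>q \<noteq> 0\<close> by auto
    then have deg: "degree q = degree b + degree c" using bc by (simp add: degree_mult_eq)
    have "b dvd a" "c dvd a" using bc q(1) by (metis dvd_mult_left, metis dvd_mult_right)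
    then have "degree b = 0 \<or> degree c = 0" using min deg q(2)
      by (metis add_cancel_right_right add_le_cancel_left gr0I le_zero_eq add.right_neutral)
    then show "b dvd 1 \<or> c dvd 1" using nz by (auto simp: is_unit_iff_degree)
  qed (use \<open>q \<noteq> 0\<close> q in \<open>auto simp: is_unit_iff_degree\<close>)
  then show ?thesis using that field_poly_irreducible_imp_prime q by blast
qed

text \<open>Gauss's lemma: a polynomial whose coefficients generate the unit ideal is primitive.\<close>

lemma primitive_dvd_smult_cancel:
  fixes P R Q :: "'a::field poly poly"
  assumes "a \<noteq> 0" "smult a Q = P * R" and prim: "(\<Sum>i\<in>I. b i * coeff P i) = 1"
  shows "P dvd Q"
  using assms(1,2)
proof (induction "degree a" arbitrary: a R rule: less_induct)
  case less
  show ?case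
  proof (cases "degree a = 0")
    case True
    then obtain c where c: "a = [:c:]" by (metis degree_0_id)
    with less.prems have "c \<noteq> 0" by auto
    have "Q = smult [:inverse c:] (smult a Q)"
      using \<open>c \<noteq> 0\<close> by (simp add: c one_pCons[symmetric])
    also have "\<dots> = P * smult [:inverse c:] R" by (simp add: less.prems(2))
    finally show ?thesis by (rule dvdI)
  next
    case False
    then obtain q where q: "prime_elem q" "q dvd a" using prime_elem_dvd_exists less.prems by blast
    then obtain a' where a': "a = q * a'" by auto
    \<comment> \<open>A prime dividing all coefficients of \<open>P\<close> would divide the
      combination that equals 1. So \<open>[:q:]\<close>, which is prime among the bivariate
      polynomials, divides \<open>R\<close> and cancels, lowering the degree of
      \<open>a\<close>.\<close>
    have "\<not> [:q:] dvd P"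
    proof
      assume "[:q:] dvd P"
      then have "q dvd (\<Sum>i\<in>I. b i * coeff P i)" by (intro dvd_sum dvd_mult) (simp add: const_poly_dvd_iff)
      then show False using q(1) prim by (simp add: prime_elem_def)
    qed
    moreover have "[:q:] dvd P * R" unfolding less.prems(2)[symmetric] a' by (simp add: const_poly_dvd_iff mult.assoc)
    ultimately have "[:q:] dvd R" using prime_elem_dvd_mult_iff[OF lift_prime_elem_poly[OF q(1)]] by blast
    then obtain R' where R': "R = smult q R'" by (auto elim!: dvdE)
    have "q \<noteq> 0" "a' \<noteq> 0" using a' less.prems(1) by auto
    have "smult q (smult a' Q) = smult q (P * R')" using less.prems(2) by (simp add: a' R')
    then have "smult q (smult a' Q - P * R') = 0" by (simp only: smult_diff_right right_minus_eq)
    then have "smult a' Q = P * R'" using \<open>q \<noteq> 0\<close> by (simp only: smult_eq_0_iff right_minus_eq simp_thms)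
    moreover have "degree a' < degree a"
      using q(1) \<open>q \<noteq> 0\<close> \<open>a' \<noteq> 0\<close> by (auto simp: a' degree_mult_eq prime_elem_def is_unit_iff_degree)
    ultimately show ?thesis using less.hyps \<open>a' \<noteq> 0\<close> by blast
  qed
qed

section \<open>Bivariate polynomials: degree and evaluation in the inner variable\<close>

lemma coeff_mult_sum_bounds:
  fixes p q :: "'a::comm_semiring_0 poly"
  assumes "degree p \<le> a" "degree q \<le> b"
  shows "coeff (p * q) (a + b) = coeff p a * coeff q b"
proof -
  have "coeff (p * q) (a + b) = (\<Sum>i\<in>{a}. coeff p i * coeff q (a + b - i))"
    unfolding coeff_mult
  proof (rule sum.mono_neutral_right)
    show "\<forall>i\<in>{..a + b} - {a}. coeff p i * coeff q (a + b - i) = 0"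
    proof
      fix i assume "i \<in> {..a + b} - {a}"
      then consider "i > a" | "a + b - i > b" by fastforce
      then show "coeff p i * coeff q (a + b - i) = 0"
        using assms by cases (auto simp: coeff_eq_0)
    qed
  qed auto
  then show ?thesis by simp
qed

text \<open>An element of \<open>'a poly poly\<close> is read as P(s, X) with inner variable s and
  outer variable X; this is the coefficient of s^k, a polynomial in X.\<close>

abbreviation inner_coeff :: "nat \<Rightarrow> 'a::zero poly poly \<Rightarrow> 'a poly" where
  "inner_coeff k \<equiv> map_poly (\<lambda>c. coeff c k)"

lemma inner_coeff_mult:
  fixes P Q :: "'a::comm_semiring_0 poly poly"
  assumes "\<And>i. degree (coeff P i) \<le> a" "\<And>i. degree (coeff Q i) \<le> b"
  shows "inner_coeff (a + b) (P * Q) = inner_coeff a P * inner_coeff b Q"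
  by (rule poly_eqI)
    (simp add: coeff_map_poly coeff_mult[of P] coeff_mult[of "inner_coeff a P"] coeff_sum coeff_mult_sum_bounds[OF assms])

lemma inner_coeff_mult_const:
  fixes P Q :: "'a::comm_semiring_0 poly poly"
  assumes "\<And>i. degree (coeff Q i) = 0"
  shows "inner_coeff k (P * Q) = inner_coeff k P * inner_coeff 0 Q"
proof -
  have Q: "coeff Q i = [:coeff (coeff Q i) 0:]" for i using assms[of i] by (metis degree_0_id)
  have "coeff (p * coeff Q i) k = coeff p k * coeff (coeff Q i) 0" for p i
    by (subst Q) (simp add: mult.commute)
  then show ?thesis
    by (intro poly_eqI) (simp add: coeff_map_poly coeff_mult[of P] coeff_mult[of "inner_coeff k P"] coeff_sum)
qed

text \<open>The degree in the inner variable, given by its two characteristic properties; stated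
  this way it also covers \<open>P = 0\<close>.\<close>

lemma inner_degree_bound:
  fixes P :: "'a::zero poly poly"
  obtains d where "\<And>i. degree (coeff P i) \<le> d" "P \<noteq> 0 \<Longrightarrow> inner_coeff d P \<noteq> 0"
proof -
  define d where "d = Max ((\<lambda>i. degree (coeff P i)) ` {..degree P})"
  have le: "degree (coeff P i) \<le> d" for i
  proof (cases "i \<le> degree P")
    case True then show ?thesis unfolding d_def by (intro Max_ge) auto
  qed (simp add: coeff_eq_0)
  have "d \<in> (\<lambda>i. degree (coeff P i)) ` {..degree P}" unfolding d_def by (intro Max_in) auto
  then obtain i where i: "degree (coeff P i) = d" by auto
  have "inner_coeff d P \<noteq> 0" if "P \<noteq> 0"
  proof (cases "d = 0")
    case True
    \<comment> \<open>A coefficient of degree 0 may itself be zero, so the leading outer coefficient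
      serves as witness here.\<close>
    have "degree (coeff P (degree P)) = 0" using le[of "degree P"] True by simp
    then have "coeff (coeff P (degree P)) 0 \<noteq> 0" using that by (metis leading_coeff_0_iff)
    then show ?thesis using True by (metis coeff_0 coeff_map_poly)
  next
    case False
    then have "coeff (coeff P i) d \<noteq> 0" using i by (metis degree_0 leading_coeff_0_iff)
    then show ?thesis by (metis coeff_0 coeff_map_poly)
  qed
  with le that show ?thesis by blast
qed

text \<open>Inner degrees add up in a product, so a factor \<open>P\<close> that already reaches the
  bound \<open>d\<close> leaves nothing for \<open>Q\<close>.\<close>

lemma inner_degree_factor:
  fixes P Q :: "'a::idom poly poly"
  assumes "P * Q \<noteq> 0" "\<And>i. degree (coeff (P * Q) i) \<le> d" "degree (coeff P j) \<ge> d"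
  shows "degree (coeff Q i) = 0"
proof -
  obtain a where a: "\<And>i. degree (coeff P i) \<le> a" "inner_coeff a P \<noteq> 0" using inner_degree_bound[of P] assms(1) by (metis mult_zero_left)
  obtain b where b: "\<And>i. degree (coeff Q i) \<le> b" "inner_coeff b Q \<noteq> 0" using inner_degree_bound[of Q] assms(1) by (metis mult_zero_right)
  have nz: "inner_coeff (a + b) (P * Q) \<noteq> 0" using a b by (simp add: inner_coeff_mult)
  obtain k where "coeff (coeff (P * Q) k) (a + b) \<noteq> 0"
  proof (rule ccontr)
    assume "\<not> thesis"
    then have "inner_coeff (a + b) (P * Q) = 0" using that by (intro poly_eqI) (auto simp: coeff_map_poly)
    with nz show False by contradiction
  qed
  then have "a + b \<le> d" using assms(2)[of k] le_degree le_trans by blast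
  moreover have "d \<le> a" using a(1)[of j] assms(3) by simp
  ultimately have "b = 0" by simp
  then show ?thesis using b(1)[of i] by simp
qed

abbreviation inner_eval :: "'a::comm_semiring_0 \<Rightarrow> 'a poly poly \<Rightarrow> 'a poly" where
  "inner_eval s \<equiv> map_poly (\<lambda>c. poly c s)"

lemma inner_eval_mult: "inner_eval s (P * Q) = inner_eval s P * inner_eval (s::'a::comm_ring_1) Q"
  by (rule poly_eqI) (simp add: coeff_map_poly coeff_mult poly_sum)

lemma inner_eval_smult: "inner_eval s (smult c P) = smult (poly c s) (inner_eval (s::'a::comm_ring_1) P)"
  by (rule poly_eqI) (simp add: coeff_map_poly)

lemma inner_eval_inj:
  assumes K: "is_subfield K" and s: "transcendental_over K s"
    and "\<And>i. coeff P i \<in> polys_over K" "\<And>i. coeff Q i \<in> polys_over K" "inner_eval s P = inner_eval s Q"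
  shows "P = Q"
proof (rule poly_eqI)
  fix i
  have "coeff (inner_eval s P) i = coeff (inner_eval s Q) i" using assms(5) by simp
  then show "coeff P i = coeff Q i"
    using transcendental_over_eq[OF K s assms(3,4)] by (simp add: coeff_map_poly)
qed

lemma simple_extension_common_denominator:
  assumes K: "is_subfield K" and p: "p \<in> polys_over (gen_subfield (insert s K))"
  obtains D P where "D \<in> polys_over K" "poly D s \<noteq> 0" "\<And>i. coeff P i \<in> polys_over K"
    "inner_eval s P = smult (poly D s) p"
proof -
  have "\<exists>D\<in>polys_over K. \<exists>P. poly D s \<noteq> 0 \<and> (\<forall>i. coeff P i \<in> polys_over K) \<and> inner_eval s P = smult (poly D s) p"
    using p
  proof (induction p)
    case 0
    then show ?case by (intro bexI[of _ 1] exI[of _ 0]) (auto simp: polys_over_closed[OF K])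
  next
    case (pCons c p)
    then obtain D P where D: "D \<in> polys_over K" "poly D s \<noteq> 0" "\<forall>i. coeff P i \<in> polys_over K"
      "inner_eval s P = smult (poly D s) p"
      by (auto simp: polys_over_pCons[OF is_subfield_gen_subfield])
    obtain f g where fg: "f \<in> polys_over K" "g \<in> polys_over K" "poly g s \<noteq> 0" "c = poly f s / poly g s"
      using pCons.prems simple_extension_iff[OF K] by (auto simp: polys_over_pCons[OF is_subfield_gen_subfield])
    have "inner_eval s (pCons (D * f) (smult g P)) = smult (poly (D * g) s) (pCons c p)"
      using fg D(4) by (simp add: map_poly_pCons inner_eval_smult mult.commute)
    moreover have "coeff (pCons (D * f) (smult g P)) i \<in> polys_over K" for i
      using D fg by (cases i) (auto intro!: polys_over_mult[OF K])
    ultimately show ?case using D fg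
      by (intro bexI[of _ "D * g"] exI[of _ "pCons (D * f) (smult g P)"]) (auto intro!: polys_over_mult[OF K])
  qed
  then show ?thesis using that by blast
qed

context
  fixes K E :: "'a::field set" and s :: 'a
  assumes K: "is_subfield K" and s: "transcendental_over K s"
    and E: "is_subfield E" and KE: "K \<subseteq> E" and Es: "E \<subseteq> gen_subfield (insert s K)"
begin

text \<open>\<open>d\<close> bounds from below the degrees of the fractions in \<open>E - K\<close>.
  Let \<open>q\<close> be a polynomial of least degree over \<open>E\<close> that kills
  \<open>s\<close>, and P(s, X) its primitive multiple. Some ratio \<open>e\<close> of coefficients
  of \<open>q\<close> is a fraction f(s)/g(s) outside \<open>K\<close>, and \<open>P\<close> divides
  g(s) f(X) - f(s) g(X). Comparing degrees in s shows that the cofactor is free of s, coprimality of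
  \<open>f\<close> and \<open>g\<close> makes it constant, and the degrees in X then give the
  bound.\<close>

lemma luroth_degree_bound:
  assumes d: "\<And>f g a b. f \<in> polys_over K \<Longrightarrow> g \<in> polys_over K \<Longrightarrow> a * f + b * g = 1 \<Longrightarrow> poly g s \<noteq> 0 \<Longrightarrow>
      poly f s / poly g s \<in> E - K \<Longrightarrow> d \<le> max (degree f) (degree g)"
    and p: "p \<in> polys_over E" "p \<noteq> 0" "poly p s = 0"
  shows "d \<le> degree p"
proof -
  obtain q where q: "q \<in> polys_over E" "q \<noteq> 0" "poly q s = 0" and min:
    "\<And>q'. q' \<in> polys_over E \<Longrightarrow> q' \<noteq> 0 \<Longrightarrow> poly q' s = 0 \<Longrightarrow> degree q \<le> degree q'"
    using ex_has_least_nat[of "\<lambda>q. q \<in> polys_over E \<and> q \<noteq> 0 \<and> poly q s = 0" p degree] p by blast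
  define m where "m = degree q"
  have qs: "q \<in> polys_over (gen_subfield (insert s K))" using q(1) Es polys_over_mono by blast
  obtain D P0 where D: "D \<in> polys_over K" "poly D s \<noteq> 0" and P0: "\<And>i. coeff P0 i \<in> polys_over K"
    and P0q: "inner_eval s P0 = smult (poly D s) q"
    using simple_extension_common_denominator[OF K qs] by blast
  have P0c: "poly (coeff P0 i) s = poly D s * coeff q i" for i
    using arg_cong[OF P0q, of "\<lambda>r. coeff r i"] by (simp add: coeff_map_poly)
  have "coeff P0 m \<noteq> 0" using P0c[of m] D(2) q(2) by (auto simp: m_def)
  then have P0m: "\<exists>i\<in>{..m}. coeff P0 i \<noteq> 0" by auto
  obtain h a C where h: "h \<noteq> 0" "h \<in> polys_over K" and "\<And>i. a i \<in> polys_over K" and aC: "\<And>i. C i \<in> polys_over K"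
      "\<And>i. i \<in> {..m} \<Longrightarrow> coeff P0 i = h * C i" "(\<Sum>i\<in>{..m}. a i * C i) = 1"
    by (rule polys_over_bezout[OF K finite_atMost P0 P0m]) (rule that)
  have hs: "poly h s \<noteq> 0" using h transcendental_overD[OF s] by blast
  define P where "P = (\<Sum>i\<le>m. monom (C i) i)"
  have cP: "coeff P i = (if i \<le> m then C i else 0)" for i by (simp add: P_def coeff_sum)
  have CP: "poly h s * poly (C i) s = poly D s * coeff q i" if "i \<le> m" for i
    using P0c[of i] aC(2)[of i] that by simp
  have hP: "smult (poly h s) (inner_eval s P) = smult (poly D s) q"
    by (rule poly_eqI) (simp add: coeff_map_poly cP CP coeff_eq_0 m_def)
  have Pm: "C m \<noteq> 0" using CP[of m] D(2) q(2) by (auto simp: m_def)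
  then have degP: "degree P = m" by (intro antisym degree_le le_degree) (auto simp: cP)

  \<comment> \<open>If all these ratios were in \<open>K\<close>, the normalized \<open>q\<close>
    would be an algebraic equation for \<open>s\<close> over \<open>K\<close>.\<close>
  obtain j where j: "j \<le> m" "coeff q j / coeff q m \<notin> K"
  proof (rule ccontr)
    assume "\<not> thesis"
    then have "coeff q i / coeff q m \<in> K" for i
      using that by (cases "i \<le> m") (auto simp: coeff_eq_0 m_def subfield_0[OF K])
    then have "smult (inverse (coeff q m)) q \<in> polys_over K"
      by (intro polys_overI) (simp add: field_simps)
    moreover have "poly (smult (inverse (coeff q m)) q) s = 0" using q(3) by simp
    ultimately show False using transcendental_overD[OF s] q(2) by (fastforce simp: m_def)
  qed
  define e where "e = coeff q j / coeff q m"
  have eE: "e \<in> E - K" using j(2) q(1) by (auto simp: e_def intro: subfield_divide[OF E] polys_overD)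
  then have es: "e \<in> gen_subfield (insert s K)" using Es by auto
  obtain f g a' b' where fg: "f \<in> polys_over K" "g \<in> polys_over K"
    and "a' \<in> polys_over K" "b' \<in> polys_over K"
    and bez: "a' * f + b' * g = 1" and gs: "poly g s \<noteq> 0" and e: "e = poly f s / poly g s"
    by (rule simple_extension_coprime[OF K es]) (rule that)
  have dmax: "d \<le> max (degree f) (degree g)" using d[OF fg bez gs] eE e by simp
  have "poly (f * C m) s = poly (g * C j) s"
  proof -
    have qm: "coeff q m \<noteq> 0" using q(2) by (simp add: m_def)
    have "poly f s * coeff q m = poly g s * coeff q j" using e gs qm by (simp add: e_def field_simps)
    then have "poly f s * (poly h s * poly (C m) s) = poly g s * (poly h s * poly (C j) s)"
      using CP[of m] CP[OF j(1)] by (simp add: mult.left_commute[of _ "poly D s"])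
    then have "poly h s * (poly f s * poly (C m) s) = poly h s * (poly g s * poly (C j) s)"
      by (simp only: mult.left_commute)
    then show ?thesis using hs by simp
  qed
  then have fC: "f * C m = g * C j"
    by (rule transcendental_over_eq[OF K s, rotated 2]) (use fg aC(1) in \<open>auto intro: polys_over_mult[OF K]\<close>)
  \<comment> \<open>C_j/C_m equals f/g, which is in lowest terms; hence \<open>f\<close> divides
    \<open>C j\<close> and \<open>g\<close> divides \<open>C m\<close>, and the inner degree of
    \<open>P\<close> is at least that of the fraction.\<close>
  have "C j = (a' * f + b' * g) * C j" by (simp only: bez mult_1_left)
  also have "\<dots> = f * (a' * C j) + b' * (g * C j)" by (simp add: algebra_simps)
  also have "\<dots> = f * (a' * C j + b' * C m)" by (simp add: fC[symmetric] algebra_simps)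
  finally have Cj: "C j = f * (a' * C j + b' * C m)" .
  have "C m = (a' * f + b' * g) * C m" by (simp only: bez mult_1_left)
  also have "\<dots> = a' * (f * C m) + g * (b' * C m)" by (simp add: algebra_simps)
  also have "\<dots> = g * (a' * C j + b' * C m)" by (simp add: fC algebra_simps)
  finally have "C m = g * (a' * C j + b' * C m)" .
  with Cj have dvd: "f dvd C j" "g dvd C m" by (blast intro: dvdI)+
  have "C j \<noteq> 0" using CP[OF j(1)] D(2) eE subfield_0[OF K] by (auto simp: e_def)
  have bigP: "\<exists>i. degree (coeff P i) \<ge> max (degree f) (degree g)"
    using dvd_imp_degree_le[OF dvd(1) \<open>C j \<noteq> 0\<close>] dvd_imp_degree_le[OF dvd(2) Pm] j(1)
    by (cases "degree f \<le> degree g") (auto simp: cP max_def intro: exI[of _ j] exI[of _ m])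

  have nprop: "smult (coeff f k) g \<noteq> smult (coeff g k) f" if "coeff f k \<noteq> 0 \<or> coeff g k \<noteq> 0" for k
  proof
    assume eq: "smult (coeff f k) g = smult (coeff g k) f"
    then have "coeff f k * poly g s = coeff g k * poly f s" by (metis poly_smult)
    moreover have "coeff g k \<noteq> 0" using eq that gs by auto
    ultimately have "e = coeff f k / coeff g k" using gs by (simp add: e field_simps)
    then show False using eE fg by (auto intro: subfield_divide[OF K] polys_overD)
  qed
  define F where "F = f - smult e g"
  \<comment> \<open>With inner variable s this is g(s) f(X) - f(s) g(X). Its degree is at most
    \<open>max (degree f) (degree g)\<close> in s, and evaluated at \<open>s\<close> it is
    \<open>F\<close> up to the factor g(s).\<close>
  define G where "G = (\<Sum>i\<le>max (degree f) (degree g). monom (smult (coeff f i) g - smult (coeff g i) f) i)"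
  have cG: "coeff G i = smult (coeff f i) g - smult (coeff g i) f" for i
    by (auto simp: G_def coeff_sum coeff_eq_0)
  have GF: "inner_eval s G = smult (poly g s) F"
    by (rule poly_eqI) (simp add: coeff_map_poly cG F_def e gs field_simps)
  have degG: "degree (coeff G i) \<le> max (degree f) (degree g)" for i
    unfolding cG by (rule degree_diff_le) (auto intro: order_trans[OF degree_smult_le])
  have "coeff f (max (degree f) (degree g)) \<noteq> 0 \<or> coeff g (max (degree f) (degree g)) \<noteq> 0"
    using gs eE subfield_0[OF K] by (cases "degree f \<le> degree g") (auto simp: max_def e)
  then have Gtop: "coeff G (max (degree f) (degree g)) \<noteq> 0" using nprop by (simp add: cG)
  then have "G \<noteq> 0" by auto
  have FE: "F \<in> polys_over E" unfolding F_def
    using fg eE KE by (intro polys_over_diff[OF E] polys_over_smult[OF E]) (auto intro: polys_over_mono[THEN subsetD])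
  have Fs: "poly F s = 0" using gs by (simp add: F_def e)
  have "F mod q = 0"
  proof (rule ccontr)
    assume nz: "F mod q \<noteq> 0"
    have "poly (F mod q) s = 0" using Fs q(3) by (simp add: poly_mod)
    then have "degree q \<le> degree (F mod q)" using min nz polys_over_div_mod[OF E FE q(1)] by blast
    then show False using degree_mod_less'[OF q(2) nz] by simp
  qed
  then have Fq: "F = q * (F div q)" by (metis dvd_mult_div_cancel mod_0_imp_dvd)
  have "F div q \<in> polys_over (gen_subfield (insert s K))"
    using polys_over_div_mod[OF E FE q(1)] Es polys_over_mono by blast
  then obtain D2 R where D2: "D2 \<in> polys_over K" "poly D2 s \<noteq> 0" and R: "\<And>i. coeff R i \<in> polys_over K"
    and RF: "inner_eval s R = smult (poly D2 s) (F div q)"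
    using simple_extension_common_denominator[OF K] by blast
  have PK: "coeff P i \<in> polys_over K" for i using aC(1) by (simp add: cP polys_over_0[OF K])
  have "smult (D * D2) G = P * smult (h * g) R"
  proof (rule inner_eval_inj[OF K s])
    show "coeff (smult (D * D2) G) i \<in> polys_over K" for i
      using D D2 fg by (auto simp: cG intro!: polys_over_mult[OF K] polys_over_diff[OF K] polys_over_smult[OF K] intro: polys_overD)
    show "coeff (P * smult (h * g) R) i \<in> polys_over K" for i
      using PK R h fg by (auto simp: coeff_mult intro!: polys_over_mult[OF K] polys_over_sum[OF K] polys_over_smult[OF K])
    have "inner_eval s (P * smult (h * g) R) = smult (poly g s * poly D2 s) (smult (poly h s) (inner_eval s P) * (F div q))"
      by (simp add: inner_eval_mult inner_eval_smult RF mult_ac)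
    also have "\<dots> = smult (poly g s * poly D2 s * poly D s) F" by (subst (2) Fq) (simp add: hP)
    finally show "inner_eval s (smult (D * D2) G) = inner_eval s (P * smult (h * g) R)"
      by (simp add: inner_eval_smult GF mult_ac)
  qed
  moreover have "D * D2 \<noteq> 0" using D D2 by auto
  moreover have "(\<Sum>i\<in>{..m}. a i * coeff P i) = 1" using aC(3) by (simp add: cP)
  \<comment> \<open>Gauss's lemma: divisibility by the primitive \<open>P\<close> descends from
    K(s)[X] to the bivariate polynomials.\<close>
  ultimately have "P dvd G" using primitive_dvd_smult_cancel by blast
  then obtain Q where Q: "G = P * Q" ..
  obtain i0 where "degree (coeff P i0) \<ge> max (degree f) (degree g)" using bigP by blast
  then have Qc: "degree (coeff Q i) = 0" for i
    using inner_degree_factor[of P Q] degG \<open>G \<noteq> 0\<close> unfolding Q by blast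
  define r where "r = inner_coeff 0 Q"
  \<comment> \<open>The coefficient of s^k in \<open>G\<close> is g_k f - f_k g, so
    \<open>r\<close>, which is \<open>Q\<close> with its constant inner coefficients read off,
    divides all of these. Two of them with nonzero determinant yield \<open>r dvd f\<close> and
    \<open>r dvd g\<close>.\<close>
  have rdvd: "r dvd smult (coeff g k) f - smult (coeff f k) g" for k
  proof -
    have "inner_coeff k G = inner_coeff k P * r" unfolding Q r_def by (rule inner_coeff_mult_const) (rule Qc)
    moreover have "inner_coeff k G = smult (coeff g k) f - smult (coeff f k) g"
      by (rule poly_eqI) (simp add: coeff_map_poly cG mult.commute)
    ultimately show ?thesis by simp
  qed
  have "g \<noteq> 0" using gs by auto
  define l where "l = degree g"
  have gl: "coeff g l \<noteq> 0" using \<open>g \<noteq> 0\<close> by (simp add: l_def)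
  obtain k where "coeff (smult (coeff f l) g) k \<noteq> coeff (smult (coeff g l) f) k"
    using nprop[of l] gl poly_eqI by blast
  then have k: "coeff f l * coeff g k - coeff g l * coeff f k \<noteq> 0" by simp
  have "r dvd smult (coeff g k) (smult (coeff g l) f - smult (coeff f l) g) - smult (coeff g l) (smult (coeff g k) f - smult (coeff f k) g)"
    by (intro dvd_diff dvd_smult rdvd)
  also have "\<dots> = smult (- (coeff f l * coeff g k - coeff g l * coeff f k)) g"
    by (rule poly_eqI) (simp add: algebra_simps)
  finally have "r dvd g" using k by (simp only: dvd_smult_iff neg_equal_0_iff_equal not_False_eq_True simp_thms)
  have "r dvd smult (coeff f k) (smult (coeff g l) f - smult (coeff f l) g) - smult (coeff f l) (smult (coeff g k) f - smult (coeff f k) g)"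
    by (intro dvd_diff dvd_smult rdvd)
  also have "\<dots> = smult (- (coeff f l * coeff g k - coeff g l * coeff f k)) f"
    by (rule poly_eqI) (simp add: algebra_simps)
  finally have "r dvd f" using k by (simp only: dvd_smult_iff neg_equal_0_iff_equal not_False_eq_True simp_thms)
  have "r dvd 1" using \<open>r dvd f\<close> \<open>r dvd g\<close> bez by (metis dvd_add dvd_mult)
  then have "degree r = 0" using dvd_imp_degree_le[of r 1] by simp
  have "degree Q = 0"
  proof -
    have "degree Q \<le> degree r"
    proof (rule ccontr)
      assume "\<not> degree Q \<le> degree r"
      then have "coeff r (degree Q) = 0" by (simp add: coeff_eq_0)
      then have "coeff (coeff Q (degree Q)) 0 = 0" by (simp add: r_def coeff_map_poly)
      then have "coeff Q (degree Q) = 0" using Qc[of "degree Q"] by (metis leading_coeff_0_iff)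
      then show False using \<open>G \<noteq> 0\<close> Q by (simp add: leading_coeff_0_iff)
    qed
    then show ?thesis using \<open>degree r = 0\<close> by simp
  qed
  then have "degree G = m" using \<open>G \<noteq> 0\<close> degP by (simp add: Q degree_mult_eq)
  moreover have "max (degree f) (degree g) \<le> degree G" using Gtop by (rule le_degree)
  ultimately have "d \<le> m" using dmax by linarith
  then show ?thesis using min[OF p] by (simp add: m_def)
qed

text \<open>\<open>u\<close> is an element of \<open>E - K\<close> whose reduced fraction has least
  degree \<open>d\<close>. Then \<open>s\<close> is a root of a polynomial of degree at most
  \<open>d\<close> over K(u), but of no nonzero polynomial of degree below \<open>d\<close> over the
  larger field \<open>E\<close>; so the two fields agree.\<close>

theorem luroth_one_variable:
  assumes "E \<noteq> K"
  obtains u where "u \<in> E" "transcendental_over K u" "E = gen_subfield (insert u K)"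
proof -
  define adm where "adm = (\<lambda>(f, g). f \<in> polys_over K \<and> g \<in> polys_over K \<and> (\<exists>a b. a * f + b * g = 1) \<and>
    poly g s \<noteq> 0 \<and> poly f s / poly g s \<in> E - K)"
  obtain w where w: "w \<in> E - K" using assms KE by auto
  then have ws: "w \<in> gen_subfield (insert s K)" using Es by auto
  obtain f g a b where "f \<in> polys_over K" "g \<in> polys_over K" "a \<in> polys_over K" "b \<in> polys_over K"
    "a * f + b * g = 1" "poly g s \<noteq> 0" "w = poly f s / poly g s"
    by (rule simple_extension_coprime[OF K ws]) (rule that)
  then have "adm (f, g)" using w by (auto simp: adm_def)
  then obtain fg where "adm fg" and min: "\<And>fg'. adm fg' \<Longrightarrow> max (degree (fst fg)) (degree (snd fg)) \<le> max (degree (fst fg')) (degree (snd fg'))"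
    using ex_has_least_nat[of adm "(f, g)" "\<lambda>x. max (degree (fst x)) (degree (snd x))"] by auto
  then obtain f g a b where fg: "f \<in> polys_over K" "g \<in> polys_over K" and bez: "a * f + b * g = 1" and gs: "poly g s \<noteq> 0"
    and uE: "poly f s / poly g s \<in> E - K" and fg_eq: "fg = (f, g)"
    by (cases fg) (auto simp: adm_def)
  define u where "u = poly f s / poly g s"
  define d where "d = max (degree f) (degree g)"
  have bound: "d \<le> degree p" if "p \<in> polys_over E" "p \<noteq> 0" "poly p s = 0" for p
    using _ that by (rule luroth_degree_bound) (use min in \<open>force simp: adm_def d_def fg_eq\<close>)
  let ?L = "gen_subfield (insert u K)"
  have L: "is_subfield ?L" "K \<subseteq> ?L" "u \<in> ?L" using is_subfield_gen_subfield gen_subfield_superset by blast+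
  have LE: "?L \<subseteq> E" using uE KE by (intro gen_subfield_least[OF E]) (auto simp: u_def)
  define F where "F = f - smult u g"
  have FL: "F \<in> polys_over ?L" unfolding F_def
    using fg L by (intro polys_over_diff polys_over_smult) (auto intro: polys_over_mono[THEN subsetD])
  have Fs: "poly F s = 0" using gs by (simp add: F_def u_def)
  have "coeff F d \<noteq> 0"
  proof
    assume "coeff F d = 0"
    then have *: "coeff f d = u * coeff g d" by (simp add: F_def)
    have "f \<noteq> 0" "g \<noteq> 0" using gs uE subfield_0[OF K] by auto
    then have "coeff f d \<noteq> 0 \<or> coeff g d \<noteq> 0" by (cases "degree f \<le> degree g") (auto simp: d_def max_def)
    then have "u = coeff f d / coeff g d" using * by (auto simp: field_simps)
    then show False using uE fg by (auto simp: u_def intro: subfield_divide[OF K] polys_overD)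
  qed
  then have "F \<noteq> 0" by auto
  have degF: "degree F \<le> d" unfolding F_def d_def
    by (rule degree_diff_le) (auto intro: order_trans[OF degree_smult_le])
  have "E \<subseteq> ?L"
  proof
    fix w assume wE: "w \<in> E"
    then have "w \<in> gen_subfield (insert s K)" using Es by auto
    then obtain h k where hk: "h \<in> polys_over K" "k \<in> polys_over K" "poly k s \<noteq> 0" "w = poly h s / poly k s"
      using simple_extension_iff[OF K] by blast
    have hkL: "h mod F \<in> polys_over ?L" "k mod F \<in> polys_over ?L"
      using hk polys_over_mono[OF L(2)] polys_over_div_mod[OF L(1) _ FL] by blast+
    \<comment> \<open>Reduction modulo \<open>F\<close> turns \<open>w = h(s)/k(s)\<close> into an
      equation for \<open>s\<close> over \<open>E\<close> of degree below \<open>d\<close>. It must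
      be trivial, and comparing coefficients expresses \<open>w\<close> over K(u).\<close>
    define p where "p = h mod F - smult w (k mod F)"
    have "poly p s = 0" using Fs hk by (simp add: p_def poly_mod)
    moreover have "p \<in> polys_over E" unfolding p_def
      using hkL wE LE by (intro polys_over_diff[OF E] polys_over_smult[OF E]) (auto intro: polys_over_mono[THEN subsetD])
    moreover have "degree p < d \<or> p = 0"
    proof -
      have "p = p mod F" by (simp add: p_def poly_mod_diff_left mod_smult_left)
      then show ?thesis using degree_mod_less'[OF \<open>F \<noteq> 0\<close>, of p] degF by (metis order.strict_trans2)
    qed
    ultimately have "p = 0" using bound by fastforce
    have "k mod F \<noteq> 0" using poly_mod[OF Fs, of k] hk(3) by auto
    then obtain i where i: "coeff (k mod F) i \<noteq> 0" by (metis leading_coeff_0_iff)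
    have "coeff (h mod F) i = w * coeff (k mod F) i"
      using arg_cong[OF \<open>p = 0\<close>, of "\<lambda>p. coeff p i"] by (simp add: p_def)
    then have "w = coeff (h mod F) i / coeff (k mod F) i" using i by (simp add: field_simps)
    then show "w \<in> ?L" using hkL by (auto intro: subfield_divide[OF L(1)] polys_overD)
  qed
  moreover have "transcendental_over K u"
    using algebraic_in_simple_extension[OF K s] uE Es by (auto simp: u_def)
  ultimately show ?thesis using that LE uE by (auto simp: u_def)
qed

end

section \<open>Embeddings of subfields\<close>

text \<open>Only the values on \<open>E\<close> matter. The condition at 1 excludes the zero map and
  thereby makes \<phi> injective on a subfield.\<close>

definition subfield_hom :: "'a::field set \<Rightarrow> ('a \<Rightarrow> 'a) \<Rightarrow> bool" where
  "subfield_hom E \<phi> \<longleftrightarrow> (\<forall>a\<in>E. \<forall>b\<in>E. \<phi> (a + b) = \<phi> a + \<phi> b \<and> \<phi> (a * b) = \<phi> a * \<phi> b) \<and> \<phi> 1 = 1"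

lemma subfield_hom_subset: "subfield_hom E \<phi> \<Longrightarrow> E' \<subseteq> E \<Longrightarrow> subfield_hom E' \<phi>"
  unfolding subfield_hom_def by blast

context
  fixes E :: "'a::field set" and \<phi> :: "'a \<Rightarrow> 'a"
  assumes E: "is_subfield E" and hom: "subfield_hom E \<phi>"
begin

lemma subfield_hom_add: "a \<in> E \<Longrightarrow> b \<in> E \<Longrightarrow> \<phi> (a + b) = \<phi> a + \<phi> b"
  and subfield_hom_mult: "a \<in> E \<Longrightarrow> b \<in> E \<Longrightarrow> \<phi> (a * b) = \<phi> a * \<phi> b"
  and subfield_hom_1: "\<phi> 1 = 1"
  using hom unfolding subfield_hom_def by simp_all

lemma subfield_hom_0: "\<phi> 0 = 0"
proof -
  have "\<phi> (0 + 0) = \<phi> 0 + \<phi> 0" by (intro subfield_hom_add subfield_0[OF E])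
  then have "\<phi> 0 = \<phi> 0 + \<phi> 0" by (simp only: add_0_right)
  then show ?thesis by (metis add_cancel_right_right)
qed

lemma subfield_hom_uminus: "a \<in> E \<Longrightarrow> \<phi> (- a) = - \<phi> a"
  using subfield_hom_add[of a "- a"] subfield_uminus[OF E] subfield_hom_0
  by (simp add: eq_neg_iff_add_eq_0 add.commute)

lemma subfield_hom_diff: "a \<in> E \<Longrightarrow> b \<in> E \<Longrightarrow> \<phi> (a - b) = \<phi> a - \<phi> b"
  using subfield_hom_add[of a "- b"] subfield_uminus[OF E] subfield_hom_uminus by simp

lemma subfield_hom_nonzero: "a \<in> E \<Longrightarrow> a \<noteq> 0 \<Longrightarrow> \<phi> a \<noteq> 0"
  using subfield_hom_mult[of a "inverse a"] subfield_inverse[OF E] subfield_hom_1 by auto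

lemma subfield_hom_inverse: "a \<in> E \<Longrightarrow> \<phi> (inverse a) = inverse (\<phi> a)"
  using subfield_hom_mult[of a "inverse a"] subfield_inverse[OF E] subfield_hom_1 subfield_hom_0
  by (cases "a = 0") (auto simp: inverse_unique)

lemma subfield_hom_divide: "a \<in> E \<Longrightarrow> b \<in> E \<Longrightarrow> \<phi> (a / b) = \<phi> a / \<phi> b"
  by (simp add: divide_inverse subfield_hom_mult subfield_hom_inverse subfield_inverse[OF E])

lemma subfield_hom_inj: "inj_on \<phi> E"
proof (rule inj_onI)
  fix a b assume "a \<in> E" "b \<in> E" "\<phi> a = \<phi> b"
  then show "a = b"
    using subfield_hom_nonzero[of "a - b"] subfield_diff[OF E] subfield_hom_diff by force
qed

lemma subfield_hom_power: "a \<in> E \<Longrightarrow> \<phi> (a ^ k) = \<phi> a ^ k"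
  by (induction k) (auto simp: subfield_hom_1 subfield_hom_mult subfield_power[OF E])

lemma subfield_hom_sum: "(\<And>i. i \<in> A \<Longrightarrow> f i \<in> E) \<Longrightarrow> \<phi> (sum f A) = (\<Sum>i\<in>A. \<phi> (f i))"
  by (induction A rule: infinite_finite_induct) (auto simp: subfield_hom_0 subfield_hom_add subfield_sum[OF E])

lemma subfield_hom_poly:
  assumes "p \<in> polys_over E" "a \<in> E" shows "\<phi> (poly p a) = poly (map_poly \<phi> p) (\<phi> a)"
  using assms(1)
proof (induction p)
  case 0
  then show ?case by (simp add: subfield_hom_0)
next
  case (pCons c p)
  then show ?case using assms(2)
    by (auto simp: polys_over_pCons[OF E] map_poly_pCons subfield_hom_0 subfield_hom_add subfield_hom_mult
        subfield_mult[OF E] poly_in_subfield[OF E])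
qed

lemma subfield_hom_image: "is_subfield (\<phi> ` E)"
  unfolding is_subfield_def
proof (intro conjI ballI)
  show "0 \<in> \<phi> ` E" "1 \<in> \<phi> ` E"
    using subfield_hom_0 subfield_hom_1 subfield_0[OF E] subfield_1[OF E] by force+
  fix a b assume "a \<in> \<phi> ` E" "b \<in> \<phi> ` E"
  then obtain a' b' where "a' \<in> E" "b' \<in> E" "a = \<phi> a'" "b = \<phi> b'" by auto
  then show "a + b \<in> \<phi> ` E" "a * b \<in> \<phi> ` E"
    using subfield_hom_add[of a' b'] subfield_hom_mult[of a' b'] subfield_add[OF E] subfield_mult[OF E] by (metis imageI)+
next
  fix a assume "a \<in> \<phi> ` E"
  then obtain a' where "a' \<in> E" "a = \<phi> a'" by auto
  then show "- a \<in> \<phi> ` E" "inverse a \<in> \<phi> ` E"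
    using subfield_hom_uminus[of a'] subfield_hom_inverse[of a'] subfield_uminus[OF E] subfield_inverse[OF E] by (metis imageI)+
qed

context
  fixes K :: "'a set"
  assumes K: "is_subfield K" and KE: "K \<subseteq> E" and fixK: "\<And>c. c \<in> K \<Longrightarrow> \<phi> c = c"
begin

lemma subfield_hom_poly_const:
  assumes "p \<in> polys_over K" "a \<in> E" shows "\<phi> (poly p a) = poly p (\<phi> a)"
proof -
  have "map_poly \<phi> p = p"
    by (rule poly_eqI) (use fixK assms(1) in \<open>auto simp: coeff_map_poly subfield_hom_0 polys_overD\<close>)
  then show ?thesis using subfield_hom_poly[of p a] assms polys_over_mono[OF KE] by auto
qed

lemma subfield_hom_transcendental:
  assumes "a \<in> E" shows "transcendental_over K (\<phi> a) \<longleftrightarrow> transcendental_over K a"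
  unfolding transcendental_over_def
  using subfield_hom_poly_const[OF _ assms] subfield_hom_0 subfield_hom_nonzero
    poly_in_subfield[OF E _ assms] polys_over_mono[OF KE] by (metis subsetD)

lemma subfield_hom_simple_extension:
  assumes "a \<in> E" "w \<in> gen_subfield (insert a K)" shows "\<phi> w \<in> gen_subfield (insert (\<phi> a) K)"
proof -
  obtain f g where fg: "f \<in> polys_over K" "g \<in> polys_over K" "poly g a \<noteq> 0" "w = poly f a / poly g a"
    using assms(2) simple_extension_iff[OF K] by blast
  then have "poly f a \<in> E" "poly g a \<in> E" using poly_in_subfield[OF E _ assms(1)] polys_over_mono[OF KE] by blast+
  then have "\<phi> w = poly f (\<phi> a) / poly g (\<phi> a)" "poly g (\<phi> a) \<noteq> 0"
    using fg assms(1) subfield_hom_nonzero by (auto simp: subfield_hom_divide subfield_hom_poly_const[symmetric])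
  then show ?thesis using fg simple_extension_iff[OF K] by blast
qed

text \<open>By injectivity, a rational expression of \<open>\<phi> e\<close> in
  \<open>\<phi> u\<close> over \<open>K\<close> is also one of \<open>e\<close> in
  \<open>u\<close>.\<close>

lemma subfield_hom_pull_back:
  assumes "u \<in> E" "\<phi> ` E = gen_subfield (insert (\<phi> u) K)" shows "E = gen_subfield (insert u K)"
proof
  show "gen_subfield (insert u K) \<subseteq> E" using assms(1) KE by (intro gen_subfield_least[OF E]) auto
  show "E \<subseteq> gen_subfield (insert u K)"
  proof
    fix e assume e: "e \<in> E"
    then obtain f g where fg: "f \<in> polys_over K" "g \<in> polys_over K" "poly g (\<phi> u) \<noteq> 0" "\<phi> e = poly f (\<phi> u) / poly g (\<phi> u)"
      using assms(2) simple_extension_iff[OF K] by blast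
    have EE: "poly f u \<in> E" "poly g u \<in> E" using fg poly_in_subfield[OF E _ assms(1)] polys_over_mono[OF KE] by blast+
    then have "\<phi> e = \<phi> (poly f u / poly g u)" using fg assms(1) by (simp add: subfield_hom_divide subfield_hom_poly_const)
    then have "e = poly f u / poly g u" using subfield_hom_inj e EE subfield_divide[OF E] by (meson inj_onD)
    moreover have "poly g u \<noteq> 0" using fg assms(1) subfield_hom_0 subfield_hom_poly_const by metis
    ultimately show "e \<in> gen_subfield (insert u K)" using fg simple_extension_iff[OF K] by blast
  qed
qed

end

end

section \<open>Specialization of a variable\<close>

text \<open>The place of F(y) at y = a. It is a relation because a fraction may have a pole at
  \<open>a\<close>; transcendence of \<open>y\<close> makes it single-valued.\<close>

definition specializes :: "'a::field set \<Rightarrow> 'a \<Rightarrow> 'a \<Rightarrow> 'a \<Rightarrow> 'a \<Rightarrow> bool" where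
  "specializes F y a e c \<longleftrightarrow> (\<exists>f\<in>polys_over F. \<exists>g\<in>polys_over F.
     poly g a \<noteq> 0 \<and> e = poly f y / poly g y \<and> c = poly f a / poly g a)"

context
  fixes F :: "'a::field set" and y a :: 'a
  assumes F: "is_subfield F" and y: "transcendental_over F y" and aF: "a \<in> F"
begin

lemma specializes_denom: "g \<in> polys_over F \<Longrightarrow> poly g a \<noteq> 0 \<Longrightarrow> poly g y \<noteq> 0"
  using transcendental_overD[OF y, of g] by auto

lemma specializes_in: "specializes F y a e c \<Longrightarrow> c \<in> F"
  by (auto simp: specializes_def intro!: subfield_divide[OF F] poly_in_subfield[OF F] aF)

lemma specializes_const: "c \<in> F \<Longrightarrow> specializes F y a c c"
  unfolding specializes_def
  by (rule bexI[of _ "[:c:]"], rule bexI[of _ 1]) (auto simp: polys_over_pCons[OF F] polys_over_closed[OF F])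

lemma specializes_unique:
  assumes "specializes F y a e c" "specializes F y a e c'" shows "c = c'"
proof -
  obtain f g f' g' where *: "f \<in> polys_over F" "g \<in> polys_over F" "f' \<in> polys_over F" "g' \<in> polys_over F"
    "poly g a \<noteq> 0" "poly g' a \<noteq> 0" "e = poly f y / poly g y" "e = poly f' y / poly g' y"
    "c = poly f a / poly g a" "c' = poly f' a / poly g' a"
    using assms unfolding specializes_def by blast
  have "poly (f * g') y = poly (f' * g) y"
    using specializes_denom[of g] specializes_denom[of g'] * by (simp add: frac_eq_eq)
  then have "f * g' = f' * g"
    by (rule transcendental_over_eq[OF F y, rotated 2]) (use * in \<open>auto intro: polys_over_mult[OF F]\<close>)
  then have "poly f a * poly g' a = poly f' a * poly g a" by (metis poly_mult)
  then show ?thesis using * by (simp add: frac_eq_eq)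
qed

lemma specializes_add:
  assumes "specializes F y a e c" "specializes F y a e' c'"
  shows "specializes F y a (e + e') (c + c')"
proof -
  obtain f g f' g' where *: "f \<in> polys_over F" "g \<in> polys_over F" "f' \<in> polys_over F" "g' \<in> polys_over F"
    "poly g a \<noteq> 0" "poly g' a \<noteq> 0" "e = poly f y / poly g y" "e' = poly f' y / poly g' y"
    "c = poly f a / poly g a" "c' = poly f' a / poly g' a"
    using assms unfolding specializes_def by blast
  show ?thesis unfolding specializes_def
    by (rule bexI[of _ "f * g' + f' * g"], rule bexI[of _ "g * g'"])
      (use * specializes_denom[of g] specializes_denom[of g'] in \<open>auto simp: add_frac_eq intro!: polys_over_add[OF F] polys_over_mult[OF F]\<close>)
qed

lemma specializes_mult:
  assumes "specializes F y a e c" "specializes F y a e' c'"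
  shows "specializes F y a (e * e') (c * c')"
proof -
  obtain f g f' g' where *: "f \<in> polys_over F" "g \<in> polys_over F" "f' \<in> polys_over F" "g' \<in> polys_over F"
    "poly g a \<noteq> 0" "poly g' a \<noteq> 0" "e = poly f y / poly g y" "e' = poly f' y / poly g' y"
    "c = poly f a / poly g a" "c' = poly f' a / poly g' a"
    using assms unfolding specializes_def by blast
  show ?thesis unfolding specializes_def
    by (rule bexI[of _ "f * f'"], rule bexI[of _ "g * g'"])
      (use * in \<open>auto intro!: polys_over_mult[OF F]\<close>)
qed

lemma specializes_inverse:
  assumes "specializes F y a e c" "c \<noteq> 0"
  shows "specializes F y a (inverse e) (inverse c)"
proof -
  obtain f g where *: "f \<in> polys_over F" "g \<in> polys_over F"
    "poly g a \<noteq> 0" "e = poly f y / poly g y" "c = poly f a / poly g a"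
    using assms unfolding specializes_def by blast
  show ?thesis unfolding specializes_def
    by (rule bexI[of _ g], rule bexI[of _ f]) (use * assms(2) in auto)
qed

text \<open>In lowest terms numerator and denominator do not both vanish at \<open>a\<close>: either
  the value is finite, or the reciprocal has value 0.\<close>

lemma specializes_total:
  assumes "e \<in> gen_subfield (insert y F)"
  shows "(\<exists>c. specializes F y a e c) \<or> specializes F y a (inverse e) 0"
proof -
  obtain f g b b' where fg: "f \<in> polys_over F" "g \<in> polys_over F" and "b \<in> polys_over F" "b' \<in> polys_over F"
    and bez: "b * f + b' * g = 1" and "poly g y \<noteq> 0" and e: "e = poly f y / poly g y"
    by (rule simple_extension_coprime[OF F assms]) (rule that)
  show ?thesis
  proof (cases "poly g a = 0")
    case True
    have "poly b a * poly f a + poly b' a * poly g a = 1" using arg_cong[OF bez, of "\<lambda>p. poly p a"] by simp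
    then have "poly f a \<noteq> 0" using True by auto
    then have "specializes F y a (inverse e) 0"
      unfolding specializes_def using fg True e by (intro bexI[of _ g] bexI[of _ f]) auto
    then show ?thesis ..
  qed (use fg e in \<open>auto simp: specializes_def\<close>)
qed

lemma specializes_poly_const:
  assumes "p \<in> polys_over F" "specializes F y a t t'"
  shows "specializes F y a (poly p t) (poly p t')"
  using assms(1)
proof (induction p)
  case 0
  then show ?case using specializes_const[OF subfield_0[OF F]] by simp
next
  case (pCons c p)
  then show ?case using assms(2)
    by (auto simp: polys_over_pCons[OF F] intro!: specializes_add specializes_mult specializes_const)
qed

context
  fixes K E :: "'a set" and t t' :: 'a
  assumes K: "is_subfield K" and KF: "K \<subseteq> F" and E: "is_subfield E" and KE: "K \<subseteq> E"
    and EF: "E \<subseteq> gen_subfield (insert y F)" and t: "t \<in> E" "specializes F y a t t'"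
    and t': "transcendental_over K t'"
    and alg: "\<And>e. e \<in> E \<Longrightarrow> \<not> transcendental_over (gen_subfield (insert t K)) e"
begin

text \<open>Since \<open>t'\<close> is transcendental over \<open>K\<close>, no nonzero polynomial
  over \<open>K\<close> vanishes there: on K(t) the place has neither poles nor zeros.\<close>

lemma specializes_simple_extension:
  assumes "e \<in> gen_subfield (insert t K)"
  shows "\<exists>c. specializes F y a e c \<and> (e \<noteq> 0 \<longrightarrow> c \<noteq> 0)"
proof -
  obtain f g where fg: "f \<in> polys_over K" "g \<in> polys_over K" "poly g t \<noteq> 0" "e = poly f t / poly g t"
    using assms simple_extension_iff[OF K] by blast
  have "poly g t' \<noteq> 0" using transcendental_overD[OF t', of g] fg by auto
  then have "specializes F y a e (poly f t' / poly g t')"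
    unfolding fg(4) divide_inverse using fg t(2) polys_over_mono[OF KF]
    by (intro specializes_mult specializes_inverse specializes_poly_const) auto
  moreover have "poly f t' \<noteq> 0" if "e \<noteq> 0" using transcendental_overD[OF t', of f] fg that by auto
  ultimately show ?thesis using \<open>poly g t' \<noteq> 0\<close> by (metis divide_eq_0_iff)
qed

text \<open>A polynomial of least degree for \<open>e\<close> over K(t) has nonzero constant term.
  If \<open>e\<close> had value 0, the equation would specialize to the vanishing of that term's
  value, which is nonzero.\<close>

lemma specializes_nonzero:
  assumes "e \<in> E" "e \<noteq> 0" shows "\<not> specializes F y a e 0"
proof
  assume e0: "specializes F y a e 0"
  let ?L = "gen_subfield (insert t K)"
  have L: "is_subfield ?L" by (rule is_subfield_gen_subfield)
  have "\<exists>p. p \<in> polys_over ?L \<and> p \<noteq> 0 \<and> poly p e = 0"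
    using alg[OF assms(1)] unfolding transcendental_over_def by blast
  then obtain p where p: "p \<in> polys_over ?L" "p \<noteq> 0" "poly p e = 0"
    and min: "\<And>q. q \<in> polys_over ?L \<and> q \<noteq> 0 \<and> poly q e = 0 \<Longrightarrow> degree p \<le> degree q"
    using ex_has_least_nat[of "\<lambda>p. p \<in> polys_over ?L \<and> p \<noteq> 0 \<and> poly p e = 0" _ degree] by blast
  obtain c q where pq: "p = pCons c q" by (cases p)
  have cq: "c \<in> ?L" "q \<in> polys_over ?L" using p(1) by (auto simp: pq polys_over_pCons[OF L])
  have "c \<noteq> 0"
  proof
    assume c: "c = 0"
    then have "q \<noteq> 0" "poly q e = 0" using p(2,3) assms(2) by (auto simp: pq)
    then show False using min[of q] cq c by (simp add: pq)
  qed
  obtain c' where c': "specializes F y a c c'" "c' \<noteq> 0" using specializes_simple_extension[OF cq(1)] \<open>c \<noteq> 0\<close> by blast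
  have "\<exists>d. specializes F y a (poly q e) d" using cq(2)
  proof (induction q)
    case 0
    then show ?case using specializes_const[OF subfield_0[OF F]] by auto
  next
    case (pCons b q)
    then obtain d where "specializes F y a (poly q e) d" by (auto simp: polys_over_pCons[OF L])
    moreover obtain b' where "specializes F y a b b'"
      using specializes_simple_extension[of b] pCons.prems by (auto simp: polys_over_pCons[OF L])
    ultimately show ?case using specializes_add[OF _ specializes_mult[OF e0]] by fastforce
  qed
  then obtain d where d: "specializes F y a (poly q e) d" ..
  have "specializes F y a (poly p e) (c' + 0 * d)"
    unfolding pq poly_pCons by (intro specializes_add specializes_mult c' d e0)
  then have "c' = 0" using specializes_unique specializes_const[OF subfield_0[OF F]] p(3) by force
  with c' show False by simp
qed

lemma specializes_ex1: assumes "e \<in> E" shows "\<exists>!c. specializes F y a e c"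
proof -
  have "\<exists>c. specializes F y a e c"
  proof (rule ccontr)
    assume not: "\<nexists>c. specializes F y a e c"
    then have "e \<noteq> 0" using specializes_const[OF subfield_0[OF F]] by auto
    \<comment> \<open>A pole of \<open>e\<close> is a zero of its inverse, which lies in
      \<open>E\<close> as well.\<close>
    moreover have "specializes F y a (inverse e) 0" using specializes_total not assms EF by blast
    ultimately show False using specializes_nonzero[of "inverse e"] assms subfield_inverse[OF E] by auto
  qed
  then show ?thesis using specializes_unique by blast
qed

lemma specialization_embedding:
  obtains \<phi> where "subfield_hom E \<phi>" "\<And>c. c \<in> K \<Longrightarrow> \<phi> c = c" "\<phi> ` E \<subseteq> F" "\<phi> t = t'"
proof -
  define \<phi> where "\<phi> e = (THE c. specializes F y a e c)" for e
  have sp: "specializes F y a e (\<phi> e)" if "e \<in> E" for e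
    unfolding \<phi>_def by (rule theI') (rule specializes_ex1[OF that])
  have eq: "\<phi> e = c" if "e \<in> E" "specializes F y a e c" for e c
    using sp that specializes_unique by blast
  show ?thesis
  proof (rule that[of \<phi>])
    show "subfield_hom E \<phi>"
      unfolding subfield_hom_def
      by (auto intro!: eq specializes_add specializes_mult sp specializes_const
          simp: subfield_closed[OF E] subfield_closed[OF F])
  qed (use KE KF t in \<open>auto intro!: eq specializes_const specializes_in sp\<close>)
qed

end

end

section \<open>Choice of the value, and Lueroth's theorem in several variables\<close>

text \<open>Kronecker substitution: with \<open>N\<close> above all inner degrees, substituting the
  \<open>N\<close>-th power of the inner variable for the outer one keeps the coefficients of
  \<open>H\<close> in disjoint ranges of exponents.\<close>

lemma poly_large_power_nonzero:
  fixes H :: "'a::idom poly poly"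
  assumes "H \<noteq> 0" "\<And>i. degree (coeff H i) < N"
  shows "poly H (monom 1 N) \<noteq> 0"
  using assms
proof (induction H)
  case (pCons h H)
  have h: "degree h < N" using pCons.prems(2)[of 0] by simp
  show ?case
  proof (cases "H = 0")
    case True
    then show ?thesis using pCons by simp
  next
    case False
    have "degree (coeff H i) < N" for i using pCons.prems(2)[of "Suc i"] by simp
    then have "poly H (monom 1 N) \<noteq> 0" using pCons.IH False by blast
    then have "degree (monom 1 N * poly H (monom 1 N)) = N + degree (poly H (monom 1 N))"
      by (simp add: degree_mult_eq degree_monom_eq)
    then have "degree (h + monom 1 N * poly H (monom 1 N)) = N + degree (poly H (monom 1 N))"
      using h by (subst degree_add_eq_right) auto
    then show ?thesis using h by (metis poly_pCons degree_0 add_is_0 not_less0)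
  qed
qed simp

lemma poly_inner_eval: "poly (poly H q) x = poly (inner_eval x H) (poly q (x::'a::comm_ring_1))"
  by (induction H) (auto simp: map_poly_pCons)

text \<open>The value \<open>x ^ N\<close> with \<open>N\<close> large keeps numerator and denominator of \<open>t\<close> linearly independent
  over \<open>F\<^sub>0\<close>, also when \<open>F\<^sub>0\<close> is finite.\<close>

lemma specialization_nonconstant:
  assumes F0: "is_subfield F0" and x: "transcendental_over F0 x"
    and y: "transcendental_over (gen_subfield (insert x F0)) y"
    and t: "t \<in> gen_subfield (insert y (gen_subfield (insert x F0)))" "t \<notin> gen_subfield (insert x F0)"
  obtains a t' where "a \<in> gen_subfield (insert x F0)" "specializes (gen_subfield (insert x F0)) y a t t'" "t' \<notin> F0"
proof -
  let ?F = "gen_subfield (insert x F0)"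
  have F: "is_subfield ?F" by (rule is_subfield_gen_subfield)
  have F0F: "F0 \<subseteq> ?F" "x \<in> ?F" using gen_subfield_superset by blast+
  obtain f g where fg: "f \<in> polys_over ?F" "g \<in> polys_over ?F" "poly g y \<noteq> 0" "t = poly f y / poly g y"
    using t(1) simple_extension_iff[OF F] by blast
  obtain D1 P1 where D1: "D1 \<in> polys_over F0" "poly D1 x \<noteq> 0" and P1: "\<And>i. coeff P1 i \<in> polys_over F0" "inner_eval x P1 = smult (poly D1 x) f"
    by (rule simple_extension_common_denominator[OF F0 fg(1)]) (rule that)
  obtain D2 P2 where D2: "D2 \<in> polys_over F0" "poly D2 x \<noteq> 0" and P2: "\<And>i. coeff P2 i \<in> polys_over F0" "inner_eval x P2 = smult (poly D2 x) g"
    by (rule simple_extension_common_denominator[OF F0 fg(2)]) (rule that)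
  obtain n1 where n1: "\<And>i. degree (coeff P1 i) \<le> n1" and "P1 \<noteq> 0 \<Longrightarrow> inner_coeff n1 P1 \<noteq> 0"
    by (rule inner_degree_bound[of P1]) (rule that)
  obtain n2 where n2: "\<And>i. degree (coeff P2 i) \<le> n2" and "P2 \<noteq> 0 \<Longrightarrow> inner_coeff n2 P2 \<noteq> 0"
    by (rule inner_degree_bound[of P2]) (rule that)
  define N where "N = Suc (max (degree D2 + n1) (degree D1 + n2))"
  have d1: "degree (D2 * coeff P1 i) < N" for i using degree_mult_le[of D2 "coeff P1 i"] n1[of i] by (simp add: N_def)
  have d2: "degree (D1 * coeff P2 i) < N" for i using degree_mult_le[of D1 "coeff P2 i"] n2[of i] by (simp add: N_def)
  define D where "D = poly D1 x * poly D2 x"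
  have "D \<noteq> 0" using D1 D2 by (simp add: D_def)
  \<comment> \<open>A nontrivial combination of \<open>f\<close> and \<open>g\<close> over
    \<open>F0\<close> is not the zero polynomial, because \<open>t\<close> is not in
    \<open>F0\<close> and g(y) is nonzero. With denominators cleared it is \<open>H\<close>, and the
    choice of \<open>N\<close> keeps its value at \<open>x ^ N\<close> nonzero.\<close>
  have key: "c1 * poly f (x ^ N) + c2 * poly g (x ^ N) \<noteq> 0" if c: "c1 \<in> F0" "c2 \<in> F0" "c1 \<noteq> 0 \<or> c2 \<noteq> 0" for c1 c2
  proof -
    define H where "H = smult (smult c1 D2) P1 + smult (smult c2 D1) P2"
    have "inner_eval x H = inner_eval x (smult (smult c1 D2) P1) + inner_eval x (smult (smult c2 D1) P2)"
      unfolding H_def by (rule poly_eqI) (simp add: coeff_map_poly)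
    then have H: "inner_eval x H = smult D (smult c1 f + smult c2 g)"
      by (simp add: inner_eval_smult P1 P2 D_def smult_add_right mult_ac)
    have "H \<noteq> 0"
    proof
      assume "H = 0"
      then have "smult c1 f + smult c2 g = 0" using H \<open>D \<noteq> 0\<close> by (metis map_poly_0 smult_eq_0_iff)
      then have *: "c1 * poly f y + c2 * poly g y = 0" by (metis poly_0 poly_add poly_smult)
      then have "c1 \<noteq> 0" using c fg(3) by auto
      then have "t = - c2 / c1" using * fg(3) by (simp add: fg(4) field_simps eq_neg_iff_add_eq_0)
      then show False using t(2) c F0F by (auto intro!: subfield_divide[OF F] subfield_uminus[OF F])
    qed
    moreover have "degree (coeff H i) < N" for i
      unfolding H_def coeff_add coeff_smult
      by (rule degree_add_less) (use d1[of i] d2[of i] degree_smult_le in \<open>auto intro: le_less_trans simp: mult_smult_left\<close>)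
    ultimately have "poly H (monom 1 N) \<noteq> 0" by (rule poly_large_power_nonzero)
    moreover have "poly H (monom 1 N) \<in> polys_over F0"
    proof -
      have "coeff H i \<in> polys_over F0" for i
        unfolding H_def using c D1 D2 P1 P2
        by (auto intro!: polys_over_add[OF F0] polys_over_smult[OF F0] polys_over_mult[OF F0])
      then show ?thesis
        by (simp add: poly_altdef polys_over_sum[OF F0] polys_over_mult[OF F0] polys_over_power[OF F0] polys_over_monom[OF F0] subfield_1[OF F0])
    qed
    ultimately have "poly (poly H (monom 1 N)) x \<noteq> 0" using transcendental_overD[OF x] by blast
    then have "D * (c1 * poly f (x ^ N) + c2 * poly g (x ^ N)) \<noteq> 0"
      by (simp add: poly_inner_eval H poly_monom)
    then show ?thesis by auto
  qed
  have g: "poly g (x ^ N) \<noteq> 0" using key[of 0 1] by (simp add: subfield_0[OF F0] subfield_1[OF F0])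
  show ?thesis
  proof (rule that[of "x ^ N"])
    show "x ^ N \<in> ?F" using F0F by (simp add: subfield_power[OF F])
    show "specializes ?F y (x ^ N) t (poly f (x ^ N) / poly g (x ^ N))"
      using fg g unfolding specializes_def by blast
    \<comment> \<open>A value in \<open>F0\<close> would itself provide the excluded
      combination.\<close>
    show "poly f (x ^ N) / poly g (x ^ N) \<notin> F0"
      using key[of 1 "- (poly f (x ^ N) / poly g (x ^ N))"] g by (auto simp: subfield_1[OF F0] subfield_uminus[OF F0])
  qed
qed

text \<open>Induction on the number of variables: \<open>E\<close> is embedded into the field of the
  remaining variables by specializing \<open>y\<close>, and a generator of the image is pulled back.
  Algebraicity of \<open>E\<close> over K(t) is what makes the specialization defined and injective
  on all of \<open>E\<close>; it is inherited by the image.\<close>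

theorem luroth:
  fixes K :: "'a::field set"
  assumes "finite S" and K: "is_subfield K" and "alg_indep K S" "is_subfield E" "K \<subseteq> E" "E \<subseteq> gen_subfield (K \<union> S)"
    "t \<in> E" "transcendental_over K t" "\<And>e. e \<in> E \<Longrightarrow> \<not> transcendental_over (gen_subfield (insert t K)) e"
  shows "\<exists>u\<in>E. transcendental_over K u \<and> E = gen_subfield (insert u K)"
  using assms(1,3-)
proof (induction S arbitrary: E t)
  case empty
  then have "t \<in> K" by (auto simp: gen_subfield_eq[OF K])
  then show ?case using transcendental_over_notin[OF K empty.prems(6)] by simp
next
  case (insert y S)
  let ?F = "gen_subfield (K \<union> S)"
  have F: "is_subfield ?F" "K \<subseteq> ?F" using is_subfield_gen_subfield gen_subfield_superset by blast+
  have S: "alg_indep K S" using alg_indep_subset[OF insert.prems(1)] by blast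
  have y: "transcendental_over ?F y" using alg_indep_insertD[OF K] insert by blast
  have EF: "E \<subseteq> gen_subfield (insert y ?F)" using insert.prems(4) by (simp add: gen_subfield_insert_gen)
  show ?case
  proof (cases "S = {}")
    case True
    then have FK: "?F = K" by (simp add: gen_subfield_eq[OF K])
    have "E \<noteq> K" using transcendental_over_notin[OF K] insert.prems by blast
    then show ?thesis
      using luroth_one_variable[OF K _ insert.prems(2,3), of y] y EF unfolding FK by metis
  next
    case False
    \<comment> \<open>The value of \<open>t\<close> has to stay transcendental over
      \<open>K\<close>. If \<open>t\<close> is free of \<open>y\<close>, the value 0 for
      \<open>y\<close> does; otherwise another variable \<open>x\<close> is singled out and
      \<open>y\<close> becomes a power of it.\<close>
    have "\<exists>a t'. a \<in> ?F \<and> specializes ?F y a t t' \<and> transcendental_over K t'"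
    proof (cases "t \<in> ?F")
      case True
      then show ?thesis
        using specializes_const[OF F(1) y subfield_0[OF F(1)] True] subfield_0[OF F(1)] insert.prems(6) by blast
    next
      case tF: False
      obtain x S' where x: "S = insert x S'" "x \<notin> S'" using False by (metis mk_disjoint_insert ex_in_conv)
      let ?M = "gen_subfield (K \<union> S')"
      have F0: "is_subfield ?M" "K \<subseteq> ?M" using is_subfield_gen_subfield gen_subfield_superset by blast+
      have xt: "transcendental_over ?M x" using alg_indep_insertD[OF K] S x by blast
      have FF0: "?F = gen_subfield (insert x ?M)" by (simp only: gen_subfield_insert_gen x(1) Un_insert_right)
      obtain a t' where at: "a \<in> ?F" "specializes ?F y a t t'" "t' \<notin> ?M"
        using specialization_nonconstant[OF F0(1) xt, of y t] y tF EF insert.prems(5) unfolding FF0 by blast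
      have "t' \<in> ?F" using specializes_in[OF F(1) y at(1,2)] .
      then have "transcendental_over ?M t'"
        using algebraic_in_simple_extension[OF F0(1) xt] at(3) unfolding FF0 by blast
      then show ?thesis using at transcendental_over_mono F0(2) by blast
    qed
    then obtain a t' where a: "a \<in> ?F" and sp: "specializes ?F y a t t'" and t': "transcendental_over K t'" by blast
    obtain \<phi> where hom: "subfield_hom E \<phi>" and fx: "\<And>c. c \<in> K \<Longrightarrow> \<phi> c = c" and im: "\<phi> ` E \<subseteq> ?F" and \<phi>t: "\<phi> t = t'"
      by (rule specialization_embedding[OF F(1) y a K F(2) insert.prems(2,3) EF insert.prems(5) sp t' insert.prems(7)], assumption) (rule that)
    note E = insert.prems(2)
    have KE: "K \<subseteq> \<phi> ` E" using fx insert.prems(3) by (metis image_eqI subsetD subsetI)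
    have "\<exists>u\<in>\<phi> ` E. transcendental_over K u \<and> \<phi> ` E = gen_subfield (insert u K)"
    proof (rule insert.IH[OF S subfield_hom_image[OF E hom] KE im _ t'])
      show "t' \<in> \<phi> ` E" using \<phi>t insert.prems(5) by blast
      fix e' assume "e' \<in> \<phi> ` E"
      then obtain e where e: "e \<in> E" "e' = \<phi> e" by blast
      let ?L = "gen_subfield (insert t K)"
      have LE: "?L \<subseteq> E" using insert.prems(3,5) by (intro gen_subfield_least[OF E]) auto
      obtain p where p: "p \<in> polys_over ?L" "p \<noteq> 0" "poly p e = 0"
        using insert.prems(7)[OF e(1)] unfolding transcendental_over_def by blast
      have pE: "p \<in> polys_over E" using p(1) polys_over_mono[OF LE] by blast
      have c: "coeff (map_poly \<phi> p) i = \<phi> (coeff p i)" for i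
        by (simp add: coeff_map_poly subfield_hom_0[OF E hom])
      have "map_poly \<phi> p \<in> polys_over (gen_subfield (insert t' K))"
        using subfield_hom_simple_extension[OF E hom K insert.prems(3) fx insert.prems(5)] polys_overD[OF p(1)]
        by (intro polys_overI) (simp add: c \<phi>t[symmetric])
      moreover have "poly (map_poly \<phi> p) e' = 0"
        using subfield_hom_poly[OF E hom pE e(1)] p(3) e(2) by (simp add: subfield_hom_0[OF E hom])
      moreover have "map_poly \<phi> p \<noteq> 0"
      proof
        assume "map_poly \<phi> p = 0"
        then have "\<phi> (lead_coeff p) = 0" using c[of "degree p"] by simp
        then show False using subfield_hom_nonzero[OF E hom polys_overD[OF pE]] p(2) by (metis leading_coeff_0_iff)
      qed
      ultimately show "\<not> transcendental_over (gen_subfield (insert t' K)) e'"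
        unfolding transcendental_over_def by blast
    qed
    then obtain u where u: "u \<in> E" "transcendental_over K (\<phi> u)" "\<phi> ` E = gen_subfield (insert (\<phi> u) K)" by blast
    then show ?thesis
      using subfield_hom_pull_back[OF E hom K insert.prems(3) fx] subfield_hom_transcendental[OF E hom K insert.prems(3) fx] by blast
  qed
qed

section \<open>Transcendence degree\<close>

lemma trdeg_is_1D:
  assumes K: "is_subfield K" and "trdeg_is K E 1"
  obtains t where "t \<in> E" "transcendental_over K t"
    "\<And>e. e \<in> E \<Longrightarrow> \<not> transcendental_over (gen_subfield (insert t K)) e"
proof -
  obtain S where S: "S \<subseteq> E" "card S = 1" "alg_indep K S" and max: "\<And>e. e \<in> E - S \<Longrightarrow> \<not> alg_indep K (insert e S)"
    using assms(2) unfolding trdeg_is_def by blast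
  then obtain t where t: "S = {t}" by (auto simp: card_1_singleton_iff)
  show ?thesis
  proof (rule that[of t])
    show "t \<in> E" "transcendental_over K t" using S t alg_indep_singleton_iff[OF K] by auto
    fix e assume e: "e \<in> E"
    have L: "gen_subfield (K \<union> S) = gen_subfield (insert t K)" by (simp add: t)
    show "\<not> transcendental_over (gen_subfield (insert t K)) e"
    proof (cases "e = t")
      case True
      then show ?thesis
        using transcendental_over_notin[OF is_subfield_gen_subfield] gen_subfield_superset[of "insert t K"] by blast
    next
      case False
      then show ?thesis using alg_indep_insertI[OF K S(3), of e, unfolded L] max[of e] e t by auto
    qed
  qed
qed

lemma trdeg_is_0D:
  assumes K: "is_subfield K" and "trdeg_is K E 0" "e \<in> E"
  shows "\<not> transcendental_over K e"
  using assms by (auto simp: trdeg_is_def alg_indep_singleton_iff[OF K])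

lemma trdeg_is_gen_subfield:
  assumes K: "is_subfield K" and "finite S" "alg_indep K S"
  shows "trdeg_is K (gen_subfield (K \<union> S)) (card S)"
  unfolding trdeg_is_def
proof (intro exI[of _ S] conjI ballI)
  fix e assume e: "e \<in> gen_subfield (K \<union> S) - S"
  show "\<not> alg_indep K (insert e S)"
    using alg_indep_insertD[OF K, of e S] transcendental_over_notin[OF is_subfield_gen_subfield] e by blast
qed (use assms gen_subfield_superset[of "K \<union> S"] in auto)

section \<open>Fractional linear substitutions\<close>

lemma bezout_dvd_power_mult:
  fixes A B Z :: "'a::comm_ring_1"
  assumes bez: "a * A + b * B = 1" and "B dvd A ^ e * Z" shows "B dvd Z"
  using assms(2)
proof (induction e)
  case (Suc e)
  have "A ^ e * Z = (a * A + b * B) * (A ^ e * Z)" by (simp only: bez mult_1_left)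
  also have "\<dots> = a * (A ^ Suc e * Z) + B * (b * (A ^ e * Z))" by (simp add: algebra_simps)
  finally have "B dvd A ^ e * Z" using Suc.prems by (metis dvd_add dvd_mult dvd_triv_left)
  then show ?case by (rule Suc.IH)
qed simp

text \<open>The sum is the homogenization of \<open>C\<close> of degree \<open>e\<close> at (A, B):
  modulo \<open>B\<close> only its term in A^e survives, modulo \<open>A\<close> only the one in
  B^e.\<close>

lemma homogenize_mod:
  fixes A B C :: "'a::comm_ring_1 poly"
  assumes "degree C \<le> e"
  shows "B dvd (\<Sum>i\<le>e. smult (coeff C i) (A ^ i * B ^ (e - i))) - smult (coeff C e) (A ^ e)"
    and "A dvd (\<Sum>i\<le>e. smult (coeff C i) (A ^ i * B ^ (e - i))) - smult (coeff C 0) (B ^ e)"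
proof -
  have "(\<Sum>i\<le>e. smult (coeff C i) (A ^ i * B ^ (e - i))) - smult (coeff C e) (A ^ e)
      = (\<Sum>i<e. smult (coeff C i) (A ^ i * B ^ (e - i)))"
    by (simp add: lessThan_Suc_atMost[symmetric])
  also have "B dvd \<dots>" by (intro dvd_sum dvd_smult dvd_mult dvd_power) auto
  finally show "B dvd (\<Sum>i\<le>e. smult (coeff C i) (A ^ i * B ^ (e - i))) - smult (coeff C e) (A ^ e)" .
  have "(\<Sum>i\<le>e. smult (coeff C i) (A ^ i * B ^ (e - i)))
      = smult (coeff C 0) (B ^ e) + (\<Sum>i\<in>{..e} - {0}. smult (coeff C i) (A ^ i * B ^ (e - i)))"
    by (subst sum.remove[of _ 0]) auto
  then have "(\<Sum>i\<le>e. smult (coeff C i) (A ^ i * B ^ (e - i))) - smult (coeff C 0) (B ^ e)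
      = (\<Sum>i\<in>{..e} - {0}. smult (coeff C i) (A ^ i * B ^ (e - i)))" by simp
  also have "A dvd \<dots>" by (intro dvd_sum dvd_smult dvd_mult2 dvd_power) auto
  finally show "A dvd (\<Sum>i\<le>e. smult (coeff C i) (A ^ i * B ^ (e - i))) - smult (coeff C 0) (B ^ e)" .
qed

lemma poly_homogenize:
  fixes A B C :: "'a::field poly"
  assumes "degree C \<le> e" "poly B u \<noteq> 0"
  shows "poly (\<Sum>i\<le>e. smult (coeff C i) (A ^ i * B ^ (e - i))) u = poly B u ^ e * poly C (poly A u / poly B u)"
proof -
  have "poly C z = (\<Sum>i\<le>e. coeff C i * z ^ i)" for z
    unfolding poly_altdef by (rule sum.mono_neutral_left) (use assms(1) in \<open>auto simp: coeff_eq_0\<close>)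
  then show ?thesis using assms(2)
    by (simp add: poly_sum sum_distrib_left power_divide power_diff algebra_simps)
qed

definition frac_linear :: "'a::field set \<Rightarrow> 'a \<Rightarrow> 'a \<Rightarrow> 'a \<Rightarrow> 'a \<Rightarrow> 'a \<Rightarrow> 'a \<Rightarrow> bool" where
  "frac_linear K u w a b c d \<longleftrightarrow> a \<in> K \<and> b \<in> K \<and> c \<in> K \<and> d \<in> K \<and> a * d - b * c \<noteq> 0 \<and>
     c * u + d \<noteq> 0 \<and> w * (c * u + d) = a * u + b"

text \<open>Let w = A(u)/B(u) and u = C(w)/D(w) in lowest terms. Substituting and homogenizing gives
  an identity of polynomials in u; modulo \<open>B\<close> it shows that \<open>B\<close> divides
  \<open>[:coeff C e, - coeff D e:]\<close>, and modulo \<open>A\<close> that \<open>A\<close>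
  divides \<open>[:coeff C 0, - coeff D 0:]\<close>. Both are nonzero of degree at most 1. A zero
  determinant would put \<open>w\<close>, hence \<open>u\<close>, into \<open>K\<close>.\<close>

lemma frac_linear_exists:
  assumes K: "is_subfield K" and u: "transcendental_over K u"
    and wu: "w \<in> gen_subfield (insert u K)" and uw: "u \<in> gen_subfield (insert w K)"
  shows "\<exists>a b c d. frac_linear K u w a b c d"
proof -
  obtain A B a b where AB: "A \<in> polys_over K" "B \<in> polys_over K" and "a \<in> polys_over K" "b \<in> polys_over K"
    and bez: "a * A + b * B = 1" and Bu: "poly B u \<noteq> 0" and w: "w = poly A u / poly B u"
    by (rule simple_extension_coprime[OF K wu]) (rule that)
  obtain C D c d where CD: "C \<in> polys_over K" "D \<in> polys_over K" and "c \<in> polys_over K" "d \<in> polys_over K"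
    and bez': "c * C + d * D = 1" and Dw: "poly D w \<noteq> 0" and uCD: "u = poly C w / poly D w"
    by (rule simple_extension_coprime[OF K uw]) (rule that)
  define e where "e = max (degree C) (degree D)"
  define H where "H p = (\<Sum>i\<le>e. smult (coeff p i) (A ^ i * B ^ (e - i)))" for p
  have HK: "H p \<in> polys_over K" if "p \<in> polys_over K" for p unfolding H_def
    using AB polys_overD[OF that]
    by (intro polys_over_sum[OF K] polys_over_smult[OF K] polys_over_mult[OF K] polys_over_power[OF K])
  have dC: "degree C \<le> e" "degree D \<le> e" by (auto simp: e_def)
  have "poly (H C) u = poly B u ^ e * poly C w" "poly (H D) u = poly B u ^ e * poly D w"
    unfolding H_def w by (rule poly_homogenize[OF dC(1) Bu], rule poly_homogenize[OF dC(2) Bu])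
  moreover have "poly C w = u * poly D w" using uCD Dw by (metis nonzero_eq_divide_eq)
  ultimately have "poly (H C) u = poly ([:0, 1:] * H D) u" by simp
  then have "H C = [:0, 1:] * H D"
    by (rule transcendental_over_eq[OF K u, rotated 2])
      (use HK CD in \<open>auto intro!: polys_over_mult[OF K] simp: polys_over_pCons[OF K] polys_over_closed[OF K] subfield_closed[OF K]\<close>)
  then have eq: "(H C - smult (coeff C k) Z) - [:0, 1:] * (H D - smult (coeff D k) Z) = - (Z * [:coeff C k, - coeff D k:])" for k Z
    by (simp add: algebra_simps)
  have "B dvd A ^ e * [:coeff C e, - coeff D e:]"
    using dvd_diff[OF homogenize_mod(1)[OF dC(1), of B A] dvd_mult[OF homogenize_mod(1)[OF dC(2), of B A], of "[:0, 1:]"]]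
    unfolding H_def[symmetric] eq by (simp only: dvd_minus_iff)
  then have Bd: "B dvd [:coeff C e, - coeff D e:]" by (rule bezout_dvd_power_mult[OF bez])
  have "A dvd B ^ e * [:coeff C 0, - coeff D 0:]"
    using dvd_diff[OF homogenize_mod(2)[OF dC(1), of A B] dvd_mult[OF homogenize_mod(2)[OF dC(2), of A B], of "[:0, 1:]"]]
    unfolding H_def[symmetric] eq by (simp only: dvd_minus_iff)
  moreover have "b * B + a * A = 1" by (subst add.commute) (rule bez)
  ultimately have Ad: "A dvd [:coeff C 0, - coeff D 0:]" by (rule bezout_dvd_power_mult[rotated])
  \<comment> \<open>\<open>e\<close> is the degree of \<open>C\<close> or of \<open>D\<close>, and
    the Bezout relation excludes that both are zero.\<close>
  have "coeff C e \<noteq> 0 \<or> coeff D e \<noteq> 0"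
  proof (rule ccontr)
    assume zero: "\<not> ?thesis"
    have "degree C = e \<or> degree D = e" by (simp add: e_def max_def)
    then have "(C = 0 \<or> D = 0) \<and> e = 0" using zero leading_coeff_0_iff[of C] leading_coeff_0_iff[of D] by auto
    then have "C = 0 \<and> D = 0" using zero dC leading_coeff_0_iff[of C] leading_coeff_0_iff[of D] by auto
    then show False using bez' by simp
  qed
  then have dB: "degree B \<le> 1" using dvd_imp_degree_le[OF Bd] by (auto split: if_splits)
  have "coeff C 0 \<noteq> 0 \<or> coeff D 0 \<noteq> 0"
    using arg_cong[OF bez', of "\<lambda>p. coeff p 0"] by (auto simp: coeff_mult_0)
  then have dA: "degree A \<le> 1" using dvd_imp_degree_le[OF Ad] by (auto split: if_splits)
  have lin: "p = [:coeff p 0, coeff p 1:]" if "degree p \<le> 1" for p :: "'a poly"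
    by (rule poly_eqI) (use that in \<open>auto simp: coeff_pCons coeff_eq_0 split: nat.splits\<close>)
  have A: "poly A u = coeff A 1 * u + coeff A 0" by (subst lin[OF dA]) (simp add: mult.commute)
  have B: "poly B u = coeff B 1 * u + coeff B 0" by (subst lin[OF dB]) (simp add: mult.commute)
  have "coeff A 1 * coeff B 0 - coeff A 0 * coeff B 1 \<noteq> 0"
  proof
    assume det: "coeff A 1 * coeff B 0 - coeff A 0 * coeff B 1 = 0"
    have "w \<in> K"
    proof (cases "coeff B 1 = 0")
      case True
      then have "coeff B 0 \<noteq> 0" "coeff A 1 = 0" using B Bu det by auto
      then have "w = coeff A 0 / coeff B 0" using A B True by (simp add: w)
      then show ?thesis using AB by (auto intro!: subfield_divide[OF K] polys_overD)
    next
      case False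
      then have "coeff B 1 * poly A u = coeff A 1 * poly B u" using det unfolding A B by (simp add: algebra_simps)
      then have "w = coeff A 1 / coeff B 1" using False Bu by (simp add: w field_simps)
      then show ?thesis using AB by (auto intro!: subfield_divide[OF K] polys_overD)
    qed
    then have "insert w K = K" by auto
    then have "u \<in> K" using uw by (simp add: gen_subfield_eq[OF K])
    then show False using transcendental_over_notin[OF K u] by simp
  qed
  then have "frac_linear K u w (coeff A 1) (coeff A 0) (coeff B 1) (coeff B 0)"
    unfolding frac_linear_def using polys_overD[OF AB(1)] polys_overD[OF AB(2)] Bu A B by (auto simp: w)
  then show ?thesis by blast
qed

section \<open>Elements of order p and their fixed points\<close>

text \<open>The coefficients of \<open>X ^ k\<close> modulo \<open>X\<^sup>2 - t X + \<delta>\<close>, hence of the \<open>k\<close>-th power of a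
  \<open>2 \<times> 2\<close> matrix with trace \<open>t\<close> and determinant \<open>\<delta>\<close>.\<close>

fun power_mod_coeffs :: "'a::comm_ring_1 \<Rightarrow> 'a \<Rightarrow> nat \<Rightarrow> 'a \<times> 'a" where
  "power_mod_coeffs t \<delta> 0 = (0, 1)"
| "power_mod_coeffs t \<delta> (Suc k) = (let (\<alpha>, \<beta>) = power_mod_coeffs t \<delta> k in (t * \<alpha> + \<beta>, - \<delta> * \<alpha>))"

lemma power_mod_coeffs_dvd:
  "[:\<delta>, - t, 1:] dvd [:0, 1:] ^ k - [:snd (power_mod_coeffs t \<delta> k), fst (power_mod_coeffs t \<delta> k):]"
proof (induction k)
  case (Suc k)
  obtain \<alpha> \<beta> where ab: "power_mod_coeffs t \<delta> k = (\<alpha>, \<beta>)" by fastforce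
  have "[:0, 1:] ^ Suc k - [:- \<delta> * \<alpha>, t * \<alpha> + \<beta>:] = [:0, 1:] * ([:0, 1:] ^ k - [:\<beta>, \<alpha>:]) + [:\<alpha>:] * [:\<delta>, - t, 1:]"
    by (simp add: algebra_simps)
  also have "[:\<delta>, - t, 1:] dvd \<dots>"
    using Suc.IH ab by (intro dvd_add dvd_mult) auto
  finally show ?case unfolding power_mod_coeffs.simps ab Let_def prod.case fst_conv snd_conv .
qed (simp add: one_pCons)

text \<open>By hypothesis X^p is constant modulo X^2 - tX + \<delta>. For odd
  \<open>p = 2 * j + 1\<close> the polynomial 2X - t has a square congruent to the discriminant D,
  so its p-th power is congruent to D^j (2X - t). By additivity of the p-th power the same power is
  congruent to a constant, and the coefficient of X gives 2 D^j = 0. For \<open>p = 2\<close> the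
  hypothesis reads \<open>t = 0\<close>, and 4 vanishes.\<close>

lemma discriminant_eq_0:
  fixes t \<delta> :: "'a::field"
  assumes p: "prime p" "CHAR('a) = p" and "fst (power_mod_coeffs t \<delta> p) = 0"
  shows "t\<^sup>2 - 4 * \<delta> = 0"
proof (cases "p = 2")
  case True
  then have two: "(2::'a) = 0" using p(2) by (metis of_nat_CHAR of_nat_numeral)
  then have "(4::'a) = 0" by (metis mult_zero_left numeral_Bit0_eq_double)
  moreover have "t = 0" using assms(3) True by (simp add: numeral_2_eq_2 Let_def)
  ultimately show ?thesis by simp
next
  case False
  then have "odd p" using p(1) primes_dvd_imp_eq two_is_prime_nat by blast
  then obtain j where j: "p = 2 * j + 1" by (rule oddE)
  have "j \<noteq> 0"
  proof
    assume "j = 0"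
    then show False using p(1) j by simp
  qed
  let ?c = "[:\<delta>, - t, 1:]" and ?l = "[:- t, 2:]" and ?D = "t\<^sup>2 - 4 * \<delta>"
  define \<beta> where "\<beta> = snd (power_mod_coeffs t \<delta> p)"
  have 1: "?c dvd [:0, 1:] ^ p - [:\<beta>:]"
    using power_mod_coeffs_dvd[of \<delta> t p] assms(3) by (simp add: \<beta>_def)
  have "?l ^ 2 = [:?D:] + 4 * ?c"
    by (simp add: power2_eq_square algebra_simps numeral_poly)
  then have "?l ^ 2 - [:?D:] = 4 * ?c" by (simp only: add_diff_cancel_left')
  then have "?c dvd ?l ^ 2 - [:?D:]" by (simp only: dvd_triv_right)
  moreover have "?l ^ 2 - [:?D:] dvd (?l ^ 2) ^ j - [:?D:] ^ j" by (simp only: power_diff_sumr2 dvd_triv_left)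
  ultimately have "?c dvd ?l * ((?l ^ 2) ^ j - [:?D:] ^ j)" by (meson dvd_mult dvd_trans)
  moreover have "l * ((l ^ 2) ^ j - [:D:] ^ j) = l ^ p - smult (D ^ j) l" for l :: "'a poly" and D
    by (simp add: j power_mult[symmetric] poly_const_pow algebra_simps)
  ultimately have 2: "?c dvd ?l ^ p - smult (?D ^ j) ?l" by metis
  have fd: "(x + y) ^ p = x ^ p + y ^ p" for x y :: "'a poly"
    by (rule freshmans_dream) (use p in simp_all)
  have "?l = smult 2 [:0, 1:] + [:- t:]" by simp
  then have "?l ^ p = (smult 2 [:0, 1:]) ^ p + [:- t:] ^ p" by (simp only: fd)
  also have "\<dots> = smult (2 ^ p) ([:0, 1:] ^ p) + [:(- t) ^ p:]" by (simp only: smult_power poly_const_pow)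
  finally have 3: "?l ^ p = smult (2 ^ p) ([:0, 1:] ^ p) + [:(- t) ^ p:]" .
  have "?c dvd smult (2 ^ p) ([:0, 1:] ^ p - [:\<beta>:]) - (?l ^ p - smult (?D ^ j) ?l)"
    by (intro dvd_diff dvd_smult 1 2)
  also have "\<dots> = [:- (2 ^ p * \<beta>) - (- t) ^ p - ?D ^ j * t, 2 * ?D ^ j:]"
    unfolding 3 by (rule poly_eqI) (auto simp: coeff_pCons algebra_simps split: nat.splits)
  finally have "?c dvd [:- (2 ^ p * \<beta>) - (- t) ^ p - ?D ^ j * t, 2 * ?D ^ j:]" .
  moreover have "[:x, y:] = 0" if "?c dvd [:x, y:]" for x y
  proof (rule ccontr)
    assume "[:x, y:] \<noteq> 0"
    with dvd_imp_degree_le[OF that] show False by (simp split: if_splits)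
  qed
  ultimately have "[:- (2 ^ p * \<beta>) - (- t) ^ p - ?D ^ j * t, 2 * ?D ^ j:] = 0" by blast
  then have "2 * ?D ^ j = 0" by simp
  moreover have "(2::'a) \<noteq> 0"
  proof
    assume "(2::'a) = 0"
    then have "of_nat 2 = (0::'a)" by simp
    then have "p dvd 2" using p(2) of_nat_eq_0_iff_char_dvd by blast
    then show False using False p(1) primes_dvd_imp_eq two_is_prime_nat by blast
  qed
  ultimately show ?thesis by auto
qed

lemma subfield_simple_extension_facts:
  shows "is_subfield (gen_subfield (insert u K))" "K \<subseteq> gen_subfield (insert u K)" "u \<in> gen_subfield (insert u K)"
  using is_subfield_gen_subfield gen_subfield_superset[of "insert u K"] by auto

text \<open>The k-th iterate acts through the k-th power of the coefficient matrix M, which is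
  \<open>al k\<close> times M plus \<open>be k\<close> times the identity. The conclusion is the
  discriminant of the characteristic polynomial of M.\<close>

lemma frac_linear_order_p:
  fixes K :: "'a::field set"
  assumes p: "prime p" "CHAR('a) = p"
    and K: "is_subfield K" and u: "transcendental_over K u"
    and hom: "subfield_hom (gen_subfield (insert u K)) \<phi>" and fixK: "\<And>c. c \<in> K \<Longrightarrow> \<phi> c = c"
    and stable: "\<And>e. e \<in> gen_subfield (insert u K) \<Longrightarrow> \<phi> e \<in> gen_subfield (insert u K)"
    and fl: "frac_linear K u (\<phi> u) a b c d" and ord: "(\<phi> ^^ p) u = u" and ne: "\<phi> u \<noteq> u"
  shows "(a - d)\<^sup>2 + 4 * (b * c) = 0"
proof -
  let ?L = "gen_subfield (insert u K)"
  note L = subfield_simple_extension_facts[where u = u and K = K]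
  have abcd: "a \<in> K" "b \<in> K" "c \<in> K" "d \<in> K" "a * d - b * c \<noteq> 0" "c * u + d \<noteq> 0" and fu: "\<phi> u * (c * u + d) = a * u + b"
    using fl by (auto simp: frac_linear_def)
  let ?t = "a + d" and ?\<delta> = "a * d - b * c"
  define al where "al k = fst (power_mod_coeffs ?t ?\<delta> k)" for k
  define be where "be k = snd (power_mod_coeffs ?t ?\<delta> k)" for k
  have rec: "al (Suc k) = ?t * al k + be k" "be (Suc k) = - ?\<delta> * al k" for k
    by (auto simp: al_def be_def split: prod.splits)
  have K': "al k \<in> K \<and> be k \<in> K" for k
  proof (induction k)
    case (Suc k)
    then show ?case unfolding rec using abcd
      by (intro conjI subfield_add[OF K] subfield_mult[OF K] subfield_uminus[OF K] subfield_diff[OF K]) auto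
  qed (auto simp: al_def be_def subfield_closed[OF K])
  have iter: "(\<phi> ^^ k) u \<in> ?L \<and> al k * c * u + (al k * d + be k) \<noteq> 0 \<and>
    (\<phi> ^^ k) u * (al k * c * u + (al k * d + be k)) = (al k * a + be k) * u + al k * b" for k
  proof (induction k)
    case 0
    then show ?case using L by (simp add: al_def be_def)
  next
    case (Suc k)
    define w where "w = (\<phi> ^^ k) u"
    have w: "w \<in> ?L" using Suc by (simp add: w_def)
    have inK: "x \<in> K \<Longrightarrow> x \<in> ?L" for x using L by auto
    have ck: "al k * c \<in> K" "al k * d + be k \<in> K" "al k * a + be k \<in> K" "al k * b \<in> K"
      using K'[of k] abcd by (auto intro!: subfield_add[OF K] subfield_mult[OF K])
    have lin: "\<phi> (x * u + y) = x * \<phi> u + y" "x * u + y \<in> ?L" if "x \<in> K" "y \<in> K" for x y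
      using that fixK inK L by (simp_all add: subfield_hom_add[OF L(1) hom] subfield_hom_mult[OF L(1) hom] subfield_add[OF L(1)] subfield_mult[OF L(1)])
    have den: "\<phi> (al k * c * u + (al k * d + be k)) \<noteq> 0"
      using subfield_hom_nonzero[OF L(1) hom] lin(2)[OF ck(1,2)] Suc by blast
    have "\<phi> (w * (al k * c * u + (al k * d + be k))) = \<phi> ((al k * a + be k) * u + al k * b)"
      using Suc by (simp add: w_def)
    then have eq: "\<phi> w * (al k * c * \<phi> u + (al k * d + be k)) = (al k * a + be k) * \<phi> u + al k * b"
      using lin[OF ck(1,2)] lin[OF ck(3,4)] w subfield_hom_mult[OF L(1) hom] by simp
    have D: "al (Suc k) * c * u + (al (Suc k) * d + be (Suc k)) = (al k * c * \<phi> u + (al k * d + be k)) * (c * u + d)"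
    proof -
      have "(al k * c * \<phi> u + (al k * d + be k)) * (c * u + d) = al k * c * (\<phi> u * (c * u + d)) + (al k * d + be k) * (c * u + d)"
        by (simp add: algebra_simps)
      then show ?thesis unfolding fu rec by (simp add: algebra_simps)
    qed
    have N: "((al k * a + be k) * \<phi> u + al k * b) * (c * u + d) = (al (Suc k) * a + be (Suc k)) * u + al (Suc k) * b"
    proof -
      have "((al k * a + be k) * \<phi> u + al k * b) * (c * u + d) = (al k * a + be k) * (\<phi> u * (c * u + d)) + al k * b * (c * u + d)"
        by (simp add: algebra_simps)
      then show ?thesis unfolding fu rec by (simp add: algebra_simps)
    qed
    show ?case
    proof (intro conjI)
      show "(\<phi> ^^ Suc k) u \<in> ?L" using w stable by (simp add: w_def)
      show "al (Suc k) * c * u + (al (Suc k) * d + be (Suc k)) \<noteq> 0"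
        using D den lin[OF ck(1,2)] abcd(6) by simp
      show "(\<phi> ^^ Suc k) u * (al (Suc k) * c * u + (al (Suc k) * d + be (Suc k))) = (al (Suc k) * a + be (Suc k)) * u + al (Suc k) * b"
        unfolding D N[symmetric] eq[symmetric] by (simp add: w_def mult.assoc)
    qed
  qed
  have "al p = 0"
  proof (rule ccontr)
    assume nz: "al p \<noteq> 0"
    \<comment> \<open>Return to \<open>u\<close> after \<open>p\<close> steps is a quadratic
      equation for \<open>u\<close> over \<open>K\<close>; if its coefficients vanish with
      \<open>al p\<close> nonzero, M is scalar and \<phi> fixes \<open>u\<close>.\<close>
    have "poly [:- (al p * b), al p * (d - a), al p * c:] u = 0"
      using iter[of p] ord by (simp add: algebra_simps)
    moreover have "[:- (al p * b), al p * (d - a), al p * c:] \<in> polys_over K"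
      using K'[of p] abcd by (auto simp: polys_over_pCons[OF K] polys_over_0[OF K] intro!: subfield_uminus[OF K] subfield_mult[OF K] subfield_diff[OF K])
    ultimately have "[:- (al p * b), al p * (d - a), al p * c:] = 0" using transcendental_overD[OF u] by blast
    then have "b = 0" "d = a" "c = 0" using nz by auto
    then show False using fu abcd ne by simp
  qed
  then have "?t\<^sup>2 - 4 * ?\<delta> = 0" using discriminant_eq_0[OF p] by (simp add: al_def)
  then show ?thesis by (simp add: power2_eq_square algebra_simps)
qed

text \<open>\<open>q\<close> is the double fixed point and \<open>h\<close> the double eigenvalue.
  In the coordinate inverse(z - q), which sends \<open>q\<close> to infinity, the substitution is a
  translation.\<close>

lemma frac_linear_fixed_point:
  fixes z :: "'a::field"
  assumes eq: "z' * (c * z + d) = a * z + b" and "c * z + d \<noteq> 0" and q: "a - c * q = h" "c * q + d = h" "b - q * d = - (q * h)"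
    and "z' \<noteq> q" "z \<noteq> q"
  shows "inverse (z' - q) = inverse (z - q) + c / h" "h \<noteq> 0"
proof -
  have "(z' - q) * (c * z + d) = (a - c * q) * z + (b - q * d)" using eq by (simp add: algebra_simps)
  also have "\<dots> = h * (z - q)" unfolding q by (simp add: algebra_simps)
  finally have *: "(z' - q) * (c * z + d) = h * (z - q)" .
  then show h: "h \<noteq> 0" using assms by auto
  have "c * z + d = c * (z - q) + h" using q(2) by (simp add: algebra_simps)
  with * have "(z' - q) * (c * (z - q) + h) = h * (z - q)" by simp
  then show "inverse (z' - q) = inverse (z - q) + c / h" using h assms by (simp add: field_simps)
qed

text \<open>For \<open>p = 2\<close> the fixed point of \<open>\<phi>\<close> need not be rational over an imperfect \<open>K\<close>; passing from \<open>u\<close>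
  to \<open>u\<^sup>2\<close> squares all coefficients and makes it rational.\<close>

lemma translation_generator:
  fixes K :: "'a::field set" and H :: "('a \<Rightarrow> 'a) set"
  assumes p: "prime p" "CHAR('a) = p"
    and K: "is_subfield K" and u: "transcendental_over K u"
    and hom: "\<And>\<psi>. \<psi> \<in> H \<Longrightarrow> subfield_hom (gen_subfield (insert u K)) \<psi>" and fixK: "\<And>\<psi> c. \<psi> \<in> H \<Longrightarrow> c \<in> K \<Longrightarrow> \<psi> c = c"
    and stable: "\<And>\<psi> e. \<psi> \<in> H \<Longrightarrow> e \<in> gen_subfield (insert u K) \<Longrightarrow> \<psi> e \<in> gen_subfield (insert u K)"
    and \<phi>: "\<phi> \<in> H" and fl: "frac_linear K u (\<phi> u) a b c d" and ord: "(\<phi> ^^ p) u = u" and ne: "\<phi> u \<noteq> u"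
  obtains U \<beta> where "U \<in> gen_subfield (insert u K)" "transcendental_over K U"
    "\<And>\<psi>. \<psi> \<in> H \<Longrightarrow> \<psi> U \<in> gen_subfield (insert U K)" "\<beta> \<in> K" "\<beta> \<noteq> 0" "\<phi> U = U + \<beta>"
    "\<And>\<psi>. \<psi> \<in> H \<Longrightarrow> \<psi> U = U \<Longrightarrow> \<psi> u = u"
proof -
  note result = that
  let ?L = "gen_subfield (insert u K)"
  note L = subfield_simple_extension_facts[where u = u and K = K]
  have abcd: "a \<in> K" "b \<in> K" "c \<in> K" "d \<in> K" "a * d - b * c \<noteq> 0" "c * u + d \<noteq> 0" and fu: "\<phi> u * (c * u + d) = a * u + b"
    using fl by (auto simp: frac_linear_def)
  have disc: "(a - d)\<^sup>2 + 4 * (b * c) = 0"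
    by (rule frac_linear_order_p[OF p K u hom[OF \<phi>] fixK[OF \<phi>] stable[OF \<phi>] fl ord ne])
  show ?thesis
  proof (cases "c = 0")
    case True
    \<comment> \<open>For \<open>c = 0\<close> infinity is already the fixed point, and the
      vanishing discriminant turns the affine map into a translation.\<close>
    then have "a = d" "d \<noteq> 0" using disc abcd by auto
    then have "\<phi> u = u + b / d" using fu True by (simp add: field_simps)
    moreover have "b / d \<in> K" using abcd by (auto intro: subfield_divide[OF K])
    ultimately show ?thesis using ne u stable L by (intro that[of u "b / d"]) auto
  next
    case c: False
    \<comment> \<open>The change of coordinate for any \<open>z\<close> on which \<open>H\<close>
      acts faithfully enough and whose double fixed point is rational: \<open>z\<close> is
      \<open>u\<close> for odd \<open>p\<close> and \<open>u\<^sup>2\<close> for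
      \<open>p = 2\<close>.\<close>
    have key: ?thesis
      if z: "z \<in> ?L" "transcendental_over K z" and zst: "\<And>\<psi>. \<psi> \<in> H \<Longrightarrow> \<psi> z \<in> gen_subfield (insert z K)"
        and zfix: "\<And>\<psi>. \<psi> \<in> H \<Longrightarrow> \<psi> z = z \<Longrightarrow> \<psi> u = u"
        and abc': "a' \<in> K" "b' \<in> K" "c' \<in> K" "d' \<in> K" "c' \<noteq> 0" and eq: "\<phi> z * (c' * z + d') = a' * z + b'" and den: "c' * z + d' \<noteq> 0"
        and q: "q \<in> K" "a' - c' * q = c' * q + d'" "b' - q * d' = - (q * (c' * q + d'))"
      for z a' b' c' d' q
    proof -
      let ?M = "gen_subfield (insert z K)"
      note M = subfield_simple_extension_facts[where u = z and K = K]
      have qL: "q \<in> ?L" using q L by auto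
      have im: "\<psi> (inverse (z - q)) = inverse (\<psi> z - q)" if "\<psi> \<in> H" for \<psi>
        using z(1) qL subfield_diff[OF L(1)] fixK[OF that q(1)]
        by (simp add: subfield_hom_inverse[OF L(1) hom[OF that]] subfield_hom_diff[OF L(1) hom[OF that]])
      have zq: "z \<noteq> q" using transcendental_over_notin[OF K z(2)] q(1) by auto
      have zq': "\<psi> z \<noteq> q" if "\<psi> \<in> H" for \<psi>
        using inj_onD[OF subfield_hom_inj[OF L(1) hom[OF that]], of z q] fixK[OF that q(1)] z(1) qL zq by auto
      define U where "U = inverse (z - q)"
      define h where "h = c' * q + d'"
      note M' = subfield_simple_extension_facts[where u = U and K = K]
      have "z = inverse U + q" by (simp add: U_def)
      then have "z \<in> gen_subfield (insert U K)"
        using M' q(1) by (auto intro!: subfield_add[OF M'(1)] subfield_inverse[OF M'(1)])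
      then have MU: "?M \<subseteq> gen_subfield (insert U K)" using M' by (intro gen_subfield_least) auto
      have hK: "h \<in> K" unfolding h_def using abc' q by (auto intro!: subfield_add[OF K] subfield_mult[OF K])
      have tr: "inverse (\<phi> z - q) = inverse (z - q) + c' / h" "h \<noteq> 0"
        by (rule frac_linear_fixed_point[OF eq den]; use q zq zq'[OF \<phi>] in \<open>simp add: h_def\<close>)+
      show ?thesis
      proof (rule result[of U "c' / h"])
        show "U \<in> ?L" unfolding U_def using z(1) qL by (intro subfield_inverse[OF L(1)] subfield_diff[OF L(1)])
        have "U \<notin> K"
        proof
          assume "U \<in> K"
          then have "z \<in> K" using \<open>z = inverse U + q\<close> q(1) subfield_add[OF K] subfield_inverse[OF K] by metis
          then show False using transcendental_over_notin[OF K z(2)] by simp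
        qed
        then show "transcendental_over K U"
          using algebraic_in_simple_extension[OF K u \<open>U \<in> ?L\<close>] by blast
        show "c' / h \<in> K" "c' / h \<noteq> 0" using abc' hK tr(2) by (auto intro: subfield_divide[OF K])
        show "\<phi> U = U + c' / h" using tr(1) im[OF \<phi>] by (simp add: U_def)
        fix \<psi> assume \<psi>: "\<psi> \<in> H"
        have "inverse (\<psi> z - q) \<in> ?M" using zst[OF \<psi>] q(1) M by (intro subfield_inverse[OF M(1)] subfield_diff[OF M(1)]) auto
        then show "\<psi> U \<in> gen_subfield (insert U K)" using MU im[OF \<psi>] by (auto simp: U_def)
        assume "\<psi> U = U"
        then have "\<psi> z = z" using im[OF \<psi>] by (simp add: U_def)
        then show "\<psi> u = u" by (rule zfix[OF \<psi>])
      qed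
    qed
    show ?thesis
    proof (cases "p = 2")
      case False
      have two: "(2::'a) \<noteq> 0"
      proof
        assume "(2::'a) = 0"
        then have "of_nat 2 = (0::'a)" by simp
        then have "p dvd 2" using p(2) of_nat_eq_0_iff_char_dvd by blast
        then show False using False p(1) primes_dvd_imp_eq two_is_prime_nat by blast
      qed
      then have four: "(4::'a) \<noteq> 0" by (metis mult_eq_0_iff numeral_Bit0_eq_double)
      \<comment> \<open>The double root of the fixed point equation c q^2 + (d - a) q - b =
        0.\<close>
      define q where "q = (a - d) / (2 * c)"
      have q2: "2 * (c * q) = a - d" using two c by (simp add: q_def)
      have "4 * c * (b + c * q\<^sup>2) = (2 * (c * q))\<^sup>2 + 4 * (b * c)" by (simp add: power2_eq_square algebra_simps)
      then have bq: "b = - (c * q\<^sup>2)" using disc four c unfolding q2 by (simp add: eq_neg_iff_add_eq_0)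
      show ?thesis
      proof (rule key[of u a b c d q])
        show "q \<in> K" unfolding q_def using abcd by (intro subfield_divide[OF K] subfield_diff[OF K] subfield_mult[OF K] subfield_numeral[OF K])
        show "a - c * q = c * q + d" using q2 by (simp add: algebra_simps)
        show "b - q * d = - (q * (c * q + d))" by (simp add: bq power2_eq_square algebra_simps)
      qed (use abcd c fu L u stable in auto)
    next
      case True
      then have two: "(2::'a) = 0" using p(2) by (metis of_nat_CHAR of_nat_numeral)
      have four: "(4::'a) = 0" by (metis two mult_zero_left numeral_Bit0_eq_double)
      have neg: "- x = x" for x :: 'a using two by (metis add_eq_0_iff mult_2 mult_zero_left)
      have "a = d" using disc four by simp
      have sq_add: "(x + y)\<^sup>2 = x\<^sup>2 + y\<^sup>2" for x y :: 'a using two by (simp add: power2_sum)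
      have sq_poly: "(poly f x)\<^sup>2 = poly (map_poly (\<lambda>c. c\<^sup>2) f) (x\<^sup>2)" for f :: "'a poly" and x
        by (induction f) (auto simp: map_poly_pCons sq_add power_mult_distrib)
      have sqK: "map_poly (\<lambda>c. c\<^sup>2) f \<in> polys_over K" if "f \<in> polys_over K" for f
        using that by (auto simp: polys_over_def coeff_map_poly intro: subfield_power[OF K])
      have "u\<^sup>2 \<notin> K"
      proof
        assume "u\<^sup>2 \<in> K"
        then have "[:- (u\<^sup>2), 0, 1:] \<in> polys_over K" by (auto simp: polys_over_pCons[OF K] polys_over_0[OF K] subfield_closed[OF K])
        then show False using transcendental_overD[OF u] by (fastforce simp: power2_eq_square)
      qed
      moreover have u2: "u\<^sup>2 \<in> ?L" using L by (auto intro: subfield_power[OF L(1)])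
      ultimately have tr: "transcendental_over K (u\<^sup>2)" using algebraic_in_simple_extension[OF K u] by blast
      have hom2: "\<psi> (u\<^sup>2) = (\<psi> u)\<^sup>2" if "\<psi> \<in> H" for \<psi>
        by (rule subfield_hom_power[OF L(1) hom[OF that] L(3)])
      show ?thesis
      \<comment> \<open>In characteristic 2 the discriminant gives \<open>a = d\<close>, and a fixed
        point has square b/c. So \<open>b / c\<close> is the rational fixed point of the
        substitution with squared coefficients by which \<phi> acts on
        \<open>u\<^sup>2\<close>.\<close>
      proof (rule key[of "u\<^sup>2" "a\<^sup>2" "b\<^sup>2" "c\<^sup>2" "d\<^sup>2" "b / c"], fact u2, fact tr)
        fix \<psi> assume \<psi>: "\<psi> \<in> H"
        obtain f g where fg: "f \<in> polys_over K" "g \<in> polys_over K" "poly g u \<noteq> 0" "\<psi> u = poly f u / poly g u"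
          using stable[OF \<psi> L(3)] simple_extension_iff[OF K] by blast
        have "\<psi> (u\<^sup>2) = poly (map_poly (\<lambda>c. c\<^sup>2) f) (u\<^sup>2) / poly (map_poly (\<lambda>c. c\<^sup>2) g) (u\<^sup>2)"
          unfolding hom2[OF \<psi>] fg(4) by (simp add: power_divide sq_poly)
        moreover have "poly (map_poly (\<lambda>c. c\<^sup>2) g) (u\<^sup>2) \<noteq> 0" using fg(3) by (simp flip: sq_poly)
        ultimately show "\<psi> (u\<^sup>2) \<in> gen_subfield (insert (u\<^sup>2) K)"
          using sqK fg simple_extension_iff[OF K] by blast
        assume "\<psi> (u\<^sup>2) = u\<^sup>2"
        then have "(\<psi> u + u)\<^sup>2 = 0" unfolding hom2[OF \<psi>] sq_add using two by (metis mult_2 mult_zero_left)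
        then show "\<psi> u = u" using neg by (metis add_eq_0_iff power_eq_0_iff)
      next
        show "b / c \<in> K" "a\<^sup>2 \<in> K" "b\<^sup>2 \<in> K" "c\<^sup>2 \<in> K" "d\<^sup>2 \<in> K" "c\<^sup>2 \<noteq> 0"
          using abcd c by (auto intro: subfield_divide[OF K] subfield_power[OF K])
        have "(\<phi> u * (c * u + d))\<^sup>2 = (a * u + b)\<^sup>2" by (simp only: fu)
        then show "\<phi> (u\<^sup>2) * (c\<^sup>2 * u\<^sup>2 + d\<^sup>2) = a\<^sup>2 * u\<^sup>2 + b\<^sup>2"
          unfolding hom2[OF \<phi>] by (simp only: power_mult_distrib sq_add)
        have "(c * u + d)\<^sup>2 \<noteq> 0" using abcd by simp
        then show "c\<^sup>2 * u\<^sup>2 + d\<^sup>2 \<noteq> 0" by (simp only: sq_add power_mult_distrib not_False_eq_True)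
        show "a\<^sup>2 - c\<^sup>2 * (b / c) = c\<^sup>2 * (b / c) + d\<^sup>2"
          using neg[of "c\<^sup>2 * (b / c)"] by (simp add: \<open>a = d\<close> diff_conv_add_uminus add.commute del: add_uminus_conv_diff)
        have "b\<^sup>2 = - (b\<^sup>2)" by (simp only: neg)
        then show "b\<^sup>2 - b / c * d\<^sup>2 = - (b / c * (c\<^sup>2 * (b / c) + d\<^sup>2))"
          using c by (simp add: field_simps power2_eq_square)
      qed
    qed
  qed
qed

text \<open>Infinity is the only fixed point of a nontrivial translation; a substitution carrying
  one translation to another therefore fixes infinity. In coordinates, applying \<phi> and comparing
  the coefficients of U^2 gives \<gamma> c^2 = 0.\<close>

lemma affine_of_translation:
  assumes K: "is_subfield K" and U: "transcendental_over K U"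
    and hom: "subfield_hom (gen_subfield (insert U K)) \<phi>" and fixK: "\<And>c. c \<in> K \<Longrightarrow> \<phi> c = c"
    and \<phi>U: "\<phi> U = U + \<beta>" "\<beta> \<in> K" and fl: "frac_linear K U w a b c d" and w: "w \<in> gen_subfield (insert U K)"
    and \<phi>w: "\<phi> w = w + \<gamma>" "\<gamma> \<in> K" "\<gamma> \<noteq> 0"
  shows "\<exists>\<alpha>\<in>K. \<exists>\<delta>\<in>K. \<alpha> \<noteq> 0 \<and> w = \<alpha> * U + \<delta>"
proof -
  let ?L = "gen_subfield (insert U K)"
  note L = subfield_simple_extension_facts[where u = U and K = K]
  have abcd: "a \<in> K" "b \<in> K" "c \<in> K" "d \<in> K" "a * d - b * c \<noteq> 0" "c * U + d \<noteq> 0" and fu: "w * (c * U + d) = a * U + b"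
    using fl by (auto simp: frac_linear_def)
  have lin: "\<phi> (x * U + y) = x * (U + \<beta>) + y" "x * U + y \<in> ?L" if "x \<in> K" "y \<in> K" for x y
  proof -
    have "x \<in> ?L" "y \<in> ?L" using that L by auto
    then show "\<phi> (x * U + y) = x * (U + \<beta>) + y" "x * U + y \<in> ?L"
      using that fixK L \<phi>U by (simp_all add: subfield_hom_add[OF L(1) hom] subfield_hom_mult[OF L(1) hom] subfield_add[OF L(1)] subfield_mult[OF L(1)])
  qed
  have "\<phi> (w * (c * U + d)) = \<phi> (a * U + b)" by (simp only: fu)
  then have X: "(w + \<gamma>) * (c * (U + \<beta>) + d) = a * (U + \<beta>) + b"
    using lin[OF abcd(3,4)] lin[OF abcd(1,2)] w \<phi>w(1) subfield_hom_mult[OF L(1) hom] by simp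
  have "(w * (c * U + d) + \<gamma> * (c * U + d)) * (c * (U + \<beta>) + d) = ((w + \<gamma>) * (c * (U + \<beta>) + d)) * (c * U + d)"
    by (simp add: algebra_simps)
  also have "\<dots> = (a * (U + \<beta>) + b) * (c * U + d)" by (simp only: X)
  finally have "(w * (c * U + d) + \<gamma> * (c * U + d)) * (c * (U + \<beta>) + d) = (a * (U + \<beta>) + b) * (c * U + d)" .
  then have "(a * U + b + \<gamma> * (c * U + d)) * (c * (U + \<beta>) + d) = (a * (U + \<beta>) + b) * (c * U + d)"
    by (simp only: fu)
  then have "poly ([:b + \<gamma> * d, a + \<gamma> * c:] * [:c * \<beta> + d, c:]) U = poly ([:a * \<beta> + b, a:] * [:d, c:]) U"
    by (simp add: algebra_simps)
  then have "[:b + \<gamma> * d, a + \<gamma> * c:] * [:c * \<beta> + d, c:] = [:a * \<beta> + b, a:] * [:d, c:]"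
    by (rule transcendental_over_eq[OF K U, rotated 2])
      (use abcd \<phi>w \<phi>U in \<open>auto simp del: mult_pCons_left mult_pCons_right intro!: polys_over_mult[OF K] subfield_add[OF K] subfield_mult[OF K] simp: polys_over_pCons[OF K] polys_over_0[OF K]\<close>)
  then have "(a + \<gamma> * c) * c = a * c" by simp
  then have "c = 0" using \<phi>w(3) by (simp add: algebra_simps)
  then have "d \<noteq> 0" "a \<noteq> 0" "w = (a / d) * U + b / d" using abcd fu by (auto simp: field_simps)
  then show ?thesis using abcd by (intro bexI[of _ "a / d"] bexI[of _ "b / d"]) (auto intro: subfield_divide[OF K])
qed

section \<open>Independence over the prime field\<close>

lemma of_nat_mod_char:
  assumes "CHAR('a::field) = p"
  shows "(of_nat (a mod p) :: 'a) = of_nat a"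
proof -
  have "(of_nat a :: 'a) = of_nat (p * (a div p) + a mod p)" by simp
  also have "\<dots> = of_nat p * of_nat (a div p) + of_nat (a mod p)" by (simp only: of_nat_add of_nat_mult)
  also have "(of_nat p :: 'a) = 0" using assms by (metis of_nat_CHAR)
  finally show ?thesis by simp
qed

text \<open>Reduced modulo \<open>p\<close> the coefficients are unique, so the span is parametrized
  by the functions from \<open>B\<close> to \<open>{..<p}\<close>. In the proof of uniqueness
  \<open>p - c' b\<close> stands for the negative of \<open>c' b\<close>, since the coefficients are
  natural numbers.\<close>

lemma fp_span_card:
  fixes B :: "'a::field set"
  assumes p: "prime p" "CHAR('a) = p" and B: "finite B" "fp_indep B"
  shows "finite {\<Sum>b\<in>B. of_nat (c b) * b | c :: 'a \<Rightarrow> nat. True}" (is "finite ?S")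
    and "card {\<Sum>b\<in>B. of_nat (c b) * b | c :: 'a \<Rightarrow> nat. True} = p ^ card B"
proof -
  define f where "f c = (\<Sum>b\<in>B. of_nat (c b) * b)" for c :: "'a \<Rightarrow> nat"
  have p0: "p > 0" using p(1) prime_gt_0_nat by blast
  have inj: "inj_on f (B \<rightarrow>\<^sub>E {..<p})"
  proof (rule inj_onI)
    fix c c' assume c: "c \<in> B \<rightarrow>\<^sub>E {..<p}" "c' \<in> B \<rightarrow>\<^sub>E {..<p}" and eq: "f c = f c'"
    have lt: "c b < p" "c' b < p" if "b \<in> B" for b using c that by (auto simp: PiE_def Pi_def)
    have "(\<Sum>b\<in>B. of_nat (c b + (p - c' b)) * b) = (\<Sum>b\<in>B. of_nat (c b) * b - of_nat (c' b) * b)"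
    proof (rule sum.cong[OF refl])
      fix b assume "b \<in> B"
      have "of_nat p = (0::'a)" using p(2) by (metis of_nat_CHAR)
      then show "of_nat (c b + (p - c' b)) * b = of_nat (c b) * b - of_nat (c' b) * b"
        using lt(2)[OF \<open>b \<in> B\<close>] by (simp add: of_nat_diff algebra_simps)
    qed
    also have "\<dots> = 0" using eq by (simp add: f_def sum_subtractf)
    finally have "(\<Sum>b\<in>B. of_nat (c b + (p - c' b)) * b) = 0" .
    then have z: "of_nat (c b + (p - c' b)) = (0::'a)" if "b \<in> B" for b
      using B(2)[unfolded fp_indep_def, THEN spec[of _ "\<lambda>b. c b + (p - c' b)"]] that by blast
    have "c b = c' b" if "b \<in> B" for b
    proof -
      have "p dvd c b + (p - c' b)" using z[OF that] p(2) of_nat_eq_0_iff_char_dvd by blast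
      then obtain k where k: "c b + (p - c' b) = p * k" by (auto elim: dvdE)
      have "0 < p * k" "p * k < p * 2" unfolding k[symmetric] using lt[OF that] by auto
      then have "k = 1" using p0 by (simp only: nat_0_less_mult_iff mult_less_cancel1) auto
      then show ?thesis using k lt[OF that] by simp
    qed
    then show "c = c'" using c by (intro PiE_ext[of c B "\<lambda>_. {..<p}" c']) auto
  qed
  have im: "?S = f ` (B \<rightarrow>\<^sub>E {..<p})"
  proof
    show "f ` (B \<rightarrow>\<^sub>E {..<p}) \<subseteq> ?S" by (auto simp: f_def)
    show "?S \<subseteq> f ` (B \<rightarrow>\<^sub>E {..<p})"
    proof
      fix v assume "v \<in> ?S"
      then obtain c where v: "v = f c" by (auto simp: f_def)
      have "f c = f (\<lambda>b\<in>B. c b mod p)"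
        unfolding f_def by (rule sum.cong[OF refl]) (simp add: of_nat_mod_char[OF p(2)])
      then show "v \<in> f ` (B \<rightarrow>\<^sub>E {..<p})" using v p0 by (intro image_eqI[of _ _ "\<lambda>b\<in>B. c b mod p"]) auto
    qed
  qed
  show "finite ?S" unfolding im using B(1) by (intro finite_imageI finite_PiE) auto
  show "card ?S = p ^ card B" unfolding im using B(1) by (simp add: card_image[OF inj] card_PiE)
qed

lemma fp_dim_card:
  assumes "prime p" "CHAR('a::field) = p" "fp_dim (S :: 'a set) d"
  shows "finite S" "card S = p ^ d"
proof -
  obtain B where B: "finite B" "fp_indep B" "card B = d" and S: "S = {\<Sum>b\<in>B. of_nat (c b) * b | c :: 'a \<Rightarrow> nat. True}"
    using assms(3) unfolding fp_dim_def by blast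
  show "finite S" "card S = p ^ d"
    unfolding S B(3)[symmetric] by (rule fp_span_card[OF assms(1,2) B(1,2)])+
qed

lemma primitive_root_dvd:
  assumes "primitive_root z n" "n > 0" "z ^ m = 1" shows "n dvd m"
proof (rule ccontr)
  assume "\<not> n dvd m"
  then have "0 < m mod n" "m mod n < n" using assms(2) by (auto simp: mod_greater_zero_iff_not_dvd)
  moreover have "z ^ (m mod n) = 1"
  proof -
    have "z ^ m = (z ^ n) ^ (m div n) * z ^ (m mod n)" by (simp flip: power_mult power_add)
    then show ?thesis using assms by (simp add: primitive_root_def)
  qed
  ultimately show False using assms(1) by (auto simp: primitive_root_def)
qed

section \<open>The group and its action\<close>

lemma mmul_assoc: "mmul (mmul a b) c = mmul a (mmul b c)"
  by (cases a rule: minv.cases; cases b rule: minv.cases; cases c rule: minv.cases) (simp add: algebra_simps)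

lemma mmul_mone: "mmul mone a = a" "mmul a mone = a"
  by (cases a rule: minv.cases; simp add: mone_def)+

lemma subfield_hom_eq_on_gen:
  assumes hom: "subfield_hom (gen_subfield X) \<phi>" "subfield_hom (gen_subfield X) \<psi>"
    and eq: "\<And>a. a \<in> X \<Longrightarrow> \<phi> a = \<psi> a" and e: "e \<in> gen_subfield X"
  shows "\<phi> e = \<psi> e"
proof -
  let ?E = "gen_subfield X"
  have E: "is_subfield ?E" by (rule is_subfield_gen_subfield)
  have "is_subfield {e \<in> ?E. \<phi> e = \<psi> e}"
    unfolding is_subfield_def
    by (auto simp: subfield_closed[OF E] subfield_hom_0[OF E hom(1)] subfield_hom_0[OF E hom(2)]
        subfield_hom_1[OF E hom(1)] subfield_hom_1[OF E hom(2)] subfield_hom_add[OF E hom(1)] subfield_hom_add[OF E hom(2)]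
        subfield_hom_mult[OF E hom(1)] subfield_hom_mult[OF E hom(2)] subfield_hom_uminus[OF E hom(1)] subfield_hom_uminus[OF E hom(2)]
        subfield_hom_inverse[OF E hom(1)] subfield_hom_inverse[OF E hom(2)])
  moreover have "X \<subseteq> {e \<in> ?E. \<phi> e = \<psi> e}" using eq gen_subfield_superset by blast
  ultimately show ?thesis using gen_subfield_least e by blast
qed

lemma subfield_hom_comp:
  "subfield_hom E \<phi> \<Longrightarrow> subfield_hom E \<psi> \<Longrightarrow> (\<And>e. e \<in> E \<Longrightarrow> \<psi> e \<in> E) \<Longrightarrow> subfield_hom E (\<lambda>e. \<phi> (\<psi> e))"
  unfolding subfield_hom_def by auto

text \<open>\<open>K\<close> lies in the type \<open>'f\<close>, while \<zeta> and \<open>V\<close>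
  lie in \<open>'l\<close>; the two ambient fields are related only through their common
  characteristic.\<close>

locale gnp_rep =
  fixes p n r s :: nat and K :: "'f::field set" and \<zeta> :: "'l::field" and V :: "'l set"
    and x :: "'l mat2 \<Rightarrow> 'f" and \<sigma> :: "'l mat2 \<Rightarrow> 'f \<Rightarrow> 'f"
  assumes prime: "prime p" and charf: "CHAR('f) = p" and K: "is_subfield K" and charl: "CHAR('l) = p"
    and pn: "\<not> p dvd n" and root: "primitive_root \<zeta> n" and dimF: "fp_dim (gen_subfield {\<zeta> ^ 2}) s"
    and r: "r \<ge> 1" and V: "subspace_over (gen_subfield {\<zeta> ^ 2}) V" and dimV: "fp_dim V r"
    and regular: "regular_setup K (Gnp \<zeta> V) mmul x \<sigma>"
begin

abbreviation G :: "'l mat2 set" where "G \<equiv> Gnp \<zeta> V"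
abbreviation KX :: "'f set" where "KX \<equiv> gen_subfield (K \<union> x ` G)"

lemma n_pos: "n > 0" using pn by (cases n) auto

lemma zeta_nz: "\<zeta> \<noteq> 0"
  using root n_pos by (auto simp: primitive_root_def zero_power)

lemma zeta_n: "\<zeta> ^ n = 1" using root by (simp add: primitive_root_def)

lemma V_0: "0 \<in> V" and V_add: "v \<in> V \<Longrightarrow> w \<in> V \<Longrightarrow> v + w \<in> V"
  and V_mult: "c \<in> gen_subfield {\<zeta> ^ 2} \<Longrightarrow> v \<in> V \<Longrightarrow> c * v \<in> V"
  using V by (auto simp: subspace_over_def)

lemma zeta2_in: "\<zeta> ^ (2 * k) \<in> gen_subfield {\<zeta> ^ 2}"
  using subfield_power[OF is_subfield_gen_subfield, of "\<zeta> ^ 2" "{\<zeta> ^ 2}" k] gen_subfield_superset[of "{\<zeta> ^ 2}"]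
  by (simp add: power_mult)

lemma V_zeta: "v \<in> V \<Longrightarrow> \<zeta> ^ (2 * k) * v \<in> V" and V_zeta_inv: "v \<in> V \<Longrightarrow> inverse (\<zeta> ^ (2 * k)) * v \<in> V"
  by (intro V_mult zeta2_in subfield_inverse[OF is_subfield_gen_subfield]; assumption)+

lemma V_uminus: "v \<in> V \<Longrightarrow> - v \<in> V"
  using V_mult[OF subfield_uminus[OF is_subfield_gen_subfield subfield_1[OF is_subfield_gen_subfield]]] by simp

lemma V_of_nat: "v \<in> V \<Longrightarrow> of_nat k * v \<in> V"
  by (intro V_mult subfield_of_nat is_subfield_gen_subfield)

text \<open>The normal form of the group elements: the k-th power of the diagonal generator times
  the unipotent matrix of \<open>v\<close>.\<close>

definition el :: "nat \<Rightarrow> 'l \<Rightarrow> 'l mat2" where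
  "el k v = ((\<zeta> ^ k, \<zeta> ^ k * v), (0, inverse (\<zeta> ^ k)))"

lemma el_mult: "mmul (el k v) (el j w) = el (k + j) (w + inverse (\<zeta> ^ (2 * j)) * v)"
proof -
  have "\<zeta> ^ (2 * j) = \<zeta> ^ j * \<zeta> ^ j" by (simp add: mult_2 power_add)
  then show ?thesis unfolding el_def using zeta_nz by (simp add: power_add field_simps)
qed

lemma el_0: "el 0 0 = mone" by (simp add: el_def mone_def)

lemma el_n: "el n v = el 0 v" by (simp add: el_def zeta_n)

lemma G_eq: "G = {el k v | k v. v \<in> V}"
proof
  show "G \<subseteq> {el k v | k v. v \<in> V}"
  proof
    fix g assume "g \<in> G"
    then show "g \<in> {el k v | k v. v \<in> V}"
      unfolding Gnp_def
    proof (induction g rule: sl2_gen.induct)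
      case one
      then show ?case using el_0[symmetric] V_0 by blast
    next
      case (gen g)
      then consider v where "v \<in> V" "g = el 0 v" | "g = el 1 0" by (auto simp: el_def)
      then show ?case using V_0 by cases blast+
    next
      case (mult g h)
      then obtain k v j w where "v \<in> V" "w \<in> V" "g = el k v" "h = el j w" by blast
      then show ?case using V_add V_zeta_inv el_mult by blast
    next
      case (inv g)
      then obtain k v where v: "v \<in> V" "g = el k v" by blast
      \<comment> \<open>Exponents are natural numbers, so \<open>k * (n - 1)\<close> takes the place
        of the exponent -k.\<close>
      have "k + k * (n - 1) = n * k" using n_pos by (cases n) auto
      then have "\<zeta> ^ k * \<zeta> ^ (k * (n - 1)) = \<zeta> ^ (n * k)" by (simp only: power_add[symmetric])
      also have "\<dots> = 1" by (simp add: power_mult zeta_n)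
      finally have "\<zeta> ^ k * \<zeta> ^ (k * (n - 1)) = 1" .
      then have inv: "\<zeta> ^ (k * (n - 1)) = inverse (\<zeta> ^ k)" using zeta_nz by (simp add: inverse_unique)
      have "minv g = el (k * (n - 1)) (\<zeta> ^ (2 * k) * (- v))"
        unfolding v(2) el_def inv using zeta_nz by (simp add: mult_2 power_add)
      then show ?case using V_zeta[OF V_uminus[OF v(1)]] by blast
    qed
  qed
  have U: "el 0 v \<in> G" if "v \<in> V" for v unfolding Gnp_def el_def using that by (intro sl2_gen.gen) auto
  have T: "el k 0 \<in> G" for k
  proof (induction k)
    case 0
    show ?case using U[OF V_0] .
  next
    case (Suc k)
    have "el 1 0 \<in> G" unfolding Gnp_def el_def by (intro sl2_gen.gen) auto
    with Suc have "mmul (el k 0) (el 1 0) \<in> G" unfolding Gnp_def by (intro sl2_gen.mult)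
    then show ?case by (simp add: el_mult)
  qed
  show "{el k v | k v. v \<in> V} \<subseteq> G"
  proof
    fix g assume "g \<in> {el k v | k v. v \<in> V}"
    then obtain k v where "v \<in> V" "g = el k v" by blast
    moreover have "mmul (el k 0) (el 0 v) \<in> G" using U[OF \<open>v \<in> V\<close>] T[of k] unfolding Gnp_def by (rule sl2_gen.mult[rotated])
    ultimately show "g \<in> G" by (simp add: el_mult)
  qed
qed

lemma el_in_G: "v \<in> V \<Longrightarrow> el k v \<in> G" by (auto simp: G_eq)

lemma el_mod: "el (k mod n) v = el k v"
proof -
  have "\<zeta> ^ k = (\<zeta> ^ n) ^ (k div n) * \<zeta> ^ (k mod n)" by (simp flip: power_mult power_add)
  then show ?thesis by (simp add: el_def zeta_n)
qed

lemma el_inj: "el k v = el j w \<longleftrightarrow> \<zeta> ^ k = \<zeta> ^ j \<and> v = w"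
  using zeta_nz by (auto simp: el_def)

lemma finite_V: "finite V" and card_V: "card V = p ^ r"
  using fp_dim_card[OF prime charl dimV] by auto

lemma finite_G: "finite G"
proof -
  have "G \<subseteq> (\<lambda>(k, v). el k v) ` ({..<n} \<times> V)"
  proof
    fix g assume "g \<in> G"
    then obtain k v where "v \<in> V" "g = el k v" by (auto simp: G_eq)
    then have "(k mod n, v) \<in> {..<n} \<times> V" "g = el (k mod n) v" using n_pos by (auto simp: el_mod)
    then show "g \<in> (\<lambda>(k, v). el k v) ` ({..<n} \<times> V)" by force
  qed
  then show ?thesis using finite_V by (meson finite_SigmaI finite_imageI finite_lessThan finite_subset)
qed

lemma G_mult: "g \<in> G \<Longrightarrow> h \<in> G \<Longrightarrow> mmul g h \<in> G"
  and G_one: "mone \<in> G"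
  unfolding Gnp_def by (auto intro: sl2_gen.intros)

lemma G_inverse: assumes "g \<in> G" obtains h where "h \<in> G" "mmul g h = mone" "mmul h g = mone"
proof -
  have "minv g \<in> G" using assms unfolding Gnp_def by (rule sl2_gen.inv)
  moreover obtain k v where "g = el k v" using assms by (auto simp: G_eq)
  then have "mmul g (minv g) = mone" "mmul (minv g) g = mone"
    using zeta_nz by (simp_all add: el_def mone_def)
  ultimately show ?thesis using that by blast
qed

lemma KX: "is_subfield KX" "K \<subseteq> KX" "\<And>g. g \<in> G \<Longrightarrow> x g \<in> KX"
  using is_subfield_gen_subfield gen_subfield_superset[of "K \<union> x ` G"] by auto

lemma inj_x: "inj_on x G" and indep_x: "alg_indep K (x ` G)"
  using regular by (auto simp: regular_setup_def)

context fixes g assumes g: "g \<in> G" begin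

lemma sigma_hom: "subfield_hom KX (\<sigma> g)" and sigma_in: "a \<in> KX \<Longrightarrow> \<sigma> g a \<in> KX"
  and sigma_K: "c \<in> K \<Longrightarrow> \<sigma> g c = c" and sigma_x: "h \<in> G \<Longrightarrow> \<sigma> g (x h) = x (mmul g h)"
  using regular g subfield_1[OF K] by (auto simp: regular_setup_def subfield_hom_def)

end

lemma sigma_mult:
  assumes "g \<in> G" "h \<in> G" "a \<in> KX" shows "\<sigma> (mmul g h) a = \<sigma> g (\<sigma> h a)"
proof (rule subfield_hom_eq_on_gen[OF _ _ _ assms(3)])
  show "subfield_hom KX (\<sigma> (mmul g h))" using assms by (intro sigma_hom G_mult)
  show "subfield_hom KX (\<lambda>a. \<sigma> g (\<sigma> h a))" by (rule subfield_hom_comp[OF sigma_hom[OF assms(1)] sigma_hom[OF assms(2)] sigma_in[OF assms(2)]])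
  fix a assume "a \<in> K \<union> x ` G"
  then show "\<sigma> (mmul g h) a = \<sigma> g (\<sigma> h a)"
    using assms by (auto simp: sigma_K sigma_x G_mult mmul_assoc)
qed

lemma sigma_one: assumes "a \<in> KX" shows "\<sigma> mone a = a"
  by (rule subfield_hom_eq_on_gen[OF sigma_hom[OF G_one] _ _ assms])
    (auto simp: subfield_hom_def sigma_K sigma_x G_one mmul_mone)

lemma sigma_iterate: "a \<in> KX \<Longrightarrow> v \<in> V \<Longrightarrow> (\<sigma> (el 0 v) ^^ k) a = \<sigma> (el 0 (of_nat k * v)) a"
proof (induction k)
  case 0
  then show ?case by (simp add: el_0 sigma_one)
next
  case (Suc k)
  then show ?case
    using sigma_mult[OF el_in_G[OF Suc.prems(2), of 0] el_in_G[OF V_of_nat[OF Suc.prems(2)], of 0 k] Suc.prems(1)]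
    by (simp add: el_mult algebra_simps)
qed

lemma sigma_p: "a \<in> KX \<Longrightarrow> v \<in> V \<Longrightarrow> (\<sigma> (el 0 v) ^^ p) a = a"
  using sigma_iterate[of a v p] of_nat_CHAR[where 'a = 'l] by (simp add: charl el_0 sigma_one)

lemma sigma_iterate_T: "a \<in> KX \<Longrightarrow> (\<sigma> (el 1 0) ^^ k) a = \<sigma> (el k 0) a"
proof (induction k)
  case 0
  then show ?case by (simp add: el_0 sigma_one)
next
  case (Suc k)
  then show ?case
    using sigma_mult[OF el_in_G[OF V_0, of 1] el_in_G[OF V_0, of k] Suc.prems]
    by (simp add: el_mult)
qed

lemma sigma_commute:
  assumes "a \<in> KX" "v \<in> V"
  shows "\<sigma> (el 0 v) (\<sigma> (el 1 0) a) = \<sigma> (el 1 0) (\<sigma> (el 0 (inverse (\<zeta> ^ 2) * v)) a)"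
proof -
  have V': "inverse (\<zeta> ^ 2) * v \<in> V" using V_zeta_inv[OF assms(2), of 1] by simp
  show ?thesis
    using sigma_mult[OF el_in_G[OF assms(2), of 0] el_in_G[OF V_0, of 1] assms(1)]
      sigma_mult[OF el_in_G[OF V_0, of 1] el_in_G[OF V', of 0] assms(1)]
    by (simp add: el_mult)
qed

lemma sigma_commute_V:
  assumes "a \<in> KX" "v \<in> V" "w \<in> V"
  shows "\<sigma> (el 0 v) (\<sigma> (el 0 w) a) = \<sigma> (el 0 (v + w)) a"
  using sigma_mult[OF el_in_G[OF assms(2), of 0] el_in_G[OF assms(3), of 0] assms(1)]
  by (simp add: el_mult add.commute)

lemma nonzero_V: obtains v where "v \<in> V" "v \<noteq> 0"
proof -
  have "card V > 1" unfolding card_V by (rule one_less_power) (use r prime_gt_1_nat[OF prime] in auto)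
  then have "V \<noteq> {0}" "V \<noteq> {}" by auto
  then show ?thesis using that by blast
qed

text \<open>The inverse of \<open>g\<close> in the group expresses \<open>U\<close> rationally in
  \<open>\<sigma> g U\<close>, so both generate the same field over \<open>K\<close>.\<close>

lemma frac_linear_sigma:
  assumes U: "U \<in> KX" "transcendental_over K U" and st: "\<And>g. g \<in> G \<Longrightarrow> \<sigma> g U \<in> gen_subfield (insert U K)" and g: "g \<in> G"
  shows "\<exists>a b c d. frac_linear K U (\<sigma> g U) a b c d"
proof (rule frac_linear_exists[OF K U(2) st[OF g]])
  obtain h where h: "h \<in> G" "mmul g h = mone" using G_inverse[OF g] by blast
  have "\<sigma> g (\<sigma> h U) \<in> gen_subfield (insert (\<sigma> g U) K)"
    using subfield_hom_simple_extension[OF KX(1) sigma_hom[OF g] K KX(2) sigma_K[OF g] U(1) st[OF h(1)]] .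
  then show "U \<in> gen_subfield (insert (\<sigma> g U) K)"
    using sigma_mult[OF g h(1) U(1)] h(2) U(1) by (simp add: sigma_one)
qed

end

section \<open>Essential dimension one forces an affine action\<close>

lemma affine_iterate:
  assumes E: "is_subfield E" and hom: "subfield_hom E \<phi>" and K: "is_subfield K" "K \<subseteq> E" and fixK: "\<And>c. c \<in> K \<Longrightarrow> \<phi> c = c"
    and U: "U \<in> E" and \<phi>U: "\<phi> U = \<alpha> * U + \<delta>" "\<alpha> \<in> K" "\<delta> \<in> K"
  shows "\<exists>\<delta>'\<in>K. (\<phi> ^^ k) U = \<alpha> ^ k * U + \<delta>'"
proof (induction k)
  case 0
  then show ?case using subfield_0[OF K(1)] by auto
next
  case (Suc k)
  then obtain \<delta>' where d: "\<delta>' \<in> K" "(\<phi> ^^ k) U = \<alpha> ^ k * U + \<delta>'" by blast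
  have "\<alpha> ^ k \<in> K" using \<phi>U subfield_power[OF K(1)] by blast
  then have "\<phi> (\<alpha> ^ k * U + \<delta>') = \<alpha> ^ k * \<phi> U + \<delta>'"
    using d(1) K U fixK by (subst subfield_hom_add[OF E hom] | subst subfield_hom_mult[OF E hom] | simp add: subset_iff subfield_mult[OF E])+
  then have "(\<phi> ^^ Suc k) U = \<alpha> ^ Suc k * U + (\<alpha> ^ k * \<delta> + \<delta>')"
    by (simp add: d(2) \<phi>U(1) algebra_simps)
  moreover have "\<alpha> ^ k * \<delta> + \<delta>' \<in> K" using \<open>\<alpha> ^ k \<in> K\<close> d(1) \<phi>U subfield_add[OF K(1)] subfield_mult[OF K(1)] by blast
  ultimately show ?case by blast
qed

lemma transcendental_affine_eq:
  assumes K: "is_subfield K" and U: "transcendental_over K U" and c: "a \<in> K" "b \<in> K" "c \<in> K" "d \<in> K" and eq: "a * U + b = c * U + d"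
  shows "a = c \<and> b = d"
proof -
  have "[:b, a:] = [:d, c:]"
    by (rule transcendental_over_eq[OF K U]) (use c eq in \<open>auto simp: polys_over_pCons[OF K] polys_over_0[OF K] algebra_simps\<close>)
  then show ?thesis by simp
qed

context gnp_rep
begin

lemma faithful_trdeg_1_imp:
  assumes faithful: "faithful_G_subfield K G mone x \<sigma> E" and trdeg: "trdeg_is K E 1"
  shows "odd n \<and> (\<exists>z\<in>K. primitive_root z n) \<and> fp_degree_ge K r"
proof -
  have E: "is_subfield E" "K \<subseteq> E" "E \<subseteq> KX" and Est: "\<And>g e. g \<in> G \<Longrightarrow> e \<in> E \<Longrightarrow> \<sigma> g e \<in> E"
    and ff: "\<And>g. g \<in> G \<Longrightarrow> g \<noteq> mone \<Longrightarrow> \<exists>e\<in>E. \<sigma> g e \<noteq> e"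
    using faithful unfolding faithful_G_subfield_def by blast+
  obtain t where t: "t \<in> E" "transcendental_over K t" "\<And>e. e \<in> E \<Longrightarrow> \<not> transcendental_over (gen_subfield (insert t K)) e"
    by (rule trdeg_is_1D[OF K trdeg]) (rule that)
  obtain u where u: "u \<in> E" "transcendental_over K u" "E = gen_subfield (insert u K)"
    using luroth[OF finite_imageI[OF finite_G] K indep_x E t] by blast
  have uKX: "u \<in> KX" using u(1) E by blast
  have homE: "subfield_hom E (\<sigma> g)" if "g \<in> G" for g by (rule subfield_hom_subset[OF sigma_hom[OF that] E(3)])
  have faithful_u: "g = mone" if g: "g \<in> G" and "\<sigma> g u = u" for g
  proof (rule ccontr)
    assume "g \<noteq> mone"
    then obtain e where e: "e \<in> E" "\<sigma> g e \<noteq> e" using ff g by blast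
    have "\<sigma> g e = e"
    proof (rule subfield_hom_eq_on_gen[of "insert u K" _ "\<lambda>e. e"])
      show "subfield_hom (gen_subfield (insert u K)) (\<sigma> g)" using homE[OF g] by (simp only: u(3)[symmetric])
      show "e \<in> gen_subfield (insert u K)" using e(1) by (simp only: u(3)[symmetric])
    qed (use that sigma_K[OF g] in \<open>auto simp: subfield_hom_def\<close>)
    with e show False by simp
  qed
  obtain v0 where v0: "v0 \<in> V" "v0 \<noteq> 0" by (rule nonzero_V)
  define g0 where "g0 = el 0 v0"
  have g0: "g0 \<in> G" unfolding g0_def by (rule el_in_G[OF v0(1)])
  have el_mone: "el k v = mone \<longleftrightarrow> \<zeta> ^ k = 1 \<and> v = 0" for k v
    unfolding el_0[symmetric] el_inj by simp
  have ne: "\<sigma> g0 u \<noteq> u" using faithful_u[OF g0] v0 el_mone[of 0 v0] by (auto simp: g0_def)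
  have st: "\<sigma> g u \<in> gen_subfield (insert u K)" if "g \<in> G" for g
    using Est[OF that u(1)] by (simp only: u(3)[symmetric])
  obtain a b c d where fl: "frac_linear K u (\<sigma> g0 u) a b c d" using frac_linear_sigma[OF uKX u(2) st g0] by blast
  have H: "\<And>\<psi>. \<psi> \<in> \<sigma> ` G \<Longrightarrow> subfield_hom (gen_subfield (insert u K)) \<psi>"
    "\<And>\<psi> c. \<psi> \<in> \<sigma> ` G \<Longrightarrow> c \<in> K \<Longrightarrow> \<psi> c = c"
    "\<And>\<psi> e. \<psi> \<in> \<sigma> ` G \<Longrightarrow> e \<in> gen_subfield (insert u K) \<Longrightarrow> \<psi> e \<in> gen_subfield (insert u K)"
    using homE Est sigma_K unfolding u(3)[symmetric] by blast+
  have ord: "(\<sigma> g0 ^^ p) u = u" unfolding g0_def by (rule sigma_p[OF uKX v0(1)])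
  have g0': "\<sigma> g0 \<in> \<sigma> ` G" using g0 by blast
  obtain U \<beta> where U: "U \<in> gen_subfield (insert u K)" "transcendental_over K U"
    "\<And>\<psi>. \<psi> \<in> \<sigma> ` G \<Longrightarrow> \<psi> U \<in> gen_subfield (insert U K)" "\<beta> \<in> K" "\<beta> \<noteq> 0" "\<sigma> g0 U = U + \<beta>"
    "\<And>\<psi>. \<psi> \<in> \<sigma> ` G \<Longrightarrow> \<psi> U = U \<Longrightarrow> \<psi> u = u"
    by (rule translation_generator[where H = "\<sigma> ` G" and \<phi> = "\<sigma> g0" and u = u and K = K],
        rule prime, rule charf, rule K, rule u(2), erule H(1), rule H(2), assumption, assumption,
        rule H(3), assumption, assumption, rule g0', rule fl, rule ord, rule ne) (rule that)
  have UKX: "U \<in> KX" using U(1) E(3) u(3) by blast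
  let ?L = "gen_subfield (insert U K)"
  have LKX: "?L \<subseteq> KX" using UKX KX(2) by (intro gen_subfield_least[OF KX(1)]) auto
  have stU: "\<sigma> g U \<in> ?L" if "g \<in> G" for g using U(3) that by blast
  have faithful_U: "g = mone" if "g \<in> G" "\<sigma> g U = U" for g using U(7) faithful_u that by blast
  \<comment> \<open>The premise holds for the elements of \<open>V\<close>, which commute with
    \<open>g0\<close>, and for \<open>T\<close>, which normalizes \<open>V\<close>.\<close>
  have affine: "\<exists>\<alpha>\<in>K. \<exists>\<delta>\<in>K. \<alpha> \<noteq> 0 \<and> \<sigma> g U = \<alpha> * U + \<delta>"
    if g: "g \<in> G" and "\<sigma> g0 (\<sigma> g U) = \<sigma> g U + \<gamma>" "\<gamma> \<in> K" "\<gamma> \<noteq> 0" for g \<gamma>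
  proof -
    obtain a b c d where fl': "frac_linear K U (\<sigma> g U) a b c d" using frac_linear_sigma[OF UKX U(2) stU g] by blast
    show ?thesis
      by (rule affine_of_translation[where \<phi> = "\<sigma> g0" and \<beta> = \<beta> and \<gamma> = \<gamma>], rule K, rule U(2),
          rule subfield_hom_subset[OF sigma_hom[OF g0] LKX], erule sigma_K[OF g0], rule U(6), rule U(4), rule fl', rule stU[OF g])
        (rule that)+
  qed
  have iterate: "\<exists>\<delta>'\<in>K. (\<sigma> g ^^ k) U = \<alpha> ^ k * U + \<delta>'" if "g \<in> G" "\<sigma> g U = \<alpha> * U + \<delta>" "\<alpha> \<in> K" "\<delta> \<in> K" for g \<alpha> \<delta> k
    by (rule affine_iterate[where \<phi> = "\<sigma> g" and \<delta> = \<delta>], rule KX(1), rule sigma_hom[OF that(1)], rule K, rule KX(2),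
        erule sigma_K[OF that(1)], rule UKX) (rule that)+
  have "\<exists>\<delta>\<in>K. \<sigma> (el 0 v) U = U + \<delta>" if v: "v \<in> V" for v
  proof -
    have vG: "el 0 v \<in> G" by (rule el_in_G[OF v])
    have "\<sigma> g0 (\<sigma> (el 0 v) U) = \<sigma> (el 0 v) (\<sigma> g0 U)"
      unfolding g0_def sigma_commute_V[OF UKX v0(1) v] sigma_commute_V[OF UKX v v0(1)] by (simp add: add.commute)
    also have "\<dots> = \<sigma> (el 0 v) U + \<beta>"
      unfolding U(6) using UKX U(4) KX(2) subfield_hom_add[OF KX(1) sigma_hom[OF vG]] sigma_K[OF vG] by auto
    finally obtain \<alpha> \<delta> where ad: "\<alpha> \<in> K" "\<delta> \<in> K" "\<sigma> (el 0 v) U = \<alpha> * U + \<delta>"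
      using affine[OF vG _ U(4,5)] by blast
    obtain \<delta>' where "\<delta>' \<in> K" "(\<sigma> (el 0 v) ^^ p) U = \<alpha> ^ p * U + \<delta>'" using iterate[OF vG ad(3,1,2)] by blast
    then have "\<alpha> ^ p * U + \<delta>' = 1 * U + 0" "\<delta>' \<in> K" using sigma_p[OF UKX v] by simp_all
    then have "\<alpha> ^ p = 1"
      using transcendental_affine_eq[OF K U(2)] ad(1) subfield_power[OF K] subfield_0[OF K] subfield_1[OF K] by blast
    \<comment> \<open>In characteristic p the only p-th root of 1 is 1, so elements of
      \<open>V\<close> act by pure translations.\<close>
    have "(\<alpha> - 1 + 1) ^ p = (\<alpha> - 1) ^ p + 1 ^ p" by (rule freshmans_dream) (use prime charf in auto)
    then have "(\<alpha> - 1) ^ p = 0" using \<open>\<alpha> ^ p = 1\<close> by simp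
    then have "\<alpha> = 1" by simp
    then show ?thesis using ad by auto
  qed
  then obtain b where b: "\<And>v. v \<in> V \<Longrightarrow> b v \<in> K" "\<And>v. v \<in> V \<Longrightarrow> \<sigma> (el 0 v) U = U + b v" by metis
  have b_nz: "b v \<noteq> 0" if "v \<in> V" "v \<noteq> 0" for v
    using b(2)[OF that(1)] faithful_U[OF el_in_G[OF that(1), of 0]] el_mone[of 0 v] that(2) by auto
  have b_add: "b (v + w) = b v + b w" if "v \<in> V" "w \<in> V" for v w
  proof -
    have "\<sigma> (el 0 v) (U + b w) = U + b v + b w"
      using subfield_hom_add[OF KX(1) sigma_hom[OF el_in_G[OF that(1), of 0]], of U "b w"] UKX KX(2) b that
        sigma_K[OF el_in_G[OF that(1), of 0]] by auto
    then have "U + b (v + w) = U + b v + b w"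
      using sigma_commute_V[OF UKX that] b(2)[OF V_add[OF that]] b(2)[OF that(2)] by simp
    then show ?thesis by (simp add: add.assoc)
  qed

  define T where "T = el 1 0"
  have T: "T \<in> G" unfolding T_def by (rule el_in_G[OF V_0])
  have conj: "\<sigma> (el 0 v) (\<sigma> T U) = \<sigma> T U + b (inverse (\<zeta> ^ 2) * v)" if v: "v \<in> V" for v
  proof -
    have V': "inverse (\<zeta> ^ 2) * v \<in> V" using V_zeta_inv[OF v, of 1] by simp
    have "\<sigma> (el 0 v) (\<sigma> T U) = \<sigma> T (U + b (inverse (\<zeta> ^ 2) * v))"
      unfolding T_def sigma_commute[OF UKX v] b(2)[OF V'] ..
    then show ?thesis using subfield_hom_add[OF KX(1) sigma_hom[OF T]] UKX b(1)[OF V'] KX(2) sigma_K[OF T] by auto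
  qed
  have V1: "inverse (\<zeta> ^ 2) * v0 \<in> V" using V_zeta_inv[OF v0(1), of 1] by simp
  obtain \<alpha> \<delta> where ad: "\<alpha> \<in> K" "\<delta> \<in> K" "\<alpha> \<noteq> 0" "\<sigma> T U = \<alpha> * U + \<delta>"
    using affine[OF T conj[OF v0(1), folded g0_def] b(1)[OF V1] b_nz[OF V1]] v0 zeta_nz by auto
  \<comment> \<open>Moving the translation by \<open>v\<close> past \<open>T\<close> multiplies it
    by \<alpha> in \<open>K\<close> and \<open>v\<close> by the inverse of
    \<open>\<zeta> ^ 2\<close> in \<open>V\<close>.\<close>
  have twist: "\<alpha> * b v = b (inverse (\<zeta> ^ 2) * v)" if v: "v \<in> V" for v
  proof -
    have "\<alpha> \<in> KX" "\<delta> \<in> KX" using ad KX(2) by auto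
    then have "\<sigma> (el 0 v) (\<alpha> * U + \<delta>) = \<alpha> * (U + b v) + \<delta>"
      using UKX ad sigma_K[OF el_in_G[OF v, of 0]] b(2)[OF v]
      by (simp add: subfield_hom_add[OF KX(1) sigma_hom[OF el_in_G[OF v]]] subfield_hom_mult[OF KX(1) sigma_hom[OF el_in_G[OF v]]] subfield_mult[OF KX(1)])
    then show ?thesis using conj[OF v] ad(4) by (simp add: algebra_simps)
  qed
  have twist_pow: "\<alpha> ^ k * b v = b (inverse (\<zeta> ^ (2 * k)) * v)" if v: "v \<in> V" for v k
  proof (induction k)
    case (Suc k)
    have "\<alpha> ^ Suc k * b v = \<alpha> * b (inverse (\<zeta> ^ (2 * k)) * v)" using Suc by (simp add: mult.assoc)
    also have "\<dots> = b (inverse (\<zeta> ^ 2) * (inverse (\<zeta> ^ (2 * k)) * v))" by (rule twist[OF V_zeta_inv[OF v]])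
    also have "inverse (\<zeta> ^ 2) * (inverse (\<zeta> ^ (2 * k)) * v) = inverse (\<zeta> ^ (2 * Suc k)) * v"
      by (simp add: power2_eq_square field_simps)
    finally show ?case .
  qed simp
  have T_pow: "\<exists>\<delta>'\<in>K. \<sigma> (el k 0) U = \<alpha> ^ k * U + \<delta>'" for k
    using iterate[OF T ad(4,1,2), of k] sigma_iterate_T[OF UKX, of k] by (simp add: T_def)
  have prim: "primitive_root \<alpha> n"
    unfolding primitive_root_def
  proof (intro conjI allI impI)
    obtain \<delta>' where "\<delta>' \<in> K" "\<sigma> (el n 0) U = \<alpha> ^ n * U + \<delta>'" using T_pow by blast
    then have "\<alpha> ^ n * U + \<delta>' = 1 * U + 0" "\<delta>' \<in> K" using sigma_one[OF UKX] by (simp_all add: el_n el_0)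
    then show "\<alpha> ^ n = 1"
      using transcendental_affine_eq[OF K U(2)] ad(1) subfield_power[OF K] subfield_0[OF K] subfield_1[OF K] by blast
  next
    fix k assume k: "0 < k \<and> k < n"
    show "\<alpha> ^ k \<noteq> 1"
    proof
      assume ak: "\<alpha> ^ k = 1"
      \<comment> \<open>With \<open>\<alpha> ^ k = 1\<close> the k-th power of \<open>T\<close> is a
        translation, so its p-th power is trivial. Faithfulness gives \<open>n dvd k * p\<close>,
        and \<open>p\<close> is coprime to \<open>n\<close>.\<close>
      obtain \<delta>' where d: "\<delta>' \<in> K" "\<sigma> (el k 0) U = U + \<delta>'" using T_pow[of k] ak by auto
      have k0: "el k 0 \<in> G" by (rule el_in_G[OF V_0])
      have mult: "\<sigma> (el (k * j) 0) U = U + of_nat j * \<delta>'" for j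
      proof (induction j)
        case (Suc j)
        have jd: "of_nat j * \<delta>' \<in> K" using d(1) by (intro subfield_mult[OF K] subfield_of_nat[OF K])
        have "\<sigma> (el (k * Suc j) 0) U = \<sigma> (el k 0) (\<sigma> (el (k * j) 0) U)"
          using sigma_mult[OF k0 el_in_G[OF V_0] UKX, of "k * j"] by (simp add: el_mult)
        also have "\<dots> = \<sigma> (el k 0) U + of_nat j * \<delta>'"
          unfolding Suc using subfield_hom_add[OF KX(1) sigma_hom[OF k0]] UKX jd KX(2) sigma_K[OF k0] by auto
        finally show ?case by (simp add: d(2) algebra_simps)
      qed (simp add: el_0 sigma_one[OF UKX])
      have "(of_nat p :: 'f) = 0" using charf by (metis of_nat_CHAR)
      then have "\<sigma> (el (k * p) 0) U = U" using mult[of p] by simp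
      then have "\<zeta> ^ (k * p) = 1" using faithful_U[OF el_in_G[OF V_0]] el_mone by blast
      then have "n dvd k * p" by (rule primitive_root_dvd[OF root n_pos])
      moreover have "coprime n p" using prime pn prime_imp_coprime coprime_commute by blast
      ultimately have "n dvd k" by (simp add: coprime_dvd_mult_left_iff)
      then show False using k by (auto dest: dvd_imp_le)
    qed
  qed
  have "odd n"
  proof
    assume "even n"
    then obtain k where k: "n = 2 * k" by (rule evenE)
    then have "0 < k" "k < n" using n_pos by auto
    \<comment> \<open>\<open>\<zeta> ^ (2 * k)\<close> is \<open>\<zeta> ^ n\<close>, so this power
      of \<open>T\<close> commutes with \<open>V\<close> and \<alpha> would have order at most
      \<open>k\<close>.\<close>
    have "\<alpha> ^ k * b v0 = b v0" using twist_pow[OF v0(1), of k] by (simp add: k[symmetric] zeta_n)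
    then have "\<alpha> ^ k = 1" using b_nz[OF v0] by simp
    then show False using prim \<open>0 < k\<close> \<open>k < n\<close> by (auto simp: primitive_root_def)
  qed
  moreover have "fp_degree_ge K r"
  proof -
    obtain B where B: "finite B" "B \<subseteq> V" "card B = r" "fp_indep B" using dimV unfolding fp_dim_def by blast
    have "b 0 = b 0 + b 0" using b_add[OF V_0 V_0] by (simp only: add_0_right)
    then have b_0: "b 0 = 0" by (metis add_cancel_right_right)
    have b_nat: "b (of_nat k * v) = of_nat k * b v" if "v \<in> V" for k v
      by (induction k) (auto simp: b_0 distrib_right b_add V_of_nat that)
    have sum_in: "(\<Sum>v\<in>B'. of_nat (c v) * v) \<in> V" if "B' \<subseteq> V" for c B'
      using that by (induction B' rule: infinite_finite_induct) (auto simp: V_0 V_add V_of_nat)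
    have b_sum: "b (\<Sum>v\<in>B'. of_nat (c v) * v) = (\<Sum>v\<in>B'. of_nat (c v) * b v)" if "B' \<subseteq> V" for c B'
      using that by (induction B' rule: infinite_finite_induct) (auto simp: b_0 b_add V_of_nat sum_in b_nat)
    have inj: "inj_on b V"
    proof (rule inj_onI)
      fix v w assume vw: "v \<in> V" "w \<in> V" "b v = b w"
      have "b v = b (v - w) + b w" using b_add[OF V_add[OF vw(1) V_uminus[OF vw(2)]] vw(2)] by simp
      then show "v = w" using vw b_nz[of "v - w"] V_add[OF vw(1) V_uminus[OF vw(2)]] by auto
    qed
    have "fp_indep (b ` B)"
      unfolding fp_indep_def
    proof (intro allI impI ballI)
      fix c :: "'f \<Rightarrow> nat" and y assume 0: "(\<Sum>y\<in>b ` B. of_nat (c y) * y) = 0" and y: "y \<in> b ` B"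
      have "(\<Sum>y\<in>b ` B. of_nat (c y) * y) = (\<Sum>v\<in>B. of_nat (c (b v)) * b v)"
        by (rule sum.reindex_cong[of b]) (use inj B(2) in \<open>auto intro: inj_on_subset\<close>)
      then have "b (\<Sum>v\<in>B. of_nat (c (b v)) * v) = 0" using 0 b_sum[OF B(2), of "\<lambda>v. c (b v)"] by simp
      then have "(\<Sum>v\<in>B. of_nat (c (b v)) * v) = 0" using b_nz sum_in[OF B(2), of "\<lambda>v. c (b v)"] by blast
      moreover obtain v where v: "v \<in> B" "y = b v" using y by blast
      \<comment> \<open>Independence of \<open>B\<close> is used in \<open>'l\<close>; divisibility
        by \<open>p\<close> then carries the vanishing of the coefficient over to
        \<open>'f\<close>.\<close>
      ultimately have "of_nat (c y) = (0::'l)" using B(4)[unfolded fp_indep_def, THEN spec[of _ "\<lambda>v. c (b v)"]] by blast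
      then have "p dvd c y" using charl of_nat_eq_0_iff_char_dvd by blast
      then show "of_nat (c y) = (0::'f)" using charf of_nat_eq_0_iff_char_dvd by blast
    qed
    then show ?thesis unfolding fp_degree_ge_def
      using B b(1) inj by (intro exI[of _ "b ` B"]) (auto simp: card_image inj_on_subset)
  qed
  ultimately show ?thesis using prim ad(1) by blast
qed

end

section \<open>An affine representation over \<open>K\<close>\<close>

text \<open>Natural coefficients make the same polynomial meaningful in both fields. Its values at
  \<open>\<zeta> ^ 2\<close> form F_p[\<open>\<zeta> ^ 2\<close>], with \<open>p - 1\<close> in the
  role of -1.\<close>

definition neval :: "nat poly \<Rightarrow> 'a::comm_semiring_1 \<Rightarrow> 'a" where
  "neval P t = poly (map_poly of_nat P) t"

lemma neval_0: "neval 0 t = 0" and neval_pCons: "neval (pCons a P) t = of_nat a + t * neval P t"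
  by (simp_all add: neval_def map_poly_pCons)

lemma neval_add: "neval (P + Q) t = neval P t + neval Q t"
proof -
  have "map_poly of_nat (P + Q) = (map_poly of_nat P + map_poly of_nat Q :: 'a poly)"
    by (rule poly_eqI) (simp add: coeff_map_poly)
  then show ?thesis by (simp add: neval_def)
qed

lemma neval_mult: "neval (P * Q) t = neval P t * neval Q t"
proof -
  have "map_poly of_nat (P * Q) = (map_poly of_nat P * map_poly of_nat Q :: 'a poly)"
    by (rule poly_eqI) (simp add: coeff_map_poly coeff_mult)
  then show ?thesis by (simp add: neval_def)
qed

lemma neval_const: "neval [:a:] t = of_nat a" by (simp add: neval_pCons neval_0)

lemma neval_one: "neval 1 t = 1" using neval_const[of 1 t] by (simp add: one_pCons)

lemma of_nat_char_minus_1: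
  assumes "CHAR('a::comm_ring_1) = p" "p > 0" shows "(of_nat (p - 1) :: 'a) = - 1"
proof -
  have "of_nat (p - 1) + 1 = (of_nat (Suc (p - 1)) :: 'a)" by simp
  also have "Suc (p - 1) = p" using assms(2) by simp
  also have "of_nat p = (0 :: 'a)" using assms(1) by (metis of_nat_CHAR)
  finally show ?thesis by (simp add: eq_neg_iff_add_eq_0)
qed

text \<open>A homomorphism of F_p[X]-modules, where X acts by \<theta> on the source and by \<alpha>
  on the target.\<close>

definition semilinear_on :: "'l::field \<Rightarrow> 'f::field \<Rightarrow> 'l set \<Rightarrow> ('l \<Rightarrow> 'f) \<Rightarrow> bool" where
  "semilinear_on \<theta> \<alpha> W f \<longleftrightarrow> 0 \<in> W \<and> (\<forall>v\<in>W. \<forall>w\<in>W. v + w \<in> W \<and> f (v + w) = f v + f w) \<and>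
     (\<forall>w\<in>W. \<theta> * w \<in> W \<and> f (\<theta> * w) = \<alpha> * f w)"

lemma semilinear_on_0:
  assumes "semilinear_on \<theta> \<alpha> W f" shows "f 0 = 0"
proof -
  have "f (0 + 0) = f 0 + f 0" using assms unfolding semilinear_on_def by blast
  then have "f 0 = f 0 + f 0" by (simp only: add_0_right)
  then show ?thesis by (metis add_cancel_right_right)
qed

lemma semilinear_on_of_nat:
  assumes "semilinear_on \<theta> \<alpha> W f" "w \<in> W"
  shows "of_nat a * w \<in> W \<and> f (of_nat a * w) = of_nat a * f w"
  using assms by (induction a) (auto simp: semilinear_on_0 distrib_right semilinear_on_def)

lemma semilinear_on_neval:
  assumes f: "semilinear_on \<theta> \<alpha> W f" and w: "w \<in> W"
  shows "neval P \<theta> * w \<in> W \<and> f (neval P \<theta> * w) = neval P \<alpha> * f w"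
proof (induction P)
  case 0
  then show ?case using f semilinear_on_0[OF f] by (simp add: neval_0 semilinear_on_def)
next
  case (pCons a P)
  have "of_nat a * w + \<theta> * (neval P \<theta> * w) \<in> W \<and>
      f (of_nat a * w + \<theta> * (neval P \<theta> * w)) = of_nat a * f w + \<alpha> * (neval P \<alpha> * f w)"
    using semilinear_on_of_nat[OF f w, of a] pCons.IH f unfolding semilinear_on_def by metis
  then show ?case by (simp add: neval_pCons algebra_simps)
qed

lemma sum_roots_of_unity:
  fixes z :: "'a::field"
  assumes "primitive_root z n" "k < n"
  shows "(\<Sum>i<n. z ^ (i * k)) = (if k = 0 then of_nat n else 0)"
proof (cases "k = 0")
  case False
  then have "z ^ k \<noteq> 1" "(z ^ k) ^ n = 1"
    using assms by (auto simp: primitive_root_def power_mult[symmetric] mult.commute[of k] power_mult)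
  then show ?thesis using geometric_sum[of "z ^ k" n] False by (simp add: power_mult[symmetric] mult.commute)
qed simp

context gnp_rep
begin

lemma p_pos: "p > 0" using prime prime_gt_0_nat by blast

lemma of_nat_transfer: "(of_nat a :: 'l) = of_nat b \<Longrightarrow> (of_nat a :: 'f) = of_nat b"
proof -
  assume "(of_nat a :: 'l) = of_nat b"
  then have "(of_nat (a + (p - 1) * b) :: 'l) = 0"
    by (simp only: of_nat_add of_nat_mult of_nat_char_minus_1[OF charl p_pos]) simp
  then have "p dvd a + (p - 1) * b" using charl of_nat_eq_0_iff_char_dvd by blast
  then have "(of_nat (a + (p - 1) * b) :: 'f) = 0" using charf of_nat_eq_0_iff_char_dvd by blast
  then show ?thesis
    by (simp only: of_nat_add of_nat_mult of_nat_char_minus_1[OF charf p_pos]) simp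
qed

text \<open>The coordinate at one basis vector, with its coefficient reread in the prime field of
  \<open>'f\<close>. The chosen coefficients are not unique as natural numbers, but their residues
  modulo \<open>p\<close> are.\<close>

lemma nonzero_functional:
  obtains f0 :: "'l \<Rightarrow> 'f" and v0 where "v0 \<in> V" "f0 v0 = 1" "\<And>v. f0 v \<in> K"
    "\<And>v w. v \<in> V \<Longrightarrow> w \<in> V \<Longrightarrow> f0 (v + w) = f0 v + f0 w"
proof -
  obtain B where B: "finite B" "B \<subseteq> V" "card B = r" "fp_indep B"
    and VB: "V = {\<Sum>b\<in>B. of_nat (c b) * b | c :: 'l \<Rightarrow> nat. True}"
    using dimV unfolding fp_dim_def by blast
  obtain b0 where b0: "b0 \<in> B" using B(3) r by fastforce
  define cf where "cf v = (SOME c :: 'l \<Rightarrow> nat. v = (\<Sum>b\<in>B. of_nat (c b) * b))" for v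
  have cf: "v = (\<Sum>b\<in>B. of_nat (cf v b) * b)" if v: "v \<in> V" for v
  proof -
    have "\<exists>c :: 'l \<Rightarrow> nat. v = (\<Sum>b\<in>B. of_nat (c b) * b)" using v VB by blast
    then show ?thesis unfolding cf_def by (rule someI_ex)
  qed
  define f0 where "f0 v = (of_nat (cf v b0) :: 'f)" for v
  have f0: "f0 v = of_nat (c b0)" if "v \<in> V" "v = (\<Sum>b\<in>B. of_nat (c b) * b)" for v c
  proof -
    have "(\<Sum>b\<in>B. of_nat (cf v b + (p - 1) * c b) * b) = (\<Sum>b\<in>B. of_nat (cf v b) * b) - (\<Sum>b\<in>B. of_nat (c b) * b)"
      unfolding sum_subtractf[symmetric]
      by (simp only: of_nat_add of_nat_mult of_nat_char_minus_1[OF charl p_pos]) (simp add: algebra_simps)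
    then have "(\<Sum>b\<in>B. of_nat (cf v b + (p - 1) * c b) * b) = 0" using cf[OF that(1)] that(2) by simp
    then have "(of_nat (cf v b0 + (p - 1) * c b0) :: 'l) = 0"
      using B(4)[unfolded fp_indep_def, THEN spec[of _ "\<lambda>b. cf v b + (p - 1) * c b"]] b0 by blast
    then have "(of_nat (cf v b0) :: 'l) = of_nat (c b0)"
      by (simp only: of_nat_add of_nat_mult of_nat_char_minus_1[OF charl p_pos]) simp
    then show ?thesis unfolding f0_def by (rule of_nat_transfer)
  qed
  show ?thesis
  proof (rule that[of b0 f0])
    show "b0 \<in> V" using b0 B(2) by blast
    have "(\<Sum>b\<in>B. of_nat (if b = b0 then 1 else 0) * b) = (\<Sum>b\<in>B. if b = b0 then b else 0)"
      by (rule sum.cong) auto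
    then show "f0 b0 = 1" using f0[of b0 "\<lambda>b. if b = b0 then 1 else 0"] b0 B(1,2) by auto
    show "f0 v \<in> K" for v unfolding f0_def by (rule subfield_of_nat[OF K])
    fix v w assume vw: "v \<in> V" "w \<in> V"
    have "v + w = (\<Sum>b\<in>B. of_nat (cf v b + cf w b) * b)"
      using cf[OF vw(1)] cf[OF vw(2)] by (simp add: distrib_right sum.distrib)
    then show "f0 (v + w) = f0 v + f0 w" using f0[OF V_add[OF vw], of "\<lambda>b. cf v b + cf w b"] by (simp add: f0_def)
  qed
qed

text \<open>Averaging a functional over \<open>\<langle>\<tau>\<rangle>\<close> against the characters of \<open>\<langle>\<tau>\<rangle>\<close> yields, for some character,
  a nonzero eigenfunctional; its eigenvalue \<open>\<alpha>\<close> is conjugate to \<open>\<zeta>\<^sup>2\<close>.\<close>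

lemma conjugate_root:
  assumes z: "z \<in> K" "primitive_root z n"
  obtains \<alpha> where "\<alpha> \<in> K" "\<alpha> ^ n = 1" "\<And>P. neval P (\<zeta> ^ 2) = 0 \<Longrightarrow> neval P \<alpha> = 0"
proof -
  obtain f0 :: "'l \<Rightarrow> 'f" and v0 where f0: "v0 \<in> V" "f0 v0 = 1" "\<And>v. f0 v \<in> K"
    "\<And>v w. v \<in> V \<Longrightarrow> w \<in> V \<Longrightarrow> f0 (v + w) = f0 v + f0 w"
    by (rule nonzero_functional) (rule that)
  let ?t = "\<zeta> ^ 2"
  have tV: "?t ^ k * v \<in> V" if "v \<in> V" for k v using V_zeta[OF that, of k] by (simp add: power_mult)
  have z1: "z ^ n = 1" and z0: "z \<noteq> 0" using z(2) n_pos by (auto simp: primitive_root_def zero_power)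
  \<comment> \<open>The part of \<open>f0\<close> on which \<open>\<tau>\<close> acts by the i-th
    character: a cyclic shift of the summation index shows that \<open>\<zeta> ^ 2\<close> acts by
    the inverse of \<open>z ^ i\<close>.\<close>
  define g where "g i v = (\<Sum>k<n. z ^ (i * k) * f0 (?t ^ k * v))" for i v
  have semi: "semilinear_on ?t (inverse (z ^ i)) V (g i)" for i
    unfolding semilinear_on_def
  proof (intro conjI ballI)
    fix v w assume "v \<in> V" "w \<in> V"
    then show "v + w \<in> V" "g i (v + w) = g i v + g i w"
      by (simp_all add: V_add g_def distrib_left f0(4) tV sum.distrib)
  next
    fix v assume v: "v \<in> V"
    show "?t * v \<in> V" using tV[OF v, of 1] by simp
    define h where "h k = z ^ (i * k) * f0 (?t ^ k * v)" for k
    have "?t ^ n = (\<zeta> ^ n) ^ 2" "z ^ (i * n) = (z ^ n) ^ i" by (simp_all only: power_mult[symmetric] mult.commute)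
    then have "h n = h 0" by (simp add: h_def zeta_n z1)
    then have "(\<Sum>k<n. h (Suc k)) = (\<Sum>k<n. h k)"
      using sum.lessThan_Suc_shift[of h n] by simp
    moreover have "z ^ i * g i (?t * v) = (\<Sum>k<n. h (Suc k))"
      by (simp add: g_def h_def sum_distrib_left power_add mult_ac)
    ultimately have "z ^ i * g i (?t * v) = g i v" by (simp add: g_def h_def)
    then show "g i (?t * v) = inverse (z ^ i) * g i v" using z0 by (simp add: field_simps)
  qed (rule V_0)
  \<comment> \<open>Orthogonality of the characters: the parts add up to \<open>n\<close> times
    \<open>f0\<close>, and \<open>n\<close> is nonzero in characteristic p.\<close>
  have "(\<Sum>i<n. g i v0) = (\<Sum>k<n. f0 (?t ^ k * v0) * (\<Sum>i<n. z ^ (i * k)))"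
    unfolding g_def sum_distrib_left by (subst sum.swap) (simp add: mult.commute)
  also have "\<dots> = (\<Sum>k<n. if k = 0 then of_nat n * f0 v0 else 0)"
    by (rule sum.cong[OF refl]) (simp add: sum_roots_of_unity[OF z(2)])
  also have "\<dots> = of_nat n" using n_pos f0(2) by simp
  finally have "(\<Sum>i<n. g i v0) \<noteq> 0" using pn charf of_nat_eq_0_iff_char_dvd by metis
  then obtain i where i: "g i v0 \<noteq> 0" by (meson sum.neutral)
  show ?thesis
  proof (rule that[of "inverse (z ^ i)"])
    show "inverse (z ^ i) \<in> K" using z(1) by (intro subfield_inverse[OF K] subfield_power[OF K])
    have "(z ^ i) ^ n = 1" using z1 by (metis power_mult mult.commute power_one)
    then show "inverse (z ^ i) ^ n = 1" by (simp add: power_inverse)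
    fix P assume "neval P ?t = 0"
    then have "neval P (inverse (z ^ i)) * g i v0 = 0"
      using semilinear_on_neval[OF semi f0(1), of P i] semilinear_on_0[OF semi, of i] by simp
    then show "neval P (inverse (z ^ i)) = 0" using i by simp
  qed
qed

text \<open>The values form a finite integral domain, in which multiplication by a nonzero element
  is injective, hence surjective.\<close>

lemma neval_inverse:
  assumes "neval P (\<zeta> ^ 2) \<noteq> 0" obtains Q where "neval Q (\<zeta> ^ 2) * neval P (\<zeta> ^ 2) = 1"
proof -
  let ?L = "gen_subfield {\<zeta> ^ 2}" and ?R = "range (\<lambda>Q. neval Q (\<zeta> ^ 2))"
  have L: "is_subfield ?L" "\<zeta> ^ 2 \<in> ?L" using is_subfield_gen_subfield gen_subfield_superset by blast+
  have "neval Q (\<zeta> ^ 2) \<in> ?L" for Q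
    by (induction Q) (auto simp: neval_0 neval_pCons L subfield_closed[OF L(1)])
  moreover have "finite ?L" by (rule fp_dim_card[OF prime charl dimF])
  ultimately have fin: "finite ?R" by (meson finite_subset image_subsetI)
  let ?m = "\<lambda>l. l * neval P (\<zeta> ^ 2)"
  have "?m ` ?R \<subseteq> ?R" by (auto simp flip: neval_mult)
  moreover have "inj_on ?m ?R" using assms by (auto intro!: inj_onI)
  ultimately have "?m ` ?R = ?R" using endo_inj_surj[OF fin] by blast
  moreover have "1 \<in> ?R" using neval_one[of "\<zeta> ^ 2"] by (metis rangeI)
  ultimately have "1 \<in> ?m ` ?R" by simp
  then show ?thesis using that by auto
qed

text \<open>Among the injective semilinear maps into \<open>K\<close> on stable subgroups
  \<open>W\<close> of \<open>V\<close>, one with the largest \<open>W\<close> is taken. If a vector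
  \<open>v\<close> were left over, the map would extend by sending \<open>v\<close> to an element
  \<open>k\<close> of \<open>K\<close> outside its image.\<close>

lemma injective_semilinear:
  assumes z: "z \<in> K" "primitive_root z n" and deg: "fp_degree_ge K r"
  obtains \<alpha> f where "\<alpha> \<in> K" "\<alpha> ^ n = 1" "semilinear_on (\<zeta> ^ 2) \<alpha> V f" "\<And>v. v \<in> V \<Longrightarrow> f v \<in> K"
    "\<And>v. v \<in> V \<Longrightarrow> f v = 0 \<Longrightarrow> v = 0"
proof -
  obtain \<alpha> where \<alpha>: "\<alpha> \<in> K" "\<alpha> ^ n = 1" and conj: "\<And>P. neval P (\<zeta> ^ 2) = 0 \<Longrightarrow> neval P \<alpha> = 0"
    by (rule conjugate_root[OF z]) (rule that)
  let ?t = "\<zeta> ^ 2"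
  define good where "good = (\<lambda>(W, f). W \<subseteq> V \<and> semilinear_on ?t \<alpha> W f \<and> (\<forall>w\<in>W. f w \<in> K) \<and> (\<forall>w\<in>W. f w = 0 \<longrightarrow> w = 0))"
  have "good ({0}, \<lambda>_. 0)" by (auto simp: good_def semilinear_on_def V_0 subfield_0[OF K])
  moreover have "\<forall>y. good y \<longrightarrow> card (fst y) < Suc (card V)"
    using card_mono[OF finite_V] by (auto simp: good_def less_Suc_eq_le)
  ultimately obtain y where y: "good y" and max: "\<And>y'. good y' \<Longrightarrow> card (fst y') \<le> card (fst y)"
    using ex_has_greatest_nat[of good "({0}, \<lambda>_. 0)" "\<lambda>y. card (fst y)"] by blast
  obtain W f where Wf: "y = (W, f)" by (cases y)
  have W: "W \<subseteq> V" and f: "semilinear_on ?t \<alpha> W f" and fK: "\<And>w. w \<in> W \<Longrightarrow> f w \<in> K" and inj: "\<And>w. w \<in> W \<Longrightarrow> f w = 0 \<Longrightarrow> w = 0"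
    using y by (auto simp: good_def Wf)
  have W_add: "v + w \<in> W" "f (v + w) = f v + f w" if "v \<in> W" "w \<in> W" for v w
    using f that by (auto simp: semilinear_on_def)
  have W0: "0 \<in> W" using f by (simp add: semilinear_on_def)
  note nev = semilinear_on_neval[OF f]
  define N :: "nat poly" where "N = [:p - 1:]"
  have N: "neval N ?t = - 1" "neval N \<alpha> = - 1"
    unfolding N_def neval_const by (rule of_nat_char_minus_1[OF charl p_pos], rule of_nat_char_minus_1[OF charf p_pos])
  have W_minus: "- w \<in> W" "f (- w) = - f w" if "w \<in> W" for w using nev[OF that, of N] N by simp_all
  have "W = V"
  proof (rule ccontr)
    assume "W \<noteq> V"
    then obtain v where v: "v \<in> V" "v \<notin> W" using W by blast
    obtain C where C: "finite C" "C \<subseteq> K" "card C = r" "fp_indep C" using deg unfolding fp_degree_ge_def by blast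
    \<comment> \<open>These are \<open>p ^ r\<close> elements of \<open>K\<close>, more than a
      proper \<open>W\<close> has, so one of them is outside the image of \<open>f\<close>.\<close>
    let ?S = "{\<Sum>b\<in>C. of_nat (c b) * b | c :: 'f \<Rightarrow> nat. True}"
    have "?S \<subseteq> K" using C(2) by (auto intro!: subfield_sum[OF K] subfield_mult[OF K] subfield_of_nat[OF K])
    have cS: "card ?S = p ^ r" using fp_span_card(2)[OF prime charf C(1,4)] C(3) by simp
    have finW: "finite W" using W finite_V finite_subset by blast
    have "card (f ` W) \<le> card W" by (rule card_image_le[OF finW])
    also have "card W < p ^ r" using psubset_card_mono[OF finite_V] W \<open>W \<noteq> V\<close> card_V by (metis psubsetI)
    finally have "\<not> ?S \<subseteq> f ` W" using cS card_mono[OF finite_imageI[OF finW], of ?S f] by linarith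
    then obtain k where k: "k \<in> K" "k \<notin> f ` W" using \<open>?S \<subseteq> K\<close> by blast

    \<comment> \<open>If the values of \<open>P\<close> and \<open>Q\<close> at
      \<open>\<zeta> ^ 2\<close> differed, their difference would be invertible and \<open>v\<close>
      would lie in \<open>W\<close>. Equality there passes to \<alpha>, which makes
      \<open>f'\<close> below well defined.\<close>
    have uniq: "neval P ?t = neval Q ?t \<and> neval P \<alpha> = neval Q \<alpha> \<and> w = w'"
      if ww: "w \<in> W" "w' \<in> W" and eq: "w + neval P ?t * v = w' + neval Q ?t * v" for w w' P Q
    proof -
      let ?R = "P + N * Q"
      have R: "neval ?R ?t = neval P ?t - neval Q ?t" "neval ?R \<alpha> = neval P \<alpha> - neval Q \<alpha>"
        by (simp_all add: neval_add neval_mult N)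
      have "neval ?R ?t = 0"
      proof (rule ccontr)
        assume "neval ?R ?t \<noteq> 0"
        then obtain I where I: "neval I ?t * neval ?R ?t = 1" by (rule neval_inverse)
        have "neval ?R ?t * v = w' + - w" unfolding R using eq by (simp add: algebra_simps)
        then have "neval I ?t * (w' + - w) = v" using I by (metis mult.assoc mult_1)
        moreover have "neval I ?t * (w' + - w) \<in> W" using nev[OF W_add(1)[OF ww(2) W_minus(1)[OF ww(1)]], of I] by blast
        ultimately show False using v(2) by simp
      qed
      then show ?thesis using conj[of ?R] R eq by simp
    qed
    define W' where "W' = {w + neval P ?t * v | w P. w \<in> W}"
    define f' where "f' y = (let (w, P) = (SOME (w, P). w \<in> W \<and> y = w + neval P ?t * v) in f w + neval P \<alpha> * k)" for y
    have f': "f' (w + neval P ?t * v) = f w + neval P \<alpha> * k" if w: "w \<in> W" for w P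
    proof -
      define q where "q = (SOME (w', P'). w' \<in> W \<and> w + neval P ?t * v = w' + neval P' ?t * v)"
      have "case q of (w', P') \<Rightarrow> w' \<in> W \<and> w + neval P ?t * v = w' + neval P' ?t * v"
        unfolding q_def by (rule someI[of _ "(w, P)"]) (use w in auto)
      then have "fst q \<in> W" "w + neval P ?t * v = fst q + neval (snd q) ?t * v" by (auto split: prod.splits)
      then have "neval P \<alpha> = neval (snd q) \<alpha>" "w = fst q" using uniq[OF w, of "fst q" P "snd q"] by blast+
      then show ?thesis unfolding f'_def q_def[symmetric] by (simp add: split_beta)
    qed
    have tV: "neval P ?t * w \<in> V" if "w \<in> V" for P w
    proof -
      have "neval P ?t \<in> gen_subfield {?t}"
        by (induction P) (use gen_subfield_superset[of "{?t}"] in \<open>auto simp: neval_0 neval_pCons subfield_closed[OF is_subfield_gen_subfield]\<close>)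
      then show ?thesis using that by (rule V_mult)
    qed
    have "good (W', f')"
      unfolding good_def prod.case
    proof (intro conjI ballI impI)
      show "W' \<subseteq> V" unfolding W'_def using W v tV V_add by blast
      show "semilinear_on ?t \<alpha> W' f'"
        unfolding semilinear_on_def
      proof (intro conjI ballI)
        have "0 + neval 0 ?t * v \<in> W'" unfolding W'_def using W0 by blast
        then show "0 \<in> W'" by (simp add: neval_0)
        fix a assume "a \<in> W'"
        then obtain w P where a: "w \<in> W" "a = w + neval P ?t * v" unfolding W'_def by blast
        have f'a: "f' a = f w + neval P \<alpha> * k" unfolding a(2) by (rule f'[OF a(1)])
        have tw: "?t * w \<in> W" "f (?t * w) = \<alpha> * f w" using f a(1) by (auto simp: semilinear_on_def)
        have ta: "?t * a = ?t * w + neval (pCons 0 P) ?t * v" by (simp add: a(2) neval_pCons algebra_simps)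
        show "?t * a \<in> W'" unfolding ta W'_def using tw(1) by blast
        have "f' (?t * a) = f (?t * w) + neval (pCons 0 P) \<alpha> * k" unfolding ta by (rule f'[OF tw(1)])
        then show "f' (?t * a) = \<alpha> * f' a" unfolding f'a tw(2) neval_pCons by (simp add: algebra_simps)
        fix b assume "b \<in> W'"
        then obtain w' Q where b: "w' \<in> W" "b = w' + neval Q ?t * v" unfolding W'_def by blast
        have ab: "a + b = (w + w') + neval (P + Q) ?t * v" by (simp add: a(2) b(2) neval_add algebra_simps)
        show "a + b \<in> W'" unfolding ab W'_def using W_add(1)[OF a(1) b(1)] by blast
        have f'b: "f' b = f w' + neval Q \<alpha> * k" unfolding b(2) by (rule f'[OF b(1)])
        have "f' (a + b) = f (w + w') + neval (P + Q) \<alpha> * k" unfolding ab by (rule f'[OF W_add(1)[OF a(1) b(1)]])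
        then show "f' (a + b) = f' a + f' b" unfolding f'a f'b W_add(2)[OF a(1) b(1)] neval_add by (simp add: algebra_simps)
      qed
      fix a assume "a \<in> W'"
      then obtain w P where a: "w \<in> W" "a = w + neval P ?t * v" unfolding W'_def by blast
      have "neval P \<alpha> \<in> K" for P
        by (induction P) (auto simp: neval_0 neval_pCons \<alpha>(1) subfield_closed[OF K])
      then show "f' a \<in> K" unfolding a(2) f'[OF a(1)] using fK[OF a(1)] k(1) by (intro subfield_add[OF K] subfield_mult[OF K])
      assume "f' a = 0"
      then have fa: "f w + neval P \<alpha> * k = 0" by (simp add: a f')
      show "a = 0"
      proof (cases "neval P ?t = 0")
        case True
        then show ?thesis using fa conj[of P] inj[OF a(1)] a(2) by simp
      next
        case False
        \<comment> \<open>The inverse is transferred to \<alpha> through a polynomial vanishing at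
          \<open>\<zeta> ^ 2\<close>; a zero of \<open>f'\<close> would then put \<open>k\<close>
          into the image of \<open>f\<close>.\<close>
        then obtain I where I: "neval I ?t * neval P ?t = 1" by (rule neval_inverse)
        have "neval (I * P + N) ?t = 0" by (simp add: neval_add neval_mult I N)
        then have "neval (I * P + N) \<alpha> = 0" by (rule conj)
        then have I': "neval I \<alpha> * neval P \<alpha> = 1" by (simp add: neval_add neval_mult N)
        have "neval P \<alpha> * k = f (- w)" unfolding W_minus(2)[OF a(1)] using fa by (simp add: eq_neg_iff_add_eq_0 add.commute)
        then have "k = neval I \<alpha> * f (- w)" using I' by (metis mult.assoc mult_1)
        then have "k = f (neval I ?t * (- w))" using nev[OF W_minus(1)[OF a(1)], of I] by simp
        then have "k \<in> f ` W" using nev[OF W_minus(1)[OF a(1)], of I] by blast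
        then show ?thesis using k(2) by simp
      qed
    qed
    then have "card W' \<le> card W" using max[of "(W', f')"] by (simp add: Wf)
    moreover have "W \<subset> W'"
    proof
      show "W \<subseteq> W'"
      proof
        fix w assume "w \<in> W"
        then have "w + neval 0 ?t * v \<in> W'" unfolding W'_def by blast
        then show "w \<in> W'" by (simp add: neval_0)
      qed
      have "0 + neval 1 ?t * v \<in> W'" unfolding W'_def using W0 by blast
      then show "W \<noteq> W'" using v(2) by (auto simp: neval_one)
    qed
    moreover have "finite W'" using \<open>good (W', f')\<close> finite_V by (auto simp: good_def intro: finite_subset)
    ultimately show False using psubset_card_mono[of W' W] by simp
  qed
  then show ?thesis using f fK inj by (intro that[OF \<alpha>, of f]) auto
qed

end

section \<open>The faithful subfield generated by a ratio of linear forms, and the value of the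
  essential dimension\<close>

context gnp_rep
begin

text \<open>A relation with nonzero coefficient at \<open>h\<close> could be solved for
  \<open>x h\<close>, which is transcendental over the field of the other variables.\<close>

lemma linear_indep_x:
  assumes a: "\<And>h. h \<in> G \<Longrightarrow> a h \<in> K" and 0: "(\<Sum>h\<in>G. a h * x h) = 0" and h: "h \<in> G"
  shows "a h = 0"
proof (rule ccontr)
  assume nz: "a h \<noteq> 0"
  let ?M = "gen_subfield (K \<union> x ` (G - {h}))"
  have M: "is_subfield ?M" "K \<subseteq> ?M" "x ` (G - {h}) \<subseteq> ?M"
    using is_subfield_gen_subfield gen_subfield_superset[of "K \<union> x ` (G - {h})"] by auto
  have "(\<Sum>h\<in>G. a h * x h) = a h * x h + (\<Sum>j\<in>G - {h}. a j * x j)" by (rule sum.remove[OF finite_G h])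
  then have "x h = - (\<Sum>j\<in>G - {h}. a j * x j) / a h" using 0 nz by (simp add: field_simps eq_neg_iff_add_eq_0)
  moreover have "(\<Sum>j\<in>G - {h}. a j * x j) \<in> ?M"
    using M a by (intro subfield_sum[OF M(1)] subfield_mult[OF M(1)]) auto
  ultimately have "x h \<in> ?M" using a[OF h] M by (auto intro!: subfield_divide[OF M(1)] subfield_uminus[OF M(1)])
  moreover have "transcendental_over ?M (x h)"
  proof (rule alg_indep_insertD[OF K])
    have "insert (x h) (x ` (G - {h})) = x ` G" using h by auto
    then show "alg_indep K (insert (x h) (x ` (G - {h})))" using indep_x by simp
    show "x h \<notin> x ` (G - {h})" using inj_x h by (auto simp: inj_on_def)
  qed
  ultimately show False using transcendental_over_notin[OF M(1)] by blast
qed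

lemma affine_subfield:
  assumes n: "odd n" and z: "z \<in> K" "primitive_root z n" and deg: "fp_degree_ge K r"
  shows "\<exists>E. faithful_G_subfield K G mone x \<sigma> E \<and> trdeg_is K E 1"
proof -
  obtain \<alpha> f where \<alpha>: "\<alpha> \<in> K" "\<alpha> ^ n = 1" and f: "semilinear_on (\<zeta> ^ 2) \<alpha> V f" and fK: "\<And>v. v \<in> V \<Longrightarrow> f v \<in> K"
    and f_inj: "\<And>v. v \<in> V \<Longrightarrow> f v = 0 \<Longrightarrow> v = 0"
    by (rule injective_semilinear[OF z deg]) (rule that)
  have f_add: "f (v + w) = f v + f w" if "v \<in> V" "w \<in> V" for v w using f that by (auto simp: semilinear_on_def)
  have f_pow: "f (\<zeta> ^ (2 * k) * v) = \<alpha> ^ k * f v" if "v \<in> V" for v k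
  proof (induction k)
    case (Suc k)
    have "f (\<zeta> ^ 2 * (\<zeta> ^ (2 * k) * v)) = \<alpha> * f (\<zeta> ^ (2 * k) * v)"
      using f V_zeta[OF that, of k] unfolding semilinear_on_def by blast
    moreover have "\<zeta> ^ 2 * (\<zeta> ^ (2 * k) * v) = \<zeta> ^ (2 * Suc k) * v" by (simp add: power2_eq_square mult.assoc)
    ultimately show ?case using Suc by simp
  qed simp
  have \<alpha>_nz: "\<alpha> \<noteq> 0" using \<alpha>(2) n_pos by (auto simp: zero_power)
  text \<open>The image of \<open>0\<close> under the affine map by which \<open>h\<close> acts on \<open>K\<close>.\<close>
  define c where "c h = f (fst (fst h) * snd (fst h))" for h :: "'l mat2"
  have c_el: "c (el k v) = \<alpha> ^ k * f v" if "v \<in> V" for k v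
  proof -
    have "\<zeta> ^ k * (\<zeta> ^ k * v) = \<zeta> ^ (2 * k) * v" by (simp add: mult_2 power_add mult.assoc)
    moreover have "c (el k v) = f (\<zeta> ^ k * (\<zeta> ^ k * v))" by (simp add: c_def el_def)
    ultimately show ?thesis by (simp only: f_pow[OF that])
  qed
  have cK: "c h \<in> K" if "h \<in> G" for h
    using that c_el fK \<alpha>(1) by (auto simp: G_eq intro!: subfield_mult[OF K] subfield_power[OF K])
  \<comment> \<open>The composition rule of affine maps: \<open>el k v\<close> acts on
    \<open>K\<close> with linear part \<open>\<alpha> ^ k\<close> and constant part
    \<open>c (el k v)\<close>.\<close>
  have c_mult: "c (mmul (el k v) h) = \<alpha> ^ k * c h + c (el k v)" if v: "v \<in> V" and h: "h \<in> G" for k v h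
  proof -
    obtain j w where w: "w \<in> V" "h = el j w" using h by (auto simp: G_eq)
    define v' where "v' = inverse (\<zeta> ^ (2 * j)) * v"
    have v': "v' \<in> V" unfolding v'_def by (rule V_zeta_inv[OF v])
    have "\<zeta> ^ (2 * j) * v' = v" using zeta_nz by (simp add: v'_def)
    then have "f v = \<alpha> ^ j * f v'" using f_pow[OF v', of j] by simp
    moreover have "mmul (el k v) h = el (k + j) (w + v')" by (simp add: w(2) el_mult v'_def)
    ultimately show ?thesis
      using c_el[OF V_add[OF w(1) v'], of "k + j", unfolded f_add[OF w(1) v']] c_el[OF w(1), of j] c_el[OF v, of k]
      by (simp add: w(2) power_add algebra_simps)
  qed
  \<comment> \<open>The group fixes \<open>w\<close> and, by the composition rule for
    \<open>c\<close>, maps \<open>u\<close> to a combination of \<open>u\<close> and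
    \<open>w\<close>. So \<open>t\<close> is transformed by the inverses of the affine maps.\<close>
  define u where "u = (\<Sum>h\<in>G. c h * x h)"
  define w where "w = (\<Sum>h\<in>G. x h)"
  define t where "t = u / w"
  have uw: "u \<in> KX" "w \<in> KX" unfolding u_def w_def
    using KX cK by (auto intro!: subfield_sum[OF KX(1)] subfield_mult[OF KX(1)])
  have "w \<noteq> 0" using linear_indep_x[of "\<lambda>_. 1", OF _ _ G_one] subfield_1[OF K] by (auto simp: w_def)
  have tKX: "t \<in> KX" unfolding t_def using uw by (rule subfield_divide[OF KX(1)])
  obtain v0 where v0: "v0 \<in> V" "v0 \<noteq> 0" by (rule nonzero_V)
  have "t \<notin> K"
  proof
    assume tK: "t \<in> K"
    have "u - t * w = 0" using \<open>w \<noteq> 0\<close> by (simp add: t_def)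
    then have "(\<Sum>h\<in>G. (c h - t) * x h) = 0"
      by (simp add: u_def w_def sum_distrib_left left_diff_distrib sum_subtractf)
    then have "c h = t" if "h \<in> G" for h
      using linear_indep_x[of "\<lambda>h. c h - t", OF _ _ that] cK tK subfield_diff[OF K] by auto
    then have "c (el 0 0) = c (el 0 v0)" using el_in_G[OF V_0, of 0] el_in_G[OF v0(1), of 0] by simp
    then have "f v0 = 0" using c_el[OF V_0, of 0] c_el[OF v0(1), of 0] semilinear_on_0[OF f] by simp
    then show False using f_inj v0 by blast
  qed
  then have t: "transcendental_over K t"
    using algebraic_in_gen_subfield[OF K finite_imageI[OF finite_G] indep_x tKX] by blast
  have reindex: "(\<Sum>h\<in>G. F (mmul g h)) = (\<Sum>h\<in>G. F h)" if g: "g \<in> G" for g and F :: "'l mat2 \<Rightarrow> 'f"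
  proof -
    obtain g' where g': "g' \<in> G" "mmul g g' = mone" "mmul g' g = mone" by (rule G_inverse[OF g])
    show ?thesis
      by (rule sum.reindex_bij_witness[of _ "mmul g'" "mmul g"])
        (use g g' in \<open>auto simp: G_mult mmul_mone simp flip: mmul_assoc\<close>)
  qed
  have \<sigma>t: "\<sigma> (el k v) t = (t - \<alpha> ^ k * f v) / \<alpha> ^ k" if v: "v \<in> V" for k v
  proof -
    let ?g = "el k v"
    have g: "?g \<in> G" by (rule el_in_G[OF v])
    note hom = sigma_hom[OF g]
    have "\<sigma> ?g w = (\<Sum>h\<in>G. x (mmul ?g h))"
      unfolding w_def using KX(3) sigma_x[OF g] by (simp add: subfield_hom_sum[OF KX(1) hom])
    then have \<sigma>w: "\<sigma> ?g w = w" unfolding w_def using reindex[OF g, of x] by simp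
    have "\<sigma> ?g u = (\<Sum>h\<in>G. c h * x (mmul ?g h))"
      unfolding u_def using KX cK sigma_x[OF g] sigma_K[OF g]
      by (subst subfield_hom_sum[OF KX(1) hom]) (auto simp: subfield_hom_mult[OF KX(1) hom] subset_iff intro!: subfield_mult[OF KX(1)])
    then have "\<alpha> ^ k * \<sigma> ?g u = (\<Sum>h\<in>G. (c (mmul ?g h) - c ?g) * x (mmul ?g h))"
      by (simp add: sum_distrib_left c_mult[OF v] mult.assoc)
    also have "\<dots> = (\<Sum>h\<in>G. (c h - c ?g) * x h)" by (rule reindex[OF g])
    also have "\<dots> = u - c ?g * w" by (simp add: u_def w_def sum_distrib_left left_diff_distrib sum_subtractf)
    finally have "\<sigma> ?g u = (u - c ?g * w) / \<alpha> ^ k" using \<alpha>_nz by (simp add: field_simps)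
    then have "\<sigma> ?g t = (u - c ?g * w) / \<alpha> ^ k / w"
      unfolding t_def by (simp add: subfield_hom_divide[OF KX(1) hom uw] \<sigma>w)
    then show ?thesis using \<open>w \<noteq> 0\<close> c_el[OF v, of k] by (simp add: t_def field_simps)
  qed
  let ?E = "gen_subfield (insert t K)"
  have E: "is_subfield ?E" "t \<in> ?E" "K \<subseteq> ?E" using is_subfield_gen_subfield gen_subfield_superset[of "insert t K"] by auto
  have "faithful_G_subfield K G mone x \<sigma> ?E"
    unfolding faithful_G_subfield_def
  proof (intro conjI ballI impI)
    show "?E \<subseteq> KX" using tKX KX by (intro gen_subfield_least[OF KX(1)]) auto
    fix g assume g: "g \<in> G"
    then obtain k v where v: "v \<in> V" "g = el k v" by (auto simp: G_eq)
    have "\<sigma> g t \<in> ?E" unfolding v(2) \<sigma>t[OF v(1)] using E \<alpha>(1) fK[OF v(1)]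
      by (intro subfield_divide[OF E(1)] subfield_diff[OF E(1)] subfield_mult[OF E(1)] subfield_power[OF E(1)]) auto
    then have "gen_subfield (insert (\<sigma> g t) K) \<subseteq> ?E" using E by (intro gen_subfield_least[OF E(1)]) auto
    then show "\<sigma> g ` ?E \<subseteq> ?E"
      using subfield_hom_simple_extension[OF KX(1) sigma_hom[OF g] K KX(2) sigma_K[OF g] tKX] by blast
    assume "g \<noteq> mone"
    have "\<sigma> g t \<noteq> t"
    proof
      assume "\<sigma> g t = t"
      then have "t - \<alpha> ^ k * f v = \<alpha> ^ k * t" using \<sigma>t[OF v(1), of k] v(2) \<alpha>_nz by (simp add: field_simps)
      then have "1 * t + (- (\<alpha> ^ k * f v)) = \<alpha> ^ k * t + 0" by simp
      then have "1 = \<alpha> ^ k \<and> - (\<alpha> ^ k * f v) = 0"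
        by (rule transcendental_affine_eq[OF K t, rotated -1])
          (use \<alpha>(1) fK[OF v(1)] in \<open>auto intro!: subfield_closed[OF K]\<close>)
      then have ak: "\<alpha> ^ k = 1" and "f v = 0" using \<alpha>_nz by auto
      then have "v = 0" using f_inj v(1) by blast
      \<comment> \<open>Injectivity of \<open>f\<close> turns \<open>\<alpha> ^ k = 1\<close> into
        \<open>\<zeta> ^ (2 * k) = 1\<close>. Oddness of \<open>n\<close> is what allows the factor
        2 to be cancelled.\<close>
      have kV: "\<zeta> ^ (2 * k) * v0 \<in> V" by (rule V_zeta[OF v0(1)])
      have "f (\<zeta> ^ (2 * k) * v0 + - v0) = 0"
      proof -
        have "f (\<zeta> ^ (2 * k) * v0 + - v0) + f v0 = f (\<zeta> ^ (2 * k) * v0)"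
          using f_add[OF V_add[OF kV V_uminus[OF v0(1)]] v0(1)] by simp
        then show ?thesis using f_pow[OF v0(1), of k] ak by simp
      qed
      then have "\<zeta> ^ (2 * k) * v0 + - v0 = 0" using f_inj V_add[OF kV V_uminus[OF v0(1)]] by blast
      then have "\<zeta> ^ (2 * k) = 1" using v0(2) by simp
      then have "n dvd 2 * k" by (rule primitive_root_dvd[OF root n_pos])
      moreover have "coprime n 2" using n by simp
      ultimately have "n dvd k" by (simp add: coprime_dvd_mult_right_iff)
      then have "\<zeta> ^ k = 1" using zeta_n by (auto simp: power_mult elim!: dvdE)
      then have "g = mone" unfolding v(2) el_0[symmetric] el_inj using \<open>v = 0\<close> by simp
      with \<open>g \<noteq> mone\<close> show False by contradiction
    qed
    then show "\<exists>e\<in>?E. \<sigma> g e \<noteq> e" using E(2) by blast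
  qed (use E in auto)
  moreover have "trdeg_is K ?E 1"
    using trdeg_is_gen_subfield[OF K, of "{t}"] t by (simp add: alg_indep_singleton_iff[OF K])
  ultimately show ?thesis by blast
qed

text \<open>A subfield of transcendence degree 0 consists of elements algebraic over
  \<open>K\<close>, hence lies in \<open>K\<close>, where the nontrivial group acts
  trivially.\<close>

lemma not_faithful_trdeg_0:
  assumes "faithful_G_subfield K G mone x \<sigma> E" shows "\<not> trdeg_is K E 0"
proof
  assume trdeg: "trdeg_is K E 0"
  obtain v where v: "v \<in> V" "v \<noteq> 0" by (rule nonzero_V)
  have g: "el 0 v \<in> G" by (rule el_in_G[OF v(1)])
  have "el 0 v \<noteq> mone" using v(2) by (simp add: el_0[symmetric] el_inj)
  then obtain e where e: "e \<in> E" "\<sigma> (el 0 v) e \<noteq> e" using assms g unfolding faithful_G_subfield_def by blast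
  have "e \<in> KX" using assms e(1) unfolding faithful_G_subfield_def by blast
  then have "e \<in> K"
    using algebraic_in_gen_subfield[OF K finite_imageI[OF finite_G] indep_x] trdeg_is_0D[OF K trdeg e(1)] by blast
  then show False using e(2) sigma_K[OF g] by simp
qed

lemma faithful_KX: "faithful_G_subfield K G mone x \<sigma> KX"
  unfolding faithful_G_subfield_def
proof (intro conjI ballI impI)
  fix g assume g: "g \<in> G"
  show "\<sigma> g ` KX \<subseteq> KX" using sigma_in[OF g] by blast
  assume "g \<noteq> mone"
  then have "\<sigma> g (x mone) \<noteq> x mone"
    using sigma_x[OF g G_one] inj_onD[OF inj_x _ g G_one] by (auto simp: mmul_mone)
  then show "\<exists>e\<in>KX. \<sigma> g e \<noteq> e" using KX(3)[OF G_one] by blast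
qed (use KX in auto)

text \<open>\<open>KX\<close> itself is faithful of finite transcendence degree, so the minimum is
  attained; as 0 never occurs, it is 1 exactly when a faithful subfield of degree 1 exists.\<close>

lemma ess_dim_eq_1_iff:
  "ess_dim K G mone x \<sigma> = 1 \<longleftrightarrow> odd n \<and> (\<exists>z\<in>K. primitive_root z n) \<and> fp_degree_ge K r"
proof
  let ?P = "\<lambda>d. \<exists>E. faithful_G_subfield K G mone x \<sigma> E \<and> trdeg_is K E d"
  assume "ess_dim K G mone x \<sigma> = 1"
  moreover have "?P (ess_dim K G mone x \<sigma>)"
    unfolding ess_dim_def
    by (rule LeastI[of ?P "card (x ` G)"])
      (use faithful_KX trdeg_is_gen_subfield[OF K finite_imageI[OF finite_G] indep_x] in blast)
  ultimately show "odd n \<and> (\<exists>z\<in>K. primitive_root z n) \<and> fp_degree_ge K r"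
    using faithful_trdeg_1_imp by auto
next
  assume "odd n \<and> (\<exists>z\<in>K. primitive_root z n) \<and> fp_degree_ge K r"
  then show "ess_dim K G mone x \<sigma> = 1"
    unfolding ess_dim_def
  proof (intro Least_equality)
    fix d assume "\<exists>E. faithful_G_subfield K G mone x \<sigma> E \<and> trdeg_is K E d"
    then have "d \<noteq> 0" using not_faithful_trdeg_0 by metis
    then show "1 \<le> d" by simp
  qed (use affine_subfield in blast)
qed

end

theorem theorem1p5:
  fixes p n r s :: nat
    and K :: "'f::field set"
    and \<zeta> :: "'l::field"
    and V :: "'l set"
    and x :: "'l mat2 \<Rightarrow> 'f"
    and \<sigma> :: "'l mat2 \<Rightarrow> 'f \<Rightarrow> 'f"
  assumes "prime p"
    and "CHAR('f) = p"
    and "is_subfield K"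
    and "CHAR('l) = p"
    and "alg_closed TYPE('l)"
    and "\<not> p dvd n"
    and "primitive_root \<zeta> n"
    and "fp_dim (gen_subfield {\<zeta> ^ 2}) s"
    and "s dvd r"
    and "r \<ge> 1"
    and "subspace_over (gen_subfield {\<zeta> ^ 2}) V"
    and "fp_dim V r"
    and "regular_setup K (Gnp \<zeta> V) mmul x \<sigma>"
  shows "ess_dim K (Gnp \<zeta> V) mone x \<sigma> = 1 \<longleftrightarrow>
           odd n \<and> (\<exists>z\<in>K. primitive_root z n) \<and> fp_degree_ge K r"
proof -
  interpret gnp_rep p n r s K \<zeta> V x \<sigma>
    by unfold_locales (fact assms)+
  show ?thesis by (rule ess_dim_eq_1_iff)
qed

end
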